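(* Let $g_1,\ldots,g_d\colon\mathbb{N}\to\mathbb{N}$ be computable, effectively contractive functions and $f_i=g_1\circ\cdots\circ g_i$ for $1\le i\le d$. Then the MSO theory of $\langle\mathbb{N};<,P_1,\ldots,P_d\rangle$, where $P_i=\{f_i(n):n\in\mathbb{N}\}$, is decidable.
   Context: A strictly increasing function $f\colon\mathbb{N}\to\mathbb{N}$ is effectively contractive if for every monoid morphism $h$ from $(\mathbb{N},+)$ into a finite monoid $M$, the sequence $\langle h(f(n+1)-f(n)-1)\rangle_{n\in\mathbb{N}}$ is ultimately periodic with a period and pre-period computable from $h$ and $M$. The MSO theory of $\langle\mathbb{N};<,P_1,\ldots,P_d\rangle$ is the set of monadic second-order sentences (first-order variables over $\mathbb{N}$, set variables over subsets of $\mathbb{N}$, $<$, $=$, $\in$, predicate symbols $P_i$) true in it; decidable means an algorithm decides truth of a given sentence. *)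

theory Defs
  imports "HOL-Algebra.Group" "HOL-Library.Nat_Bijection"
begin

text \<open>General recursive functions: the closure of the basic functions under
  composition, primitive recursion and regular minimisation.  An \<open>n\<close>-ary function is a
  function on lists of which only the values on lists of length \<open>n\<close> matter
  (rule \<open>ext\<close>).\<close>

inductive recursive :: "nat \<Rightarrow> (nat list \<Rightarrow> nat) \<Rightarrow> bool" where
  zero: "recursive n (\<lambda>xs. 0)"
| suc: "recursive 1 (\<lambda>xs. Suc (hd xs))"
| proj: "i < n \<Longrightarrow> recursive n (\<lambda>xs. xs ! i)"
| comp: "recursive (length gs) f \<Longrightarrow> \<forall>g\<in>set gs. recursive n g \<Longrightarrow>
    recursive n (\<lambda>xs. f (map (\<lambda>g. g xs) gs))"
| prec: "recursive n f \<Longrightarrow> recursive (Suc (Suc n)) g \<Longrightarrow>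
    recursive (Suc n)
      (\<lambda>xs. rec_nat (f (tl xs)) (\<lambda>k r. g (k # r # tl xs)) (hd xs))"
| mu: "recursive (Suc n) f \<Longrightarrow> \<forall>xs. length xs = n \<longrightarrow> (\<exists>k. f (k # xs) = 0) \<Longrightarrow>
    recursive n (\<lambda>xs. LEAST k. f (k # xs) = 0)"
| ext: "recursive n f \<Longrightarrow> \<forall>xs. length xs = n \<longrightarrow> f xs = g xs \<Longrightarrow> recursive n g"

definition computable :: "(nat \<Rightarrow> nat) \<Rightarrow> bool" where
  "computable f \<longleftrightarrow> recursive 1 (\<lambda>xs. f (hd xs))"


definition nat_add_monoid :: "nat monoid" where
  "nat_add_monoid = \<lparr>carrier = UNIV, monoid.mult = (+), one = 0\<rparr>"

definition monoid_morphism :: "('a, 'c) monoid_scheme \<Rightarrow> ('b, 'd) monoid_scheme \<Rightarrow> ('a \<Rightarrow> 'b) \<Rightarrow> bool" where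
  "monoid_morphism M N h \<longleftrightarrow>
    monoid M \<and> monoid N \<and> h \<in> hom M N \<and> h \<one>\<^bsub>M\<^esub> = \<one>\<^bsub>N\<^esub>"

text \<open>To be the input of an algorithm, a finite monoid has to be presented by finite
  data: up to isomorphism its carrier is \<open>{..<m}\<close>, and then it is given by \<open>m\<close>, its
  unit and its multiplication table (row by row).  A morphism \<open>h\<close> from the additive
  monoid of the natural numbers is determined by the element \<open>h 1\<close>.\<close>

definition morphism_code :: "nat monoid \<Rightarrow> (nat \<Rightarrow> nat) \<Rightarrow> nat" where
  "morphism_code M h = (let m = card (carrier M) in
    list_encode (m # \<one>\<^bsub>M\<^esub> # h 1 #
      map (\<lambda>(x, y). x \<otimes>\<^bsub>M\<^esub> y) (List.product [0..<m] [0..<m])))"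

definition ultimately_periodic_with :: "nat \<Rightarrow> nat \<Rightarrow> (nat \<Rightarrow> 'a) \<Rightarrow> bool" where
  "ultimately_periodic_with k p s \<longleftrightarrow> p > 0 \<and> (\<forall>n\<ge>k. s (n + p) = s n)"

definition effectively_contractive :: "(nat \<Rightarrow> nat) \<Rightarrow> bool" where
  "effectively_contractive f \<longleftrightarrow> strict_mono f \<and>
    (\<exists>preperiod period. computable preperiod \<and> computable period \<and>
      (\<forall>(M :: nat monoid) m h.
        carrier M = {..<m} \<and> monoid_morphism nat_add_monoid M h \<longrightarrow>
        ultimately_periodic_with
          (preperiod (morphism_code M h)) (period (morphism_code M h))
          (\<lambda>n. h (f (n + 1) - f n - 1))))"


text \<open>First-order variables and set variables are two separate families, each indexed
  by the natural numbers; \<open>Pred i x\<close> is the atomic formula \<open>P\<^sub>i(x)\<close>.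
  The remaining connectives and the universal quantifiers are definable.\<close>

datatype mso =
    Less nat nat
  | Eq nat nat
  | Mem nat nat
  | Pred nat nat
  | Neg mso
  | Conj mso mso
  | Ex nat mso
  | ExSet nat mso

primrec sat :: "(nat \<Rightarrow> nat set) \<Rightarrow> (nat \<Rightarrow> nat) \<Rightarrow> (nat \<Rightarrow> nat set) \<Rightarrow> mso \<Rightarrow> bool" where
  "sat P e E (Less x y) \<longleftrightarrow> e x < e y"
| "sat P e E (Eq x y) \<longleftrightarrow> e x = e y"
| "sat P e E (Mem x X) \<longleftrightarrow> e x \<in> E X"
| "sat P e E (Pred i x) \<longleftrightarrow> e x \<in> P i"
| "sat P e E (Neg \<phi>) \<longleftrightarrow> \<not> sat P e E \<phi>"
| "sat P e E (Conj \<phi> \<psi>) \<longleftrightarrow> sat P e E \<phi> \<and> sat P e E \<psi>"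
| "sat P e E (Ex x \<phi>) \<longleftrightarrow> (\<exists>a. sat P (e(x := a)) E \<phi>)"
| "sat P e E (ExSet X \<phi>) \<longleftrightarrow> (\<exists>A. sat P e (E(X := A)) \<phi>)"

primrec free_fo :: "mso \<Rightarrow> nat set" where
  "free_fo (Less x y) = {x, y}"
| "free_fo (Eq x y) = {x, y}"
| "free_fo (Mem x X) = {x}"
| "free_fo (Pred i x) = {x}"
| "free_fo (Neg \<phi>) = free_fo \<phi>"
| "free_fo (Conj \<phi> \<psi>) = free_fo \<phi> \<union> free_fo \<psi>"
| "free_fo (Ex x \<phi>) = free_fo \<phi> - {x}"
| "free_fo (ExSet X \<phi>) = free_fo \<phi>"

primrec free_so :: "mso \<Rightarrow> nat set" where
  "free_so (Less x y) = {}"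
| "free_so (Eq x y) = {}"
| "free_so (Mem x X) = {X}"
| "free_so (Pred i x) = {}"
| "free_so (Neg \<phi>) = free_so \<phi>"
| "free_so (Conj \<phi> \<psi>) = free_so \<phi> \<union> free_so \<psi>"
| "free_so (Ex x \<phi>) = free_so \<phi>"
| "free_so (ExSet X \<phi>) = free_so \<phi> - {X}"

primrec pred_symbols :: "mso \<Rightarrow> nat set" where
  "pred_symbols (Less x y) = {}"
| "pred_symbols (Eq x y) = {}"
| "pred_symbols (Mem x X) = {}"
| "pred_symbols (Pred i x) = {i}"
| "pred_symbols (Neg \<phi>) = pred_symbols \<phi>"
| "pred_symbols (Conj \<phi> \<psi>) = pred_symbols \<phi> \<union> pred_symbols \<psi>"
| "pred_symbols (Ex x \<phi>) = pred_symbols \<phi>"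
| "pred_symbols (ExSet X \<phi>) = pred_symbols \<phi>"

definition mso_sentence :: "nat \<Rightarrow> mso \<Rightarrow> bool" where
  "mso_sentence d \<phi> \<longleftrightarrow>
    free_fo \<phi> = {} \<and> free_so \<phi> = {} \<and> pred_symbols \<phi> \<subseteq> {1..d}"

lemma sat_cong:
  assumes "\<And>x. x \<in> free_fo \<phi> \<Longrightarrow> e x = e' x" "\<And>X. X \<in> free_so \<phi> \<Longrightarrow> E X = E' X"
    and "\<And>i. i \<in> pred_symbols \<phi> \<Longrightarrow> P i = P' i"
  shows "sat P e E \<phi> \<longleftrightarrow> sat P' e' E' \<phi>"
  using assms
proof (induction \<phi> arbitrary: e e' E E')
  case (Conj \<phi> \<psi>)
  then show ?case
    by (metis UnCI free_fo.simps(6) free_so.simps(6) pred_symbols.simps(6) sat.simps(6))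
next
  case (Ex x \<phi>)
  have "sat P (e(x := a)) E \<phi> \<longleftrightarrow> sat P' (e'(x := a)) E' \<phi>" for a
    by (rule Ex.IH) (use Ex.prems in auto)
  then show ?case by simp
next
  case (ExSet X \<phi>)
  have "sat P e (E(X := A)) \<phi> \<longleftrightarrow> sat P' e' (E'(X := A)) \<phi>" for A
    by (rule ExSet.IH) (use ExSet.prems in auto)
  then show ?case by simp
qed auto

text \<open>By \<open>sat_cong\<close> the truth value of a sentence does not depend on the assignments.\<close>

definition mso_theory :: "nat \<Rightarrow> (nat \<Rightarrow> nat set) \<Rightarrow> mso set" where
  "mso_theory d P = {\<phi>. mso_sentence d \<phi> \<and> (\<forall>e E. sat P e E \<phi>)}"

primrec mso_code :: "mso \<Rightarrow> nat" where
  "mso_code (Less x y) = prod_encode (0, prod_encode (x, y))"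
| "mso_code (Eq x y) = prod_encode (1, prod_encode (x, y))"
| "mso_code (Mem x X) = prod_encode (2, prod_encode (x, X))"
| "mso_code (Pred i x) = prod_encode (3, prod_encode (i, x))"
| "mso_code (Neg \<phi>) = prod_encode (4, mso_code \<phi>)"
| "mso_code (Conj \<phi> \<psi>) = prod_encode (5, prod_encode (mso_code \<phi>, mso_code \<psi>))"
| "mso_code (Ex x \<phi>) = prod_encode (6, prod_encode (x, mso_code \<phi>))"
| "mso_code (ExSet X \<phi>) = prod_encode (7, prod_encode (X, mso_code \<phi>))"

lemma mso_code_inject: "mso_code \<phi> = mso_code \<psi> \<longleftrightarrow> \<phi> = \<psi>"
proof (induction \<phi> arbitrary: \<psi>)
  case (Less x y) show ?case by (cases \<psi>) auto
next
  case (Eq x y) show ?case by (cases \<psi>) auto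
next
  case (Mem x X) show ?case by (cases \<psi>) auto
next
  case (Pred i x) show ?case by (cases \<psi>) auto
next
  case (Neg \<phi>) then show ?case by (cases \<psi>) auto
next
  case (Conj \<phi>1 \<phi>2) then show ?case by (cases \<psi>) auto
next
  case (Ex x \<phi>) then show ?case by (cases \<psi>) auto
next
  case (ExSet X \<phi>) then show ?case by (cases \<psi>) auto
qed

definition mso_theory_decidable :: "nat \<Rightarrow> (nat \<Rightarrow> nat set) \<Rightarrow> bool" where
  "mso_theory_decidable d P \<longleftrightarrow>
    (\<exists>decide. computable decide \<and>
      (\<forall>\<phi>. mso_sentence d \<phi> \<longrightarrow>
        decide (mso_code \<phi>) = (if \<phi> \<in> mso_theory d P then 1 else 0)))"

end

theory Submission
  imports Defs "HOL-Library.Ramsey"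
begin

text \<open>
  Call a pair \<open>(s, e)\<close> with \<open>s e = s\<close>, \<open>e e = e\<close> a factorisation of an infinite word over a finite
  semigroup if the word can be cut into blocks with products \<open>s, e, e, \<dots>\<close>; by Ramsey's theorem one
  always exists. Every MSO formula is recognised by a finite semigroup, in the sense that the truth
  of the formula can be read off from any factorisation of the word of a valuation: products handle
  conjunction and the powerset semigroup handles quantification.

  So it suffices to compute, for every finite semigroup, a factorisation of the word \<open>\<alpha>\<close> with
  \<open>\<alpha>(n) = max {i. n \<in> P\<^sub>i}\<close>. If \<open>\<beta>\<close> is the word for \<open>g\<^sub>2, \<dots>, g\<^sub>d\<close>, then \<open>\<alpha>\<close> arises from \<open>\<beta>\<close> by replacing the
  \<open>n\<close>-th letter \<open>j\<close> with \<open>j + 1\<close> followed by \<open>g\<^sub>1(n + 1) - g\<^sub>1(n) - 1\<close> zeros, and by adding \<open>g\<^sub>1(0)\<close> leading zeros.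
  In a finite semigroup the blocks of zeros have ultimately periodic values by contractivity, so
  a factorisation of \<open>\<alpha>\<close> is obtained from one of \<open>\<beta>\<close> in the semigroup of maps that also track the
  position in the period.
\<close>

section \<open>Recursive functions with named arguments\<close>

text \<open>Each composition extends the previous one on the inside, so the sets P_i decrease with
  i, and one number per position records all the predicates.

  The word for fewer functions has to be factorised in a semigroup other than the given one, built
  from it and from the gaps of g_1. The induction therefore runs over factorisations that are
  computable uniformly in all tables.

  Complementation of automata is avoided: acceptance must be correct for every factorisation of a
  word, so negation only flips it. The price is paid at the quantifiers, where Ramsey's theorem is
  applied to a word of choices.

  Computability is proved for the recursive functions themselves. Objects on codes are obtained as
  the least number with a decidable property, while existence is shown with abstract finite
  semigroups. Since minimisation must be total, such properties carry premises that make them true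
  on meaningless input.\<close>

text \<open>Arguments are read from an environment, of which only finitely many entries matter; binding a
  variable then shifts the environment by one, as in the rules for recursion and quantifiers below.\<close>

definition recursive_env :: "nat \<Rightarrow> ((nat \<Rightarrow> nat) \<Rightarrow> nat) \<Rightarrow> bool" where
  "recursive_env n F \<longleftrightarrow> (\<forall>e e'. (\<forall>i<n. e i = e' i) \<longrightarrow> F e = F e') \<and>
     recursive n (\<lambda>xs. F (nth xs))"

definition recfun :: "((nat \<Rightarrow> nat) \<Rightarrow> nat) \<Rightarrow> bool" where
  "recfun F \<longleftrightarrow> (\<exists>n. recursive_env n F)"

lemma recursive_env_cong:
  "recursive_env n F \<Longrightarrow> (\<And>i. i < n \<Longrightarrow> e i = e' i) \<Longrightarrow> F e = F e'"
  unfolding recursive_env_def by blast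

lemma recursive_env_recursive: "recursive_env n F \<Longrightarrow> recursive n (\<lambda>xs. F (nth xs))"
  unfolding recursive_env_def by blast

text \<open>Surplus arguments are discarded by composing with projections.\<close>

lemma recursive_env_mono:
  assumes F: "recursive_env n F" and "n \<le> m"
  shows "recursive_env m F"
proof -
  let ?gs = "map (\<lambda>i xs. xs ! i) [0..<n] :: (nat list \<Rightarrow> nat) list"
  have "recursive m (\<lambda>xs. F (nth (map (\<lambda>g. g xs) ?gs)))"
    by (rule recursive.comp[where f = "\<lambda>xs. F (nth xs)"])
       (use recursive_env_recursive[OF F] assms(2) in \<open>auto intro: recursive.proj\<close>)
  moreover have "F (nth (map (\<lambda>g. g xs) ?gs)) = F (nth xs)" for xs
    by (rule recursive_env_cong[OF F]) simp
  ultimately have "recursive m (\<lambda>xs. F (nth xs))"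
    by (simp only:)
  moreover have "F e = F e'" if "\<forall>i<m. e i = e' i" for e e'
    by (rule recursive_env_cong[OF F]) (use that assms(2) in auto)
  ultimately show ?thesis
    unfolding recursive_env_def by blast
qed

lemma recfunE:
  assumes "recfun F"
  obtains n where "\<And>m. m \<ge> n \<Longrightarrow> recursive_env m F"
proof -
  obtain n where "recursive_env n F"
    using assms unfolding recfun_def ..
  then show thesis
    by (intro that) (rule recursive_env_mono)
qed

lemma recfunI:
  assumes "\<And>e e'. (\<And>i. i < n \<Longrightarrow> e i = e' i) \<Longrightarrow> F e = F e'" "recursive n (\<lambda>xs. F (nth xs))"
  shows "recfun F"
  unfolding recfun_def recursive_env_def using assms by blast

lemma recfun_subst:
  assumes "recfun G" "\<And>i. recfun (A i)"
  shows "recfun (\<lambda>e. G (\<lambda>i. A i e))"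
proof -
  obtain n where n: "recursive_env n G"
    using assms(1) unfolding recfun_def ..
  have "\<exists>k. recursive_env k (A i)" for i
    using assms(2) unfolding recfun_def .
  then obtain k where k: "\<And>i. recursive_env (k i) (A i)"
    using choice[of "\<lambda>i k. recursive_env k (A i)"] by auto
  \<comment> \<open>The sum is just a common upper bound for the arities \<open>k i\<close> with
    \<open>i < n\<close>.\<close>
  define N where "N = (\<Sum>i<n. k i)"
  have N: "recursive_env N (A i)" if "i < n" for i
    by (rule recursive_env_mono[OF k]) (use that in \<open>simp add: N_def member_le_sum\<close>)
  let ?gs = "map (\<lambda>i xs. A i (nth xs)) [0..<n]"
  have "recursive N (\<lambda>xs. G (nth (map (\<lambda>g. g xs) ?gs)))"
    by (rule recursive.comp[where f = "\<lambda>xs. G (nth xs)"])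
       (use recursive_env_recursive[OF n] recursive_env_recursive[OF N] in auto)
  moreover have "G (nth (map (\<lambda>g. g xs) ?gs)) = G (\<lambda>i. A i (nth xs))" for xs
    by (rule recursive_env_cong[OF n]) simp
  ultimately have rec: "recursive N (\<lambda>xs. G (\<lambda>i. A i (nth xs)))"
    by (simp only:)
  show ?thesis
  proof (rule recfunI[OF _ rec])
    fix e e' :: "nat \<Rightarrow> nat"
    assume "\<And>i. i < N \<Longrightarrow> e i = e' i"
    then have "A i e = A i e'" if "i < n" for i
      using recursive_env_cong[OF N[OF that]] by blast
    then show "G (\<lambda>i. A i e) = G (\<lambda>i. A i e')"
      by (rule recursive_env_cong[OF n])
  qed
qed

lemma recfun_var: "recfun (\<lambda>e. e i)"
  by (rule recfunI[of "Suc i"]) (auto intro: recursive.proj)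

lemma recfun_zero: "recfun (\<lambda>e. 0)"
  by (rule recfunI[of 0]) (auto intro: recursive.zero)

lemma recfun_computable_iff: "computable f \<longleftrightarrow> recfun (\<lambda>e. f (e 0))"
proof
  assume "computable f"
  then have "recursive 1 (\<lambda>xs. f (hd xs))"
    by (simp add: computable_def)
  then have "recursive 1 (\<lambda>xs. f (xs ! 0))"
    by (rule recursive.ext) (auto simp: length_Suc_conv)
  then show "recfun (\<lambda>e. f (e 0))"
    by (rule recfunI[rotated]) auto
next
  assume "recfun (\<lambda>e. f (e 0))"
  then obtain n where "\<And>m. m \<ge> n \<Longrightarrow> recursive_env m (\<lambda>e. f (e 0))"
    by (rule recfunE) blast
  from recursive_env_recursive[OF this]
  have n: "\<And>m. m \<ge> n \<Longrightarrow> recursive m (\<lambda>xs. f (xs ! 0))" .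
  \<comment> \<open>The arity obtained need not be one, so the single argument is copied into
    \<open>Suc n\<close> places; the successor guarantees that place 0 exists.\<close>
  have "recursive 1 (\<lambda>xs. f (map (\<lambda>g. g xs) (replicate (Suc n) (\<lambda>xs. xs ! 0)) ! 0))"
    by (rule recursive.comp[where f = "\<lambda>xs. f (xs ! 0)"])
       (use n[of "Suc n"] in \<open>auto intro: recursive.proj\<close>)
  then show "computable f"
    unfolding computable_def by (rule recursive.ext) (auto simp: length_Suc_conv)
qed

lemma recfun_app1: "recfun (\<lambda>e. f (e 0)) \<Longrightarrow> recfun A \<Longrightarrow> recfun (\<lambda>e. f (A e))"
  using recfun_subst[of "\<lambda>e. f (e 0)" "\<lambda>i. A"] by simp

lemma recfun_app2:
  assumes "recfun (\<lambda>e. f (e 0) (e (Suc 0)))" "recfun A" "recfun B"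
  shows "recfun (\<lambda>e. f (A e) (B e))"
  using recfun_subst[OF assms(1), of "\<lambda>i. if i = 0 then A else B"] assms by simp

lemma recfun_app3:
  assumes "recfun (\<lambda>e. f (e 0) (e (Suc 0)) (e (Suc (Suc 0))))" "recfun A" "recfun B" "recfun C"
  shows "recfun (\<lambda>e. f (A e) (B e) (C e))"
  using recfun_subst[OF assms(1), of "\<lambda>i. if i = 0 then A else if i = Suc 0 then B else C"] assms
  by simp

lemma recfun_Suc: "recfun A \<Longrightarrow> recfun (\<lambda>e. Suc (A e))"
proof (rule recfun_app1[where f = Suc])
  have "recursive 1 (\<lambda>xs. Suc (xs ! 0))"
    by (rule recursive.ext[OF recursive.suc]) (auto simp: length_Suc_conv)
  then show "recfun (\<lambda>e. Suc (e 0))"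
    by (rule recfunI[rotated]) auto
qed

lemma recfun_const: "recfun (\<lambda>e. c)"
  by (induction c) (auto intro: recfun_zero recfun_Suc)

lemma recfun_rec_nat:
  assumes G: "recfun (\<lambda>e. G (e 0) (e (Suc 0)) (\<lambda>i. e (Suc (Suc i))))"
    and B: "recfun B" and A: "recfun A"
  shows "recfun (\<lambda>e. rec_nat (B e) (\<lambda>k r. G k r e) (A e))"
proof -
  obtain n where n: "\<And>m. m \<ge> n \<Longrightarrow> recursive_env m (\<lambda>e. G (e 0) (e (Suc 0)) (\<lambda>i. e (Suc (Suc i))))"
    by (rule recfunE[OF G]) blast
  obtain k where k: "\<And>m. m \<ge> k \<Longrightarrow> recursive_env m B"
    by (rule recfunE[OF B]) blast
  define m where "m = max n k"
  note nm = n[of "Suc (Suc m)"]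
  have G_cong: "G x r e = G x r e'" if "\<And>i. i < m \<Longrightarrow> e i = e' i" for x r e e'
    using recursive_env_cong[OF nm,
        of "\<lambda>i. case i of 0 \<Rightarrow> x | Suc 0 \<Rightarrow> r | Suc (Suc j) \<Rightarrow> e j"
        "\<lambda>i. case i of 0 \<Rightarrow> x | Suc 0 \<Rightarrow> r | Suc (Suc j) \<Rightarrow> e' j"] that
    by (simp add: m_def split: nat.splits)
  have "recursive (Suc m) (\<lambda>xs. rec_nat (B (nth (tl xs)))
      (\<lambda>k r. (\<lambda>xs. G (xs ! 0) (xs ! Suc 0) (\<lambda>i. xs ! Suc (Suc i))) (k # r # tl xs)) (hd xs))"
    by (rule recursive.prec)
       (use recursive_env_recursive[OF nm] recursive_env_recursive[OF k[of m]] in \<open>auto simp: m_def\<close>)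
  then have rec: "recursive (Suc m) (\<lambda>xs. rec_nat (B (\<lambda>i. xs ! Suc i))
      (\<lambda>k r. G k r (\<lambda>i. xs ! Suc i)) (xs ! 0))"
    by (rule recursive.ext) (auto simp: length_Suc_conv)
  \<comment> \<open>The counter is variable 0 at this stage and the remaining environment is
    shifted; the substitution at the end puts \<open>A\<close> in its place and undoes the
    shift.\<close>
  have "recfun (\<lambda>e. rec_nat (B (\<lambda>i. e (Suc i))) (\<lambda>k r. G k r (\<lambda>i. e (Suc i))) (e 0))"
  proof (rule recfunI[OF _ rec])
    fix e e' :: "nat \<Rightarrow> nat"
    assume *: "\<And>i. i < Suc m \<Longrightarrow> e i = e' i"
    have "B (\<lambda>i. e (Suc i)) = B (\<lambda>i. e' (Suc i))"
      by (rule recursive_env_cong[OF k[of m]]) (auto simp: m_def intro!: *)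
    moreover have "G x r (\<lambda>i. e (Suc i)) = G x r (\<lambda>i. e' (Suc i))" for x r
      by (rule G_cong) (use * in auto)
    ultimately show "rec_nat (B (\<lambda>i. e (Suc i))) (\<lambda>k r. G k r (\<lambda>i. e (Suc i))) (e 0) =
        rec_nat (B (\<lambda>i. e' (Suc i))) (\<lambda>k r. G k r (\<lambda>i. e' (Suc i))) (e' 0)"
      using *[of 0] by simp
  qed
  from recfun_subst[OF this, of "\<lambda>i. case i of 0 \<Rightarrow> A | Suc j \<Rightarrow> \<lambda>e. e j"]
  show ?thesis
    using A by (simp add: recfun_var split: nat.splits)
qed

definition decpred :: "((nat \<Rightarrow> nat) \<Rightarrow> bool) \<Rightarrow> bool" where
  "decpred P \<longleftrightarrow> recfun (\<lambda>e. of_bool (P e))"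

lemma recfun_if:
  assumes "decpred P" "recfun A" "recfun B"
  shows "recfun (\<lambda>e. if P e then A e else B e)"
proof -
  \<comment> \<open>A case distinction is a recursion with at most one step: counter 0 returns the
    start value, counter 1 the value of the step.\<close>
  have "recfun (\<lambda>e. rec_nat (e (Suc 0)) (\<lambda>k r. e (Suc (Suc 0))) (e 0))"
    by (intro recfun_rec_nat recfun_var)
  from recfun_app3[OF this assms(1)[unfolded decpred_def] assms(3,2)]
  show ?thesis
    by (rule back_subst[of recfun]) auto
qed

text \<open>Regular minimisation requires a zero in every environment, hence the assumption
  \<open>ex\<close>.\<close>

lemma recfun_Least_zero:
  assumes F: "recfun (\<lambda>e. F (e 0) (\<lambda>i. e (Suc i)))" and ex: "\<And>e. \<exists>k. F k e = 0"
  shows "recfun (\<lambda>e. LEAST k. F k e = 0)"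
proof -
  obtain n where n: "\<And>m. m \<ge> n \<Longrightarrow> recursive_env m (\<lambda>e. F (e 0) (\<lambda>i. e (Suc i)))"
    by (rule recfunE[OF F]) blast
  note n = n[of "Suc n", simplified]
  have F_cong: "F x e = F x e'" if "\<And>i. i < n \<Longrightarrow> e i = e' i" for x e e'
    using recursive_env_cong[OF n, of "\<lambda>i. case i of 0 \<Rightarrow> x | Suc j \<Rightarrow> e j"
        "\<lambda>i. case i of 0 \<Rightarrow> x | Suc j \<Rightarrow> e' j"] that
    by (simp split: nat.splits)
  have "recursive n (\<lambda>xs. LEAST k. (\<lambda>xs. F (xs ! 0) (\<lambda>i. xs ! Suc i)) (k # xs) = 0)"
    by (rule recursive.mu) (use recursive_env_recursive[OF n] ex in auto)
  then have rec: "recursive n (\<lambda>xs. LEAST k. F k (nth xs) = 0)"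
    by simp
  show ?thesis
  proof (rule recfunI[OF _ rec])
    fix e e' :: "nat \<Rightarrow> nat"
    assume "\<And>i. i < n \<Longrightarrow> e i = e' i"
    then have "F k e = F k e'" for k
      by (rule F_cong)
    then show "(LEAST k. F k e = 0) = (LEAST k. F k e' = 0)"
      by simp
  qed
qed

lemma decpred_not:
  assumes "decpred P"
  shows "decpred (\<lambda>e. \<not> P e)"
proof -
  have "recfun (\<lambda>e. if P e then 0 else 1)"
    by (intro recfun_if assms recfun_const)
  moreover have "(\<lambda>e. if P e then 0 else 1) = (\<lambda>e. of_bool (\<not> P e) :: nat)"
    by auto
  ultimately show ?thesis
    unfolding decpred_def by simp
qed

lemma decpred_conj:
  assumes "decpred P" "decpred Q"
  shows "decpred (\<lambda>e. P e \<and> Q e)"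
proof -
  have "recfun (\<lambda>e. if P e then of_bool (Q e) else 0)"
    by (intro recfun_if assms recfun_const assms(2)[unfolded decpred_def])
  moreover have "(\<lambda>e. if P e then of_bool (Q e) else 0) = (\<lambda>e. of_bool (P e \<and> Q e) :: nat)"
    by auto
  ultimately show ?thesis
    unfolding decpred_def by simp
qed

lemma decpred_disj: "decpred P \<Longrightarrow> decpred Q \<Longrightarrow> decpred (\<lambda>e. P e \<or> Q e)"
  using decpred_not[OF decpred_conj[OF decpred_not[of P] decpred_not[of Q]]] by simp

lemma decpred_imp: "decpred P \<Longrightarrow> decpred Q \<Longrightarrow> decpred (\<lambda>e. P e \<longrightarrow> Q e)"
  unfolding imp_conv_disj by (intro decpred_disj decpred_not)

lemma decpred_const: "decpred (\<lambda>e. b)"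
  unfolding decpred_def by (rule recfun_const)

lemma decpred_iff: "decpred P \<Longrightarrow> decpred Q \<Longrightarrow> decpred (\<lambda>e. P e = Q e)"
  unfolding iff_conv_conj_imp[of "P _"] by (intro decpred_conj decpred_imp)

lemma recfun_Least:
  assumes "decpred (\<lambda>e. P (e 0) (\<lambda>i. e (Suc i)))" "\<And>e. \<exists>k. P k e"
  shows "recfun (\<lambda>e. LEAST k. P k e)"
  using recfun_Least_zero[where F = "\<lambda>k e. of_bool (\<not> P k e)",
      OF decpred_not[OF assms(1), unfolded decpred_def]] assms(2)
  by simp

lemma recfun_pred: "recfun A \<Longrightarrow> recfun (\<lambda>e. A e - 1)"
proof (rule recfun_app1[where f = "\<lambda>x. x - 1"])
  have "rec_nat 0 (\<lambda>k r. k) n = n - 1" for n :: nat by (cases n) auto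
  moreover have "recfun (\<lambda>e. rec_nat 0 (\<lambda>k r. k) (e 0))"
    by (intro recfun_rec_nat recfun_var recfun_const)
  ultimately show "recfun (\<lambda>e. e 0 - 1)" by simp
qed

lemma recfun_add: "recfun A \<Longrightarrow> recfun B \<Longrightarrow> recfun (\<lambda>e. A e + B e)"
proof (rule recfun_app2[where f = "(+)"])
  have "rec_nat n (\<lambda>k r. Suc r) m = m + n" for m n :: nat by (induction m) auto
  moreover have "recfun (\<lambda>e. rec_nat (e (Suc 0)) (\<lambda>k r. Suc r) (e 0))"
    by (intro recfun_rec_nat recfun_var recfun_Suc)
  ultimately show "recfun (\<lambda>e. e 0 + e (Suc 0))" by simp
qed

lemma recfun_mult: "recfun A \<Longrightarrow> recfun B \<Longrightarrow> recfun (\<lambda>e. A e * B e)"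
proof (rule recfun_app2[where f = "\<lambda>x y. x * y"])
  have "rec_nat 0 (\<lambda>k r. r + n) m = m * n" for m n :: nat by (induction m) auto
  moreover have "recfun (\<lambda>e. rec_nat 0 (\<lambda>k r. r + e (Suc 0)) (e 0))"
    by (intro recfun_rec_nat recfun_var recfun_add recfun_const)
  ultimately show "recfun (\<lambda>e. e 0 * e (Suc 0))" by simp
qed

lemma recfun_diff: "recfun A \<Longrightarrow> recfun B \<Longrightarrow> recfun (\<lambda>e. A e - B e)"
proof (rule recfun_app2[where f = "(-)"])
  have "rec_nat m (\<lambda>k r. r - 1) n = m - n" for m n :: nat by (induction n) auto
  moreover have "recfun (\<lambda>e. rec_nat (e 0) (\<lambda>k r. r - 1) (e (Suc 0)))"
    by (intro recfun_rec_nat recfun_var recfun_pred)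
  ultimately show "recfun (\<lambda>e. e 0 - e (Suc 0))" by simp
qed

lemma recfun_power: "recfun A \<Longrightarrow> recfun B \<Longrightarrow> recfun (\<lambda>e. A e ^ B e)"
proof (rule recfun_app2[where f = "(^)"])
  have "rec_nat 1 (\<lambda>k r. m * r) n = m ^ n" for m n :: nat by (induction n) auto
  moreover have "recfun (\<lambda>e. rec_nat 1 (\<lambda>k r. e 0 * r) (e (Suc 0)))"
    by (intro recfun_rec_nat recfun_var recfun_mult recfun_const)
  ultimately show "recfun (\<lambda>e. e 0 ^ e (Suc 0))" by simp
qed

lemma decpred_zero: "recfun A \<Longrightarrow> decpred (\<lambda>e. A e = 0)"
proof -
  assume "recfun A"
  from recfun_diff[OF recfun_const[of 1] this] show ?thesis
    unfolding decpred_def by (rule back_subst[of recfun]) (auto simp: fun_eq_iff)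
qed

lemma decpred_le: "recfun A \<Longrightarrow> recfun B \<Longrightarrow> decpred (\<lambda>e. A e \<le> B e)"
  using decpred_zero[OF recfun_diff[of A B]] by simp

lemma decpred_less: "recfun A \<Longrightarrow> recfun B \<Longrightarrow> decpred (\<lambda>e. A e < B e)"
  using decpred_le[OF recfun_Suc[of A]] by (simp add: less_eq_Suc_le)

lemma decpred_eq: "recfun A \<Longrightarrow> recfun B \<Longrightarrow> decpred (\<lambda>e. A e = B e)"
  using decpred_conj[OF decpred_le[of A B] decpred_le[of B A]] by (simp add: order_eq_iff)

lemma decpred_subst:
  "decpred P \<Longrightarrow> (\<And>i. recfun (A i)) \<Longrightarrow> decpred (\<lambda>e. P (\<lambda>i. A i e))"
  unfolding decpred_def by (rule recfun_subst[where G = "\<lambda>e. of_bool (P e)"])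

text \<open>A bounded quantifier is a search that stops at the bound at the latest.\<close>

lemma decpred_all_less:
  assumes P: "decpred (\<lambda>e. P (e 0) (\<lambda>i. e (Suc i)))" and B: "recfun B"
  shows "decpred (\<lambda>e. \<forall>k<B e. P k e)"
proof -
  have "recfun (\<lambda>e. B (\<lambda>i. e (Suc i)))"
    by (rule recfun_subst[OF B]) (rule recfun_var)
  then have "decpred (\<lambda>e. e 0 = B (\<lambda>i. e (Suc i)) \<or> \<not> P (e 0) (\<lambda>i. e (Suc i)))"
    by (intro decpred_disj decpred_not decpred_eq recfun_var P)
  then have "recfun (\<lambda>e. LEAST k. k = B e \<or> \<not> P k e)"
    by (rule recfun_Least[where P = "\<lambda>k e. k = B e \<or> \<not> P k e"]) auto
  then have "decpred (\<lambda>e. (LEAST k. k = B e \<or> \<not> P k e) = B e)"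
    by (intro decpred_eq B)
  moreover have "((LEAST k. k = B e \<or> \<not> P k e) = B e) = (\<forall>k<B e. P k e)" for e
  proof -
    let ?Q = "\<lambda>k. k = B e \<or> \<not> P k e"
    have "?Q (Least ?Q)" by (rule LeastI[of ?Q "B e"]) simp
    moreover have "Least ?Q \<le> B e" by (rule Least_le) simp
    moreover have "P k e" if "k < Least ?Q" for k
      using not_less_Least[OF that] by simp
    ultimately show ?thesis by (metis order_le_less)
  qed
  ultimately show ?thesis by simp
qed

lemma decpred_ex_less:
  assumes "decpred (\<lambda>e. P (e 0) (\<lambda>i. e (Suc i)))" "recfun B"
  shows "decpred (\<lambda>e. \<exists>k<B e. P k e)"
  using decpred_not[OF decpred_all_less[where P = "\<lambda>k e. \<not> P k e", OF decpred_not[OF assms(1)] assms(2)]]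
  by simp

lemmas rec_intros = recfun_var recfun_const recfun_Suc recfun_add recfun_mult recfun_diff
  recfun_power recfun_rec_nat recfun_if decpred_not decpred_conj decpred_disj decpred_imp
  decpred_const decpred_iff decpred_le decpred_less decpred_eq decpred_all_less decpred_ex_less

section \<open>Decoding pairs, lists and bit masks\<close>

lemma recfun_prod_encode: "recfun A \<Longrightarrow> recfun B \<Longrightarrow> recfun (\<lambda>e. prod_encode (A e, B e))"
proof (rule recfun_app2[where f = "\<lambda>x y. prod_encode (x, y)"])
  have *: "triangle n = rec_nat 0 (\<lambda>k r. r + Suc k) n" for n
    by (induction n) auto
  show "recfun (\<lambda>e. prod_encode (e 0, e (Suc 0)))"
    unfolding prod_encode_def case_prod_conv * by (intro rec_intros)
qed

text \<open>Inverting the pairing is a search in one component and a bounded search in the other,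
  since no component exceeds the code. By injectivity only one value qualifies, and
  \<open>LEAST\<close> merely names it.\<close>

lemma fst_prod_decode_Least:
  "fst (prod_decode z) = (LEAST x. (\<exists>y<Suc z. prod_encode (x, y) = z))"
proof -
  obtain x y where z: "z = prod_encode (x, y)"
    by (metis prod_decode_inverse surj_pair)
  have "y < Suc z"
    using z le_prod_encode_2[of y x] by simp
  then show ?thesis
    unfolding z by (intro Least_equality[symmetric]) auto
qed

lemma snd_prod_decode_Least:
  "snd (prod_decode z) = (LEAST y. (\<exists>x<Suc z. prod_encode (x, y) = z))"
proof -
  obtain x y where z: "z = prod_encode (x, y)"
    by (metis prod_decode_inverse surj_pair)
  have "x < Suc z"
    using z le_prod_encode_1[of x y] by simp
  then show ?thesis
    unfolding z by (intro Least_equality[symmetric]) auto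
qed

lemma recfun_fst_prod_decode: "recfun A \<Longrightarrow> recfun (\<lambda>e. fst (prod_decode (A e)))"
proof (rule recfun_app1[where f = "\<lambda>z. fst (prod_decode z)"])
  have "\<exists>x. \<exists>y<Suc z. prod_encode (x, y) = z" for z
    by (metis le_imp_less_Suc le_prod_encode_2 prod_decode_inverse surj_pair)
  then show "recfun (\<lambda>e. fst (prod_decode (e 0)))"
    unfolding fst_prod_decode_Least
    by (intro recfun_Least rec_intros recfun_prod_encode)
qed

lemma recfun_snd_prod_decode: "recfun A \<Longrightarrow> recfun (\<lambda>e. snd (prod_decode (A e)))"
proof (rule recfun_app1[where f = "\<lambda>z. snd (prod_decode z)"])
  have "\<exists>y. \<exists>x<Suc z. prod_encode (x, y) = z" for z
    by (metis le_imp_less_Suc le_prod_encode_1 prod_decode_inverse surj_pair)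
  then show "recfun (\<lambda>e. snd (prod_decode (e 0)))"
    unfolding snd_prod_decode_Least
    by (intro recfun_Least rec_intros recfun_prod_encode)
qed

text \<open>\<open>list_encode\<close> codes a nonempty list as the successor of the pair of its
  head and the code of its tail; hence the \<open>u - 1\<close>, here and in
  \<open>code_nth\<close>.\<close>

definition code_tl :: "nat \<Rightarrow> nat" where
  "code_tl u = (if u = 0 then 0 else snd (prod_decode (u - 1)))"

definition code_nth :: "nat \<Rightarrow> nat \<Rightarrow> nat" where
  "code_nth u i = fst (prod_decode (rec_nat u (\<lambda>k. code_tl) i - 1))"

definition code_length :: "nat \<Rightarrow> nat" where
  "code_length u = (LEAST i. rec_nat u (\<lambda>k. code_tl) i = 0)"

lemma code_tl_iterate: "rec_nat (list_encode xs) (\<lambda>k. code_tl) i = list_encode (drop i xs)"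
proof (induction i)
  case (Suc i)
  then show ?case
    by (cases "drop i xs") (auto simp: code_tl_def drop_Suc drop_tl)
qed auto

lemma code_nth_list_encode: "i < length xs \<Longrightarrow> code_nth (list_encode xs) i = xs ! i"
  by (simp add: code_nth_def code_tl_iterate Cons_nth_drop_Suc[symmetric])

lemma list_encode_eq_0_iff: "list_encode xs = 0 \<longleftrightarrow> xs = []"
  by (cases xs) auto

lemma code_length_list_encode: "code_length (list_encode xs) = length xs"
  unfolding code_length_def code_tl_iterate list_encode_eq_0_iff
  by (rule Least_equality) auto

lemma recfun_code_tl: "recfun A \<Longrightarrow> recfun (\<lambda>e. code_tl (A e))"
  unfolding code_tl_def by (intro rec_intros recfun_snd_prod_decode)

lemma recfun_code_nth: "recfun A \<Longrightarrow> recfun B \<Longrightarrow> recfun (\<lambda>e. code_nth (A e) (B e))"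
proof (rule recfun_app2[where f = code_nth])
  show "recfun (\<lambda>e. code_nth (e 0) (e (Suc 0)))"
    unfolding code_nth_def
    by (intro recfun_fst_prod_decode recfun_rec_nat recfun_diff recfun_code_tl recfun_var recfun_const)
qed

lemma recfun_code_length: "recfun A \<Longrightarrow> recfun (\<lambda>e. code_length (A e))"
proof (rule recfun_app1[where f = code_length])
  have "\<exists>i. rec_nat u (\<lambda>k. code_tl) i = 0" for u
    using code_tl_iterate[of "list_decode u" "length (list_decode u)"] by auto
  then show "recfun (\<lambda>e. code_length (e 0))"
    unfolding code_length_def by (intro recfun_Least rec_intros recfun_code_tl)
qed

definition lookup :: "nat \<Rightarrow> nat \<Rightarrow> nat \<Rightarrow> nat \<Rightarrow> nat" where
  "lookup u i x y = code_nth (code_nth (code_nth u i) x) y"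

lemma recfun_lookup:
  "recfun A \<Longrightarrow> recfun B \<Longrightarrow> recfun C \<Longrightarrow> recfun D \<Longrightarrow> recfun (\<lambda>e. lookup (A e) (B e) (C e) (D e))"
  unfolding lookup_def by (intro recfun_code_nth)

lemma ex_lookup: "\<exists>u. \<forall>i<l. \<forall>x<m. \<forall>y<n. lookup u i x y = f i x y"
proof -
  let ?u = "list_encode (map (\<lambda>i. list_encode (map (\<lambda>x. list_encode (map (f i x) [0..<n])) [0..<m])) [0..<l])"
  have "\<forall>i<l. \<forall>x<m. \<forall>y<n. lookup ?u i x y = f i x y"
    by (simp add: lookup_def code_nth_list_encode)
  then show ?thesis by blast
qed

lemma decpred_set_decode: "recfun A \<Longrightarrow> recfun B \<Longrightarrow> decpred (\<lambda>e. A e \<in> set_decode (B e))"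
proof -
  \<comment> \<open>This form of the bit test consists of bounded quantifiers over sums, products
    and powers.\<close>
  have mem: "v \<in> set_decode b \<longleftrightarrow> (\<exists>q<Suc b. \<exists>r<2 ^ v. b = (2 * q + 1) * 2 ^ v + r)" for v b
  proof
    assume "v \<in> set_decode b"
    then have odd: "odd (b div 2 ^ v)" by (simp add: set_decode_def)
    have "b = (b div 2 ^ v) * 2 ^ v + b mod 2 ^ v" by (rule div_mult_mod_eq[symmetric])
    moreover obtain q where q: "b div 2 ^ v = 2 * q + 1" using odd by (auto elim: oddE)
    moreover have "q < Suc b"
    proof -
      have "b div 2 ^ v \<le> b" by simp
      then show ?thesis using q by linarith
    qed
    moreover have "b mod 2 ^ v < 2 ^ v" by simp
    ultimately show "\<exists>q<Suc b. \<exists>r<2 ^ v. b = (2 * q + 1) * 2 ^ v + r" by metis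
  next
    assume "\<exists>q<Suc b. \<exists>r<2 ^ v. b = (2 * q + 1) * 2 ^ v + r"
    then obtain q r where "r < 2 ^ v" "b = (2 * q + 1) * 2 ^ v + r" by blast
    then have "b div 2 ^ v = 2 * q + 1" by (simp add: div_nat_eqI)
    then show "v \<in> set_decode b" by (simp add: set_decode_def)
  qed
  assume "recfun A" "recfun B"
  moreover have "decpred (\<lambda>e. e 0 \<in> set_decode (e (Suc 0)))"
    unfolding mem by (intro rec_intros)
  ultimately show ?thesis
    using decpred_subst[of "\<lambda>e. e 0 \<in> set_decode (e (Suc 0))" "\<lambda>i. if i = 0 then A else B"] by simp
qed

section \<open>Factorisations of infinite words\<close>

text \<open>The product of the letters at positions \<open>i\<close> to \<open>j - 1\<close> if
  \<open>i < j\<close>. A semigroup has no empty product, so the default for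
  \<open>j \<le> i\<close> is \<open>a i\<close>, which keeps \<open>seg_in\<close> and
  \<open>seg_hom\<close> free of side conditions.\<close>

primrec seg :: "('a \<Rightarrow> 'a \<Rightarrow> 'a) \<Rightarrow> (nat \<Rightarrow> 'a) \<Rightarrow> nat \<Rightarrow> nat \<Rightarrow> 'a" where
  "seg f a i 0 = a i"
| "seg f a i (Suc j) = (if j \<le> i then a i else f (seg f a i j) (a j))"

definition semigroup_on :: "'a set \<Rightarrow> ('a \<Rightarrow> 'a \<Rightarrow> 'a) \<Rightarrow> bool" where
  "semigroup_on X f \<longleftrightarrow> (\<forall>x\<in>X. \<forall>y\<in>X. f x y \<in> X) \<and>
     (\<forall>x\<in>X. \<forall>y\<in>X. \<forall>z\<in>X. f (f x y) z = f x (f y z))"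

text \<open>The word \<open>a\<close> is \<open>s e e e \<dots>\<close> after grouping letters at the positions in \<open>R\<close>. Asking for
  \<^emph>\<open>all\<close> pairs in \<open>R\<close> makes \<open>(s, e)\<close> a linked pair, i.e. \<open>s e = s\<close> and \<open>e e = e\<close>.\<close>

definition factor :: "('a \<Rightarrow> 'a \<Rightarrow> 'a) \<Rightarrow> (nat \<Rightarrow> 'a) \<Rightarrow> 'a \<Rightarrow> 'a \<Rightarrow> bool" where
  "factor f a s e \<longleftrightarrow> (\<exists>R. infinite R \<and> 0 \<notin> R \<and> (\<forall>x\<in>R. seg f a 0 x = s) \<and>
     (\<forall>x\<in>R. \<forall>y\<in>R. x < y \<longrightarrow> seg f a x y = e))"

lemma seg_in:
  assumes "semigroup_on X f" "\<And>n. a n \<in> X"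
  shows "seg f a i j \<in> X"
  by (induction j) (use assms in \<open>auto simp: semigroup_on_def\<close>)

lemma seg_append:
  assumes "semigroup_on X f" "\<And>n. a n \<in> X" "i < j" "j < k"
  shows "f (seg f a i j) (seg f a j k) = seg f a i k"
  using assms(4)
proof (induction k)
  case (Suc k)
  show ?case
  proof (cases "k = j")
    case True
    then show ?thesis using \<open>i < j\<close> by simp
  next
    case False
    then have "j < k" using Suc.prems by simp
    moreover have "f (seg f a i j) (f (seg f a j k) (a k)) = f (f (seg f a i j) (seg f a j k)) (a k)"
      using assms(1) seg_in[of X f a i j] seg_in[of X f a j k] assms(2)
      unfolding semigroup_on_def by simp
    ultimately show ?thesis
      using Suc.IH \<open>i < j\<close> by simp
  qed
qed simp

lemma seg_hom:
  assumes "semigroup_on X f" "\<And>n. a n \<in> X"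
    and "\<And>x y. x \<in> X \<Longrightarrow> y \<in> X \<Longrightarrow> h (f x y) = f' (h x) (h y)"
  shows "h (seg f a i j) = seg f' (\<lambda>n. h (a n)) i j"
  by (induction j) (use seg_in[of X f a, OF assms(1,2)] assms(2,3) in auto)

lemma seg_cong:
  assumes "i < j" "\<And>n. i \<le> n \<Longrightarrow> n < j \<Longrightarrow> a n = b n"
  shows "seg f a i j = seg f b i j"
  using assms by (induction j) auto

text \<open>The cutting positions stay the same. In this way a factorisation over a product
  semigroup is read in each component.\<close>

lemma factor_hom:
  assumes "semigroup_on X f" "\<And>n. a n \<in> X"
    and "\<And>x y. x \<in> X \<Longrightarrow> y \<in> X \<Longrightarrow> h (f x y) = f' (h x) (h y)"
    and "factor f a s e"
  shows "factor f' (\<lambda>n. h (a n)) (h s) (h e)"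
proof -
  obtain R where "infinite R" "0 \<notin> R" "\<forall>x\<in>R. seg f a 0 x = s"
    "\<forall>x\<in>R. \<forall>y\<in>R. x < y \<longrightarrow> seg f a x y = e"
    using assms(4) unfolding factor_def by blast
  moreover have "seg f' (\<lambda>n. h (a n)) i j = h (seg f a i j)" for i j
    by (rule seg_hom[of X, symmetric]) (fact assms)+
  ultimately show ?thesis
    unfolding factor_def by (intro exI[of _ R]) auto
qed

text \<open>Two cutting positions give \<open>f s e = s\<close>, three give
  \<open>f e e = e\<close>.\<close>

lemma factor_linked:
  assumes "semigroup_on X f" "\<And>n. a n \<in> X" "factor f a s e"
  shows "s \<in> X" "e \<in> X" "f s e = s" "f e e = e"
proof -
  obtain R where R: "infinite R" "0 \<notin> R" "\<forall>x\<in>R. seg f a 0 x = s"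
    "\<forall>x\<in>R. \<forall>y\<in>R. x < y \<longrightarrow> seg f a x y = e"
    using assms(3) unfolding factor_def by blast
  obtain x where x: "x \<in> R" using R(1) by (metis finite.emptyI ex_in_conv)
  obtain y where y: "y \<in> R" "x < y" using R(1) by (meson infinite_nat_iff_unbounded)
  obtain z where z: "z \<in> R" "y < z" using R(1) by (meson infinite_nat_iff_unbounded)
  have "0 < x" using x R(2) by (metis neq0_conv)
  show "s \<in> X" "e \<in> X"
    using R(3,4) x y seg_in[of X f a, OF assms(1,2)] by metis+
  show "f s e = s"
    using seg_append[of X f a, OF assms(1,2) \<open>0 < x\<close> y(2)] R x y by simp
  show "f e e = e"
    using seg_append[of X f a, OF assms(1,2) y(2) z(2)] R x y z by simp
qed

text \<open>A converse of \<open>factor_linked\<close>: for a linked pair it is enough to know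
  consecutive blocks, as the two equations extend this to all pairs of positions.\<close>

lemma factorI:
  assumes "semigroup_on X f" "\<And>n. a n \<in> X" "strict_mono r" "0 < r 0"
    and s: "seg f a 0 (r 0) = s" and e: "\<And>i. seg f a (r i) (r (Suc i)) = e"
    and "f s e = s" "f e e = e"
  shows "factor f a s e"
proof -
  have r: "r i < r (Suc i)" for i
    using assms(3) by (simp add: strict_mono_def)
  have pos: "0 < r i" for i
    using assms(3,4) by (metis le0 order_less_le_trans strict_mono_less_eq)
  have "seg f a 0 (r i) = s" for i
  proof (induction i)
    case (Suc i)
    then show ?case
      using seg_append[of X f a, OF assms(1,2) pos r, of i] e assms(7) by simp
  qed (rule s)
  moreover have "seg f a (r i) (r j) = e" if "i < j" for i j
    using that
  proof (induction j)
    case (Suc j)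
    show ?case
    proof (cases "i = j")
      case False
      then have "i < j" using Suc.prems by simp
      then have "r i < r j" using assms(3) by (simp add: strict_mono_def)
      then show ?thesis
        using seg_append[of X f a, OF assms(1,2) _ r, of "r i" j] e assms(8) Suc.IH[OF \<open>i < j\<close>] by simp
    qed (use e in simp)
  qed simp
  moreover have "0 \<notin> range r"
    using pos by (metis image_iff less_irrefl)
  ultimately show ?thesis
    unfolding factor_def
    by (intro exI[of _ "range r"])
      (use assms(3) in
        \<open>auto simp: range_inj_infinite strict_mono_imp_inj_on strict_mono_less\<close>)
qed

text \<open>Ramsey's theorem, colouring a pair of positions with the product of the segment between them.\<close>

lemma factor_exists:
  assumes "finite X" "semigroup_on X f" "\<And>n. a n \<in> X" "infinite R" "0 \<notin> R"
  obtains x y where "x \<in> R" "y \<in> R" "x < y" "factor f a (seg f a 0 x) (seg f a x y)"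
proof -
  obtain c :: "'a \<Rightarrow> nat" and k where c: "inj_on c X" "c ` X = {i. i < k}"
    using finite_imp_inj_to_nat_seg[OF assms(1)] by blast
  define col where "col A = c (seg f a (Min A) (Max A))" for A
  have lt: "c (seg f a x y) < k" for x y
    using c(2) seg_in[of X f a, OF assms(2,3)] by blast
  have "\<exists>Y t. Y \<subseteq> R \<and> infinite Y \<and> t < k \<and> (\<forall>x\<in>Y. \<forall>y\<in>Y. x \<noteq> y \<longrightarrow> col {x, y} = t)"
    by (rule Ramsey2[of R col k, OF assms(4)]) (simp add: col_def lt)
  then obtain Y t where Y: "Y \<subseteq> R" "infinite Y" "\<forall>x\<in>Y. \<forall>y\<in>Y. x \<noteq> y \<longrightarrow> col {x, y} = t"
    by (elim exE conjE)
  \<comment> \<open>Ramsey's theorem controls only segments between two points of \<open>Y\<close>;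
    that the prefixes have equal products too is a matter of the pigeonhole principle.\<close>
  have "finite ((\<lambda>x. seg f a 0 x) ` Y)"
    by (rule finite_subset[OF _ assms(1)]) (use seg_in[of X f a, OF assms(2,3)] in blast)
  then obtain x where x: "x \<in> Y" "infinite {z \<in> Y. seg f a 0 z = seg f a 0 x}"
    using pigeonhole_infinite[OF Y(2)] by blast
  define R' where "R' = {z \<in> Y. seg f a 0 z = seg f a 0 x}"
  obtain y where y: "y \<in> R'" "x < y"
    using x(2) unfolding R'_def by (meson infinite_nat_iff_unbounded)
  have seg_eq: "seg f a u v = seg f a x y" if "u \<in> R'" "v \<in> R'" "u < v" for u v
  proof -
    have "c (seg f a u v) = c (seg f a x y)"
      using Y(3)[rule_format, of u v] Y(3)[rule_format, of x y] that y x(1) by (simp add: R'_def col_def)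
    then show ?thesis
      using c(1) seg_in[of X f a, OF assms(2,3)] by (meson inj_onD)
  qed
  have "factor f a (seg f a 0 x) (seg f a x y)"
    unfolding factor_def
  proof (intro exI[of _ R'] conjI ballI impI)
    show "infinite R'" using x(2) by (simp add: R'_def)
    show "0 \<notin> R'" using Y(1) assms(5) by (auto simp: R'_def)
    show "seg f a 0 u = seg f a 0 x" if "u \<in> R'" for u using that by (simp add: R'_def)
  qed (rule seg_eq)
  then show thesis
    using that[of x y] x y Y(1) by (auto simp: R'_def)
qed

section \<open>Choices from set-valued words\<close>

text \<open>\<open>M A\<close> is the set that the element \<open>A\<close> stands for, and
  \<open>g\<close> multiplies such sets elementwise. In this setting \<open>b\<close> is a choice of
  one element from every letter.\<close>

lemma seg_choice_in:
  assumes "semigroup_on X g" "\<And>n. a n \<in> X"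
    and M: "\<And>A B. A \<in> X \<Longrightarrow> B \<in> X \<Longrightarrow> M (g A B) = {f x y |x y. x \<in> M A \<and> y \<in> M B}"
    and "\<And>n. b n \<in> M (a n)"
  shows "seg f b i j \<in> M (seg g a i j)"
proof (induction j)
  case (Suc j)
  have "M (g (seg g a i j) (a j)) = {f x y |x y. x \<in> M (seg g a i j) \<and> y \<in> M (a j)}"
    by (rule M) (use seg_in[of X g a, OF assms(1,2)] assms(2) in auto)
  then show ?case
    using Suc assms(4) by simp blast
qed (use assms(4) in simp)

text \<open>Every element of a product of sets is a product of elements, so the choice for the last
  letter can be split off.\<close>

lemma seg_choice_ex:
  assumes "semigroup_on X g" "\<And>n. a n \<in> X"
    and M: "\<And>A B. A \<in> X \<Longrightarrow> B \<in> X \<Longrightarrow> M (g A B) = {f x y |x y. x \<in> M A \<and> y \<in> M B}"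
    and "i < j" "s \<in> M (seg g a i j)"
  shows "\<exists>b. (\<forall>n\<in>{i..<j}. b n \<in> M (a n)) \<and> seg f b i j = s"
  using assms(4,5)
proof (induction j arbitrary: s)
  case (Suc j)
  show ?case
  proof (cases "i = j")
    case True
    then show ?thesis
      using Suc.prems by (intro exI[of _ "\<lambda>_. s"]) auto
  next
    case False
    then have "i < j" using Suc.prems by simp
    have "M (g (seg g a i j) (a j)) = {f x y |x y. x \<in> M (seg g a i j) \<and> y \<in> M (a j)}"
      by (rule M) (use seg_in[of X g a, OF assms(1,2)] assms(2) in auto)
    then obtain x y where xy: "s = f x y" "x \<in> M (seg g a i j)" "y \<in> M (a j)"
      using Suc.prems \<open>i < j\<close> by auto
    obtain b where b: "\<forall>n\<in>{i..<j}. b n \<in> M (a n)" "seg f b i j = x"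
      using Suc.IH[OF \<open>i < j\<close> xy(2)] by blast
    define b' where "b' = b(j := y)"
    have "seg f b' i j = x"
      unfolding b(2)[symmetric] by (rule seg_cong[OF \<open>i < j\<close>]) (auto simp: b'_def)
    then have "seg f b' i (Suc j) = s"
      using \<open>i < j\<close> xy(1) by (simp add: b'_def)
    moreover have "\<forall>n\<in>{i..<Suc j}. b' n \<in> M (a n)"
      using b(1) xy(3) by (auto simp: b'_def)
    ultimately show ?thesis by blast
  qed
qed simp

text \<open>Choices are made separately in each block, so that the first block has product
  \<open>s\<close> and each later one \<open>e\<close>. As the pair is linked, the glued choices
  have the factorisation \<open>(s, e)\<close>.\<close>

lemma factor_choice_ex:
  assumes "semigroup_on X g" "\<And>n. a n \<in> X" "semigroup_on Z f" "\<And>A. A \<in> X \<Longrightarrow> M A \<subseteq> Z"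
    and M: "\<And>A B. A \<in> X \<Longrightarrow> B \<in> X \<Longrightarrow> M (g A B) = {f x y |x y. x \<in> M A \<and> y \<in> M B}"
    and "factor g a A E" "s \<in> M A" "e \<in> M E" "f s e = s" "f e e = e"
  obtains b where "\<And>n. b n \<in> M (a n)" "factor f b s e"
proof -
  obtain R where R: "infinite R" "0 \<notin> R" "\<forall>x\<in>R. seg g a 0 x = A"
    "\<forall>x\<in>R. \<forall>y\<in>R. x < y \<longrightarrow> seg g a x y = E"
    using assms(6) unfolding factor_def by blast
  define r where "r = enumerate R"
  have r: "strict_mono r" "\<And>i. r i \<in> R"
    unfolding r_def using R(1) by (auto simp: strict_mono_enumerate enumerate_in_set)
  have step: "r i < r (Suc i)" for i
    using r(1) by (simp add: strict_mono_def)
  have pos: "0 < r 0"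
    using r(2)[of 0] R(2) by (metis neq0_conv)
  obtain b0 where b0: "\<forall>n\<in>{0..<r 0}. b0 n \<in> M (a n)" "seg f b0 0 (r 0) = s"
    using seg_choice_ex[of X g a M f, OF assms(1,2) M pos] R(3) r(2) assms(7) by metis
  have "\<exists>b. (\<forall>n\<in>{r i..<r (Suc i)}. b n \<in> M (a n)) \<and> seg f b (r i) (r (Suc i)) = e" for i
    by (rule seg_choice_ex[of X g a M f, OF assms(1,2) M step]) (use R(4) r(2) step assms(8) in auto)
  then obtain b1 where b1: "\<And>i. \<forall>n\<in>{r i..<r (Suc i)}. b1 i n \<in> M (a n)"
    "\<And>i. seg f (b1 i) (r i) (r (Suc i)) = e"
    by metis
  \<comment> \<open>For \<open>n\<close> beyond the first block, the least such \<open>i\<close> is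
    the index of the block that contains \<open>n\<close>.\<close>
  define b where "b n = (if n < r 0 then b0 n else b1 (LEAST i. n < r (Suc i)) n)" for n
  have Lst: "(LEAST i. n < r (Suc i)) = k" if "r k \<le> n" "n < r (Suc k)" for n k
  proof (rule Least_equality)
    fix i assume "n < r (Suc i)"
    then have "r k < r (Suc i)" using that(1) by simp
    then show "k \<le> i" using r(1) by (simp add: strict_mono_less)
  qed (rule that(2))
  have in_M: "b n \<in> M (a n)" for n
  proof (cases "n < r 0")
    case False
    have ex: "n < r (Suc n)"
      using strict_mono_imp_increasing[OF r(1), of "Suc n"] by simp
    define k where "k = (LEAST i. n < r (Suc i))"
    have "n < r (Suc k)" unfolding k_def by (rule LeastI[where P = "\<lambda>i. n < r (Suc i)", OF ex])
    moreover have "r k \<le> n"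
    proof (cases k)
      case (Suc k')
      then show ?thesis
        using not_less_Least[where P = "\<lambda>i. n < r (Suc i)" and k = k'] unfolding k_def[symmetric] by simp
    qed (use False in simp)
    ultimately show ?thesis
      using b1(1)[of k] False by (auto simp: b_def k_def)
  qed (use b0 in \<open>simp add: b_def\<close>)
  have "seg f b 0 (r 0) = s"
    unfolding b0(2)[symmetric] by (rule seg_cong[OF pos]) (simp add: b_def)
  moreover have "seg f b (r i) (r (Suc i)) = e" for i
  proof -
    have "\<not> n < r 0" if "r i \<le> n" for n
      using that r(1) by (metis le0 order_trans linorder_not_less strict_mono_less_eq)
    then show ?thesis
      unfolding b1(2)[of i, symmetric]
      by (intro seg_cong[OF step]) (simp add: b_def Lst)
  qed
  ultimately have "factor f b s e"
    using factorI[of Z f b r s e, OF assms(3) _ r(1) pos] in_M assms(2,4,9,10) by blast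
  then show thesis
    using that in_M by blast
qed

text \<open>The powerset construction: acceptance of a set-valued word by a choice of its letters.\<close>

lemma factor_powerset:
  assumes "semigroup_on X g" "\<And>n. a n \<in> X" "finite Z" "semigroup_on Z f"
    and sub: "\<And>A. A \<in> X \<Longrightarrow> M A \<subseteq> Z"
    and M: "\<And>A B. A \<in> X \<Longrightarrow> B \<in> X \<Longrightarrow> M (g A B) = {f x y |x y. x \<in> M A \<and> y \<in> M B}"
    and l: "\<And>n. M (a n) = l n ` Y n"
    and acc: "\<And>y s e. (\<And>n. y n \<in> Y n) \<Longrightarrow> factor f (\<lambda>n. l n (y n)) s e \<Longrightarrow> L y \<longleftrightarrow> acc s e"
    and fac: "factor g a A E"
  shows "(\<exists>y. (\<forall>n. y n \<in> Y n) \<and> L y) \<longleftrightarrow>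
    (\<exists>s\<in>M A. \<exists>e\<in>M E. f s e = s \<and> f e e = e \<and> acc s e)"
proof
  assume "\<exists>y. (\<forall>n. y n \<in> Y n) \<and> L y"
  then obtain y where y: "\<And>n. y n \<in> Y n" "L y" by blast
  define b where "b n = l n (y n)" for n
  have b: "b n \<in> M (a n)" "b n \<in> Z" for n
    using y(1) l sub assms(2) unfolding b_def by blast+
  obtain R where R: "infinite R" "0 \<notin> R" "\<forall>x\<in>R. seg g a 0 x = A"
    "\<forall>x\<in>R. \<forall>y\<in>R. x < y \<longrightarrow> seg g a x y = E"
    using fac unfolding factor_def by blast
  \<comment> \<open>The new cutting positions are taken inside \<open>R\<close>, so the blocks
    between them are choices from \<open>A\<close> and \<open>E\<close>.\<close>
  obtain u v where uv: "u \<in> R" "v \<in> R" "u < v" "factor f b (seg f b 0 u) (seg f b u v)"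
    by (rule factor_exists[of Z f b R, OF assms(3,4) b(2) R(1,2)])
  have "seg f b i j \<in> M (seg g a i j)" for i j
    by (rule seg_choice_in[of X]) (use assms(1,2) M b(1) in auto)
  from this[of 0 u] this[of u v] have "seg f b 0 u \<in> M A" "seg f b u v \<in> M E"
    using R(3,4) uv by auto
  moreover have "acc (seg f b 0 u) (seg f b u v)"
    using acc[OF y(1)] uv(4) y(2) unfolding b_def by blast
  ultimately show "\<exists>s\<in>M A. \<exists>e\<in>M E. f s e = s \<and> f e e = e \<and> acc s e"
    using factor_linked[of Z f b, OF assms(4) b(2) uv(4)] by blast
next
  assume "\<exists>s\<in>M A. \<exists>e\<in>M E. f s e = s \<and> f e e = e \<and> acc s e"
  then obtain s e where se: "s \<in> M A" "e \<in> M E" "f s e = s" "f e e = e" "acc s e" by blast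
  obtain b where b: "\<And>n. b n \<in> M (a n)" "factor f b s e"
    using factor_choice_ex[of X g a Z f M A E s e, OF assms(1,2,4) sub M fac se(1-4)] by blast
  have "\<exists>y. y \<in> Y n \<and> b n = l n y" for n
    using b(1)[of n] l by blast
  then obtain y where y: "\<And>n. y n \<in> Y n" "\<And>n. b n = l n (y n)"
    using choice[of "\<lambda>n y. y \<in> Y n \<and> b n = l n y"] by blast
  then have "b = (\<lambda>n. l n (y n))" by blast
  then have "L y" using acc[OF y(1)] b(2) se(5) by blast
  then show "\<exists>y. (\<forall>n. y n \<in> Y n) \<and> L y" using y(1) by blast
qed

section \<open>Finite semigroups as tables\<close>

text \<open>A number codes a finite ternary table, and a table codes a semigroup on \<open>{..<tsz t}\<close> with a
  letter map, a set of accepted linked pairs and further maps \<open>tmark\<close>. A letter is a pair: a set of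
  variables (as a \<open>set_encode\<close> bit mask) and the largest \<open>j\<close> with the position in \<open>P\<^sub>j\<close> (or \<open>0\<close>).\<close>

definition tsz :: "nat \<Rightarrow> nat" where "tsz t = lookup t 0 0 0"
definition tmul :: "nat \<Rightarrow> nat \<Rightarrow> nat \<Rightarrow> nat" where "tmul t x y = lookup t 1 x y"
definition tlet :: "nat \<Rightarrow> nat \<Rightarrow> nat \<Rightarrow> nat" where "tlet t b j = lookup t 2 b j"
definition tacc :: "nat \<Rightarrow> nat \<Rightarrow> nat \<Rightarrow> bool" where "tacc t s e \<longleftrightarrow> lookup t 3 s e = 1"
definition tmark :: "nat \<Rightarrow> nat \<Rightarrow> nat \<Rightarrow> nat \<Rightarrow> nat" where "tmark t k x y = lookup t (4 + k) x y"

definition valid_table :: "nat \<Rightarrow> nat \<Rightarrow> nat \<Rightarrow> bool" where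
  "valid_table B D t \<longleftrightarrow> (\<forall>x<tsz t. \<forall>y<tsz t. tmul t x y < tsz t) \<and>
     (\<forall>x<tsz t. \<forall>y<tsz t. \<forall>z<tsz t. tmul t (tmul t x y) z = tmul t x (tmul t y z)) \<and>
     (\<forall>b<B. \<forall>j<D. tlet t b j < tsz t)"

lemma valid_table_semigroup: "valid_table B D t \<Longrightarrow> semigroup_on {..<tsz t} (tmul t)"
  by (simp add: valid_table_def semigroup_on_def)

lemma valid_table_let: "valid_table B D t \<Longrightarrow> b < B \<Longrightarrow> j < D \<Longrightarrow> tlet t b j < tsz t"
  by (simp add: valid_table_def)

text \<open>Lets existence proofs work in an abstract finite semigroup: the bijection
  \<open>h\<close> transports its structure to an initial segment of the numbers. The bounds
  \<open>K\<close> and \<open>n\<close> keep the marks finite.\<close>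

lemma ex_table:
  fixes f :: "'a \<Rightarrow> 'a \<Rightarrow> 'a"
  assumes "finite X" "semigroup_on X f" "\<And>b j. b < B \<Longrightarrow> j < D \<Longrightarrow> l b j \<in> X"
  obtains t h where "valid_table B D t" "bij_betw h {..<tsz t} X"
    "\<And>x y. x < tsz t \<Longrightarrow> y < tsz t \<Longrightarrow> h (tmul t x y) = f (h x) (h y)"
    "\<And>b j. b < B \<Longrightarrow> j < D \<Longrightarrow> h (tlet t b j) = l b j"
    "\<And>x y. x < tsz t \<Longrightarrow> y < tsz t \<Longrightarrow> tacc t x y \<longleftrightarrow> acc (h x) (h y)"
    "\<And>k x y. k < K \<Longrightarrow> x < tsz t \<Longrightarrow> y < n \<Longrightarrow> tmark t k x y = mark k (h x) y"
proof -
  define m where "m = card X"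
  obtain h where h: "bij_betw h {..<m} X"
    using ex_bij_betw_nat_finite[OF assms(1)] by (auto simp: m_def atLeast0LessThan)
  define g where "g = inv_into {..<m} h"
  have g: "g x < m" "h (g x) = x" if "x \<in> X" for x
    using h that unfolding g_def
    by (metis bij_betw_def inv_into_into lessThan_iff) (metis bij_betw_inv_into_right h that)
  have gh: "g (h x) = x" if "x < m" for x
    using h that unfolding g_def by (simp add: bij_betw_inv_into_left)
  have hX: "h x \<in> X" if "x < m" for x
    using h that by (auto simp: bij_betw_def)
  define F where "F i x y = (if i = 0 then m else if i = 1 then g (f (h x) (h y))
    else if i = 2 then g (l x y) else if i = 3 then of_bool (acc (h x) (h y))
    else mark (i - 4) (h x) y)" for i x y :: nat
  \<comment> \<open>Four components plus \<open>K\<close> marks; the other two indices must hold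
    elements, letters and arguments of marks. The \<open>+ 1\<close> makes room for the size, which
    is stored at \<open>0 0 0\<close>.\<close>
  obtain t where t: "\<forall>i<4 + K. \<forall>x<m + B + 1. \<forall>y<m + D + n + 1. lookup t i x y = F i x y"
    using ex_lookup[of "4 + K" "m + B + 1" "m + D + n + 1" F] by blast
  have sz: "tsz t = m"
    using t by (simp add: tsz_def F_def)
  have mul: "tmul t x y = g (f (h x) (h y))" if "x < m" "y < m" for x y
    using t that by (simp add: tmul_def F_def)
  have lt: "tlet t b j = g (l b j)" if "b < B" "j < D" for b j
    using t that by (simp add: tlet_def F_def)
  have fX: "f (h x) (h y) \<in> X" if "x < m" "y < m" for x y
    using assms(2) hX that by (simp add: semigroup_on_def)
  have mul_lt: "tmul t x y < m" if "x < m" "y < m" for x y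
    using mul[OF that] g(1)[OF fX[OF that]] by simp
  have h_mul: "h (tmul t x y) = f (h x) (h y)" if "x < m" "y < m" for x y
    using mul[OF that] g(2)[OF fX[OF that]] by simp
  have assoc: "tmul t (tmul t x y) z = tmul t x (tmul t y z)" if "x < m" "y < m" "z < m" for x y z
    using assms(2) that hX
    by (simp add: semigroup_on_def mul[of "tmul t x y" z] mul[of x "tmul t y z"] mul_lt h_mul)
  show thesis
  proof (rule that[of t h])
    show "valid_table B D t"
      using mul_lt assoc lt g(1)[OF assms(3)] by (simp add: valid_table_def sz)
    show "bij_betw h {..<tsz t} X" using h by (simp add: sz)
    show "h (tmul t x y) = f (h x) (h y)" if "x < tsz t" "y < tsz t" for x y
      using h_mul that by (simp add: sz)
    show "h (tlet t b j) = l b j" if "b < B" "j < D" for b j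
      using lt g(2)[OF assms(3)] that by simp
    show "tacc t x y \<longleftrightarrow> acc (h x) (h y)" if "x < tsz t" "y < tsz t" for x y
      using t that by (simp add: tacc_def F_def sz)
    show "tmark t k x y = mark k (h x) y" if "k < K" "x < tsz t" "y < n" for k x y
      using t that by (simp add: tmark_def F_def sz)
  qed
qed

section \<open>Properties of an infinite word that are visible in its prefix products\<close>

lemma seg_or:
  assumes "semigroup_on X f" "\<And>n. a n \<in> X"
    and "\<And>x y. x \<in> X \<Longrightarrow> y \<in> X \<Longrightarrow> S (f x y) \<longleftrightarrow> S x \<or> S y" and "i < j"
  shows "S (seg f a i j) \<longleftrightarrow> (\<exists>n. i \<le> n \<and> n < j \<and> S (a n))"
  using assms(4)
proof (induction j)
  case (Suc j)
  show ?case
  proof (cases "i = j")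
    case True
    then show ?thesis by (auto simp: less_Suc_eq_le dest: antisym)
  next
    case False
    then have "i < j" using Suc.prems by simp
    have "S (f (seg f a i j) (a j)) \<longleftrightarrow> S (seg f a i j) \<or> S (a j)"
      by (rule assms(3)) (use seg_in[of X f a i j] assms(1,2) in auto)
    then show ?thesis
      using Suc.IH[OF \<open>i < j\<close>] \<open>i < j\<close> by simp (metis less_Suc_eq less_imp_le_nat)
  qed
qed simp

lemma factor_prefix:
  assumes "factor f a s e"
  obtains x where "n < x" "seg f a 0 x = s"
proof -
  obtain R where "infinite R" "\<forall>x\<in>R. seg f a 0 x = s"
    using assms unfolding factor_def by blast
  then show thesis
    using that by (meson infinite_nat_iff_unbounded)
qed

text \<open>Arbitrarily long prefixes have product \<open>s\<close>, so every position lies in one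
  of them.\<close>

lemma factor_or:
  assumes "semigroup_on X f" "\<And>n. a n \<in> X"
    and "\<And>x y. x \<in> X \<Longrightarrow> y \<in> X \<Longrightarrow> S (f x y) \<longleftrightarrow> S x \<or> S y" and "factor f a s e"
  shows "S s \<longleftrightarrow> (\<exists>n. S (a n))"
proof -
  have *: "S (seg f a 0 x) \<longleftrightarrow> (\<exists>n<x. S (a n))" if "0 < x" for x
    using seg_or[of X f a S 0 x] assms(1-3) that by auto
  show ?thesis
  proof
    assume "S s"
    obtain x where "0 < x" "seg f a 0 x = s" by (rule factor_prefix[OF assms(4)])
    then show "\<exists>n. S (a n)" using * \<open>S s\<close> by blast
  next
    assume "\<exists>n. S (a n)"
    then obtain n where n: "S (a n)" ..
    obtain x where "n < x" "seg f a 0 x = s" by (rule factor_prefix[OF assms(4)])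
    then show "S s" using *[of x] n by auto
  qed
qed

text \<open>\<open>L\<close> records that an \<open>S\<close> has been followed by a
  \<open>T\<close>. The induction appends one letter at a time, so a new pair always consists of an
  \<open>S\<close> in the prefix and a \<open>T\<close> at the last letter.\<close>

lemma factor_before:
  assumes "semigroup_on X f" "\<And>n. a n \<in> X"
    and S: "\<And>x y. x \<in> X \<Longrightarrow> y \<in> X \<Longrightarrow> S (f x y) \<longleftrightarrow> S x \<or> S y"
    and L: "\<And>x y. x \<in> X \<Longrightarrow> y \<in> X \<Longrightarrow> L (f x y) \<longleftrightarrow> L x \<or> L y \<or> (S x \<and> T y)"
    and "\<And>n. \<not> L (a n)" and "factor f a s e"
  shows "L s \<longleftrightarrow> (\<exists>m n. m < n \<and> S (a m) \<and> T (a n))"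
proof -
  have *: "L (seg f a 0 (Suc x)) \<longleftrightarrow> (\<exists>m n. m < n \<and> n \<le> x \<and> S (a m) \<and> T (a n))" for x
  proof (induction x)
    case 0
    then show ?case using assms(5) by simp
  next
    case (Suc x)
    have "L (f (seg f a 0 (Suc x)) (a (Suc x))) \<longleftrightarrow>
        L (seg f a 0 (Suc x)) \<or> L (a (Suc x)) \<or> (S (seg f a 0 (Suc x)) \<and> T (a (Suc x)))"
      by (rule L) (use seg_in[of X f a 0 "Suc x"] assms(1,2) in auto)
    moreover have "S (seg f a 0 (Suc x)) \<longleftrightarrow> (\<exists>n. 0 \<le> n \<and> n < Suc x \<and> S (a n))"
      by (rule seg_or[of X]) (use assms(1,2) S in auto)
    moreover have "seg f a 0 (Suc (Suc x)) = f (seg f a 0 (Suc x)) (a (Suc x))" by simp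
    moreover have "(\<exists>m n. m < n \<and> n \<le> Suc x \<and> S (a m) \<and> T (a n)) \<longleftrightarrow>
        (\<exists>m n. m < n \<and> n \<le> x \<and> S (a m) \<and> T (a n)) \<or> (\<exists>m<Suc x. S (a m)) \<and> T (a (Suc x))"
      by (metis le_Suc_eq)
    ultimately show ?case
      using Suc assms(5) by (simp only: le0 simp_thms)
  qed
  show ?thesis
  proof
    assume "L s"
    obtain x where x: "0 < x" "seg f a 0 x = s" by (rule factor_prefix[OF assms(6)])
    then obtain y where "x = Suc y" by (cases x) auto
    then show "\<exists>m n. m < n \<and> S (a m) \<and> T (a n)" using *[of y] x \<open>L s\<close> by blast
  next
    assume "\<exists>m n. m < n \<and> S (a m) \<and> T (a n)"
    then obtain m n where n: "m < n" "S (a m)" "T (a n)" by blast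
    obtain x where x: "n < x" "seg f a 0 x = s" by (rule factor_prefix[OF assms(6)])
    then obtain y where "x = Suc y" by (cases x) auto
    then show "L s" using *[of y] x n by auto
  qed
qed

text \<open>Counting up to two, to express that a set is a singleton.\<close>

definition cadd :: "nat \<Rightarrow> nat \<Rightarrow> nat" where
  "cadd k l = (if k + l \<le> 2 then k + l else 2)"

lemma cadd_semigroup: "semigroup_on {..<3} cadd"
  by (auto simp: semigroup_on_def cadd_def)

text \<open>A prefix has as its product the number of its hits, cut off at 2. If this is 1 for
  arbitrarily long prefixes, they all contain the same single hit.\<close>

lemma factor_count:
  assumes "factor cadd (\<lambda>n. of_bool (Q n)) k k'"
  shows "k = 1 \<longleftrightarrow> (\<exists>a. {n. Q n} = {a})"
proof -
  have *: "seg cadd (\<lambda>n. of_bool (Q n)) 0 (Suc x) = min 2 (card {n. n \<le> x \<and> Q n})" for x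
  proof (induction x)
    case 0
    have "{n. n = 0 \<and> Q n} = (if Q 0 then {0} else {})" by auto
    then show ?case by simp
  next
    case (Suc x)
    have "{n. n \<le> Suc x \<and> Q n} = (if Q (Suc x) then insert (Suc x) {n. n \<le> x \<and> Q n} else {n. n \<le> x \<and> Q n})"
      by (auto simp: le_Suc_eq)
    moreover have "Suc x \<notin> {n. n \<le> x \<and> Q n}" "finite {n. n \<le> x \<and> Q n}" by auto
    ultimately have "card {n. n \<le> Suc x \<and> Q n} = card {n. n \<le> x \<and> Q n} + of_bool (Q (Suc x))"
      by simp
    then show ?case
      using Suc by (simp add: cadd_def)
  qed
  show ?thesis
  proof
    assume k: "k = 1"
    have one: "\<exists>a. {n. n \<le> y \<and> Q n} = {a}" if "seg cadd (\<lambda>n. of_bool (Q n)) 0 (Suc y) = k" for y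
    proof -
      have "card {n. n \<le> y \<and> Q n} = 1" using *[of y] that k by (simp add: min_def split: if_splits)
      then show ?thesis by (simp add: card_1_singleton_iff)
    qed
    obtain x where x: "0 < x" "seg cadd (\<lambda>n. of_bool (Q n)) 0 x = k"
      by (rule factor_prefix[OF assms])
    obtain a where a: "{n. n \<le> x - 1 \<and> Q n} = {a}" using one[of "x - 1"] x by auto
    have "n = a" if "Q n" for n
    proof -
      obtain y where y: "max n x < y" "seg cadd (\<lambda>n. of_bool (Q n)) 0 y = k"
        by (rule factor_prefix[OF assms])
      obtain a' where a': "{n. n \<le> y - 1 \<and> Q n} = {a'}" using one[of "y - 1"] y by auto
      have "n \<in> {n. n \<le> y - 1 \<and> Q n}" using that y by auto
      moreover have "a \<in> {n. n \<le> x - 1 \<and> Q n}" using a by blast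
      then have "a \<in> {n. n \<le> y - 1 \<and> Q n}" using y by auto
      ultimately show ?thesis unfolding a' by simp
    qed
    moreover have "Q a" using a by blast
    ultimately show "\<exists>a. {n. Q n} = {a}" by blast
  next
    assume "\<exists>a. {n. Q n} = {a}"
    then obtain a where a: "{n. Q n} = {a}" ..
    obtain x where x: "a < x" "seg cadd (\<lambda>n. of_bool (Q n)) 0 x = k"
      by (rule factor_prefix[OF assms])
    have "{n. n \<le> x - 1 \<and> Q n} = {a}" using a x by auto
    then show "k = 1" using *[of "x - 1"] x by auto
  qed
qed

text \<open>First-order variables become sets as well: variable \<open>x\<close> has index \<open>2 x\<close>, set variable \<open>X\<close> has
  index \<open>2 X + 1\<close>. For a sentence all these sets may then be empty.\<close>

primrec sat_sets :: "(nat \<Rightarrow> nat) \<Rightarrow> (nat \<Rightarrow> nat set) \<Rightarrow> mso \<Rightarrow> bool" where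
  "sat_sets w V (Less x y) \<longleftrightarrow> (\<exists>m n. m < n \<and> m \<in> V (2 * x) \<and> n \<in> V (2 * y))"
| "sat_sets w V (Eq x y) \<longleftrightarrow> (\<exists>n. n \<in> V (2 * x) \<and> n \<in> V (2 * y))"
| "sat_sets w V (Mem x X) \<longleftrightarrow> (\<exists>n. n \<in> V (2 * x) \<and> n \<in> V (Suc (2 * X)))"
| "sat_sets w V (Pred i x) \<longleftrightarrow> (\<exists>n. n \<in> V (2 * x) \<and> i \<le> w n)"
| "sat_sets w V (Neg \<phi>) \<longleftrightarrow> \<not> sat_sets w V \<phi>"
| "sat_sets w V (Conj \<phi> \<psi>) \<longleftrightarrow> sat_sets w V \<phi> \<and> sat_sets w V \<psi>"
| "sat_sets w V (Ex x \<phi>) \<longleftrightarrow> (\<exists>a. sat_sets w (V(2 * x := {a})) \<phi>)"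
| "sat_sets w V (ExSet X \<phi>) \<longleftrightarrow> (\<exists>A. sat_sets w (V(Suc (2 * X) := A)) \<phi>)"

text \<open>On singletons the existential reading of atoms is the usual one. The parity of the
  indices keeps updates of the two families of variables apart.\<close>

lemma sat_sets_iff_sat:
  assumes "\<And>x. x \<in> free_fo \<phi> \<Longrightarrow> V (2 * x) = {e x}"
    and "\<And>X. X \<in> free_so \<phi> \<Longrightarrow> V (Suc (2 * X)) = E X"
  shows "sat_sets w V \<phi> \<longleftrightarrow> sat (\<lambda>i. {n. i \<le> w n}) e E \<phi>"
  using assms
proof (induction \<phi> arbitrary: V e E)
  case (Ex x \<phi>)
  have "sat_sets w (V(2 * x := {a})) \<phi> \<longleftrightarrow> sat (\<lambda>i. {n. i \<le> w n}) (e(x := a)) E \<phi>" for a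
    by (rule Ex.IH) (use Ex.prems in \<open>auto simp: double_not_eq_Suc_double Suc_double_not_eq_double\<close>)
  then show ?case by simp
next
  case (ExSet X \<phi>)
  have "sat_sets w (V(Suc (2 * X) := A)) \<phi> \<longleftrightarrow> sat (\<lambda>i. {n. i \<le> w n}) e (E(X := A)) \<phi>" for A
    by (rule ExSet.IH) (use ExSet.prems in \<open>auto simp: double_not_eq_Suc_double Suc_double_not_eq_double\<close>)
  then show ?case by simp
next
  case (Conj \<phi> \<psi>)
  have "sat_sets w V \<phi> \<longleftrightarrow> sat (\<lambda>i. {n. i \<le> w n}) e E \<phi>"
    by (rule Conj.IH(1)) (use Conj.prems in auto)
  moreover have "sat_sets w V \<psi> \<longleftrightarrow> sat (\<lambda>i. {n. i \<le> w n}) e E \<psi>"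
    by (rule Conj.IH(2)) (use Conj.prems in auto)
  ultimately show ?case by simp
qed auto

text \<open>The valuation encoded by a word of bit masks: the mask at position \<open>n\<close>
  lists the variables whose sets contain \<open>n\<close>.\<close>

definition vset :: "(nat \<Rightarrow> nat) \<Rightarrow> nat \<Rightarrow> nat set" where
  "vset b v = {n. v \<in> set_decode (b n)}"

lemma set_decode_less: "b < 2 ^ N \<Longrightarrow> v \<in> set_decode b \<Longrightarrow> v < N"
proof (rule ccontr)
  assume b: "b < 2 ^ N" "v \<in> set_decode b" "\<not> v < N"
  then have "(2::nat) ^ N \<le> 2 ^ v" by (simp add: power_increasing)
  then have "b < 2 ^ v" using b(1) by linarith
  then have "b div 2 ^ v = 0" by simp
  then show False using b(2) by (simp add: set_decode_def)
qed

lemma set_encode_less: 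
  assumes "S \<subseteq> {..<N}"
  shows "set_encode S < 2 ^ N"
proof -
  have "set_encode S \<le> (\<Sum>i<N. 2 ^ i)"
    unfolding set_encode_def by (rule sum_mono2) (use assms in auto)
  also have "(\<Sum>i<N. 2 ^ i) < (2::nat) ^ N"
    by (induction N) auto
  finally show ?thesis .
qed

definition variant :: "nat \<Rightarrow> nat \<Rightarrow> nat \<Rightarrow> nat \<Rightarrow> bool" where
  "variant N v b b' \<longleftrightarrow> (\<forall>u<N. u \<noteq> v \<longrightarrow> (u \<in> set_decode b' \<longleftrightarrow> u \<in> set_decode b))"

lemma vset_variant:
  assumes "\<And>n. b n < 2 ^ N" "\<And>n. b' n < 2 ^ N" "\<And>n. variant N v (b n) (b' n)"
  shows "vset b' = (vset b)(v := vset b' v)"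
proof
  fix u
  show "vset b' u = ((vset b)(v := vset b' v)) u"
  proof (cases "u < N")
    case True
    then show ?thesis using assms(3) by (auto simp: vset_def variant_def)
  next
    case False
    then have "u \<notin> set_decode (b n)" "u \<notin> set_decode (b' n)" for n
      using set_decode_less assms(1,2) by blast+
    then show ?thesis by (auto simp: vset_def)
  qed
qed

lemma ex_variant:
  assumes "\<And>n. b n < 2 ^ N" "v < N"
  obtains b' where "\<And>n. b' n < 2 ^ N" "\<And>n. variant N v (b n) (b' n)" "vset b' = (vset b)(v := Y)"
proof -
  define c where "c n = set_decode (b n) - {v} \<union> (if n \<in> Y then {v} else {})" for n
  define b' where "b' n = set_encode (c n)" for n
  have c: "c n \<subseteq> {..<N}" for n
    using set_decode_less[OF assms(1)] assms(2) by (auto simp: c_def)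
  have dec: "set_decode (b' n) = c n" for n
    unfolding b'_def using finite_subset[OF c] by simp
  have b': "b' n < 2 ^ N" "variant N v (b n) (b' n)" for n
    unfolding variant_def dec using set_encode_less[OF c] by (auto simp: b'_def c_def)
  moreover have "vset b' = (vset b)(v := vset b' v)"
    by (rule vset_variant[of b N b' v]) (use assms(1) b' in auto)
  moreover have "vset b' v = Y"
    by (auto simp: vset_def dec c_def)
  ultimately show thesis using that by metis
qed

section \<open>Tables recognising formulas\<close>

text \<open>The bound \<open>2 ^ N\<close> on masks leaves finitely many letters, with room for the
  variable indices below \<open>N\<close>.\<close>

definition recog :: "nat \<Rightarrow> (nat \<Rightarrow> nat) \<Rightarrow> nat \<Rightarrow> mso \<Rightarrow> bool" where
  "recog N w t \<phi> \<longleftrightarrow> (\<forall>b. (\<forall>n. b n < 2 ^ N) \<longrightarrow>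
     (\<forall>s e. factor (tmul t) (\<lambda>n. tlet t (b n) (w n)) s e \<longrightarrow> (sat_sets w (vset b) \<phi> \<longleftrightarrow> tacc t s e)))"

text \<open>Tags are those of \<open>mso_code\<close>. These atoms are witnessed at one position,
  unlike \<open>Less\<close>, which has a condition of its own. For tag 3, \<open>p\<close> is the
  index of the predicate, compared with the second component of the letter.\<close>

definition atom_hit :: "nat \<Rightarrow> nat \<Rightarrow> nat \<Rightarrow> nat \<Rightarrow> nat \<Rightarrow> bool" where
  "atom_hit tag p q b j \<longleftrightarrow>
     tag = 1 \<and> 2 * p \<in> set_decode b \<and> 2 * q \<in> set_decode b \<or>
     tag = 2 \<and> 2 * p \<in> set_decode b \<and> Suc (2 * q) \<in> set_decode b \<or>
     tag = 3 \<and> 2 * q \<in> set_decode b \<and> p \<le> j"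

text \<open>The conditions \<open>ok_*\<close> are decidable, so a table satisfying them can be found by unbounded search;
  no construction on codes is needed. In \<open>ok_ex\<close> the elements of \<open>t\<close> stand for sets of pairs of an
  element of \<open>t1\<close> and a count, \<open>tmark t k x z = 1\<close> meaning that \<open>(z, k)\<close> is in the set of \<open>x\<close>.\<close>

definition ok_atom :: "nat \<Rightarrow> nat \<Rightarrow> nat \<Rightarrow> nat \<Rightarrow> nat \<Rightarrow> nat \<Rightarrow> bool" where
  "ok_atom B D tag p q t \<longleftrightarrow>
     (\<forall>x<tsz t. \<forall>y<tsz t.
        (tmark t 0 (tmul t x y) 0 = 1 \<longleftrightarrow> tmark t 0 x 0 = 1 \<or> tmark t 0 y 0 = 1) \<and>
        (tacc t x y \<longleftrightarrow> tmark t 0 x 0 = 1)) \<and>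
     (\<forall>b<B. \<forall>j<D. tmark t 0 (tlet t b j) 0 = 1 \<longleftrightarrow> atom_hit tag p q b j)"

text \<open>Marks 0, 1 and 2 play the roles of \<open>S\<close>, \<open>T\<close> and
  \<open>L\<close> in \<open>factor_before\<close>.\<close>

definition ok_less :: "nat \<Rightarrow> nat \<Rightarrow> nat \<Rightarrow> nat \<Rightarrow> nat \<Rightarrow> bool" where
  "ok_less B D p q t \<longleftrightarrow>
     (\<forall>x<tsz t. \<forall>y<tsz t.
        (tmark t 0 (tmul t x y) 0 = 1 \<longleftrightarrow> tmark t 0 x 0 = 1 \<or> tmark t 0 y 0 = 1) \<and>
        (tmark t 0 (tmul t x y) 1 = 1 \<longleftrightarrow> tmark t 0 x 1 = 1 \<or> tmark t 0 y 1 = 1) \<and>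
        (tmark t 0 (tmul t x y) 2 = 1 \<longleftrightarrow>
           tmark t 0 x 2 = 1 \<or> tmark t 0 y 2 = 1 \<or> tmark t 0 x 0 = 1 \<and> tmark t 0 y 1 = 1) \<and>
        (tacc t x y \<longleftrightarrow> tmark t 0 x 2 = 1)) \<and>
     (\<forall>b<B. \<forall>j<D. (tmark t 0 (tlet t b j) 0 = 1 \<longleftrightarrow> 2 * p \<in> set_decode b) \<and>
        (tmark t 0 (tlet t b j) 1 = 1 \<longleftrightarrow> 2 * q \<in> set_decode b) \<and>
        tmark t 0 (tlet t b j) 2 \<noteq> 1)"

definition ok_neg :: "nat \<Rightarrow> nat \<Rightarrow> nat \<Rightarrow> nat \<Rightarrow> bool" where
  "ok_neg B D t t1 \<longleftrightarrow> tsz t = tsz t1 \<and>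
     (\<forall>x<tsz t. \<forall>y<tsz t. tmul t x y = tmul t1 x y \<and> (tacc t x y \<longleftrightarrow> \<not> tacc t1 x y)) \<and>
     (\<forall>b<B. \<forall>j<D. tlet t b j = tlet t1 b j)"

text \<open>Marks 0 and 1 are the projections of a product onto \<open>t1\<close> and
  \<open>t2\<close>.\<close>

definition ok_conj :: "nat \<Rightarrow> nat \<Rightarrow> nat \<Rightarrow> nat \<Rightarrow> nat \<Rightarrow> bool" where
  "ok_conj B D t t1 t2 \<longleftrightarrow>
     (\<forall>x<tsz t. \<forall>y<tsz t.
        tmark t 0 (tmul t x y) 0 = tmul t1 (tmark t 0 x 0) (tmark t 0 y 0) \<and>
        tmark t 0 (tmul t x y) 1 = tmul t2 (tmark t 0 x 1) (tmark t 0 y 1) \<and>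
        (tacc t x y \<longleftrightarrow> tacc t1 (tmark t 0 x 0) (tmark t 0 y 0) \<and>
           tacc t2 (tmark t 0 x 1) (tmark t 0 y 1))) \<and>
     (\<forall>b<B. \<forall>j<D. tmark t 0 (tlet t b j) 0 = tlet t1 b j \<and> tmark t 0 (tlet t b j) 1 = tlet t2 b j)"

definition ok_ex :: "nat \<Rightarrow> nat \<Rightarrow> nat \<Rightarrow> nat \<Rightarrow> nat \<Rightarrow> nat \<Rightarrow> nat \<Rightarrow> bool" where
  "ok_ex N B D tag v t t1 \<longleftrightarrow>
     (\<forall>x<tsz t. \<forall>y<tsz t.
        (\<forall>k<3. \<forall>z<tsz t1. tmark t k (tmul t x y) z = 1 \<longleftrightarrow>
           (\<exists>k1<3. \<exists>z1<tsz t1. tmark t k1 x z1 = 1 \<and> (\<exists>k2<3. \<exists>z2<tsz t1. tmark t k2 y z2 = 1 \<and>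
              z = tmul t1 z1 z2 \<and> k = cadd k1 k2))) \<and>
        (tacc t x y \<longleftrightarrow>
           (\<exists>k1<3. \<exists>z1<tsz t1. tmark t k1 x z1 = 1 \<and> (\<exists>k2<3. \<exists>z2<tsz t1. tmark t k2 y z2 = 1 \<and>
              tmul t1 z1 z2 = z1 \<and> tmul t1 z2 z2 = z2 \<and> cadd k1 k2 = k1 \<and> cadd k2 k2 = k2 \<and>
              tacc t1 z1 z2 \<and> (tag = 6 \<longrightarrow> k1 = 1))))) \<and>
     (\<forall>b<B. \<forall>j<D. \<forall>k<3. \<forall>z<tsz t1. tmark t k (tlet t b j) z = 1 \<longleftrightarrow>
        (\<exists>b'<B. variant N v b b' \<and> z = tlet t1 b' j \<and> k = of_bool (v \<in> set_decode b')))"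

lemma ok_ex_mul:
  assumes "ok_ex N B D tag v t t1" "x < tsz t" "y < tsz t" "k < 3" "z < tsz t1"
  shows "tmark t k (tmul t x y) z = 1 \<longleftrightarrow>
           (\<exists>k1<3. \<exists>z1<tsz t1. tmark t k1 x z1 = 1 \<and> (\<exists>k2<3. \<exists>z2<tsz t1. tmark t k2 y z2 = 1 \<and>
              z = tmul t1 z1 z2 \<and> k = cadd k1 k2))"
  by (rule assms(1)[unfolded ok_ex_def, THEN conjunct1, rule_format, OF assms(2,3),
        THEN conjunct1, rule_format, OF assms(4,5)])

lemma ok_ex_acc:
  assumes "ok_ex N B D tag v t t1" "x < tsz t" "y < tsz t"
  shows "tacc t x y \<longleftrightarrow>
           (\<exists>k1<3. \<exists>z1<tsz t1. tmark t k1 x z1 = 1 \<and> (\<exists>k2<3. \<exists>z2<tsz t1. tmark t k2 y z2 = 1 \<and>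
              tmul t1 z1 z2 = z1 \<and> tmul t1 z2 z2 = z2 \<and> cadd k1 k2 = k1 \<and> cadd k2 k2 = k2 \<and>
              tacc t1 z1 z2 \<and> (tag = 6 \<longrightarrow> k1 = 1)))"
  by (rule assms(1)[unfolded ok_ex_def, THEN conjunct1, rule_format, OF assms(2,3), THEN conjunct2])

lemma ok_ex_let:
  assumes "ok_ex N B D tag v t t1" "b < B" "j < D" "k < 3" "z < tsz t1"
  shows "tmark t k (tlet t b j) z = 1 \<longleftrightarrow>
        (\<exists>b'<B. variant N v b b' \<and> z = tlet t1 b' j \<and> k = of_bool (v \<in> set_decode b'))"
  by (rule assms(1)[unfolded ok_ex_def, THEN conjunct2, rule_format, OF assms(2-5)])

definition pmul :: "nat \<Rightarrow> nat \<times> nat \<Rightarrow> nat \<times> nat \<Rightarrow> nat \<times> nat" where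
  "pmul t u v = (tmul t (fst u) (fst v), cadd (snd u) (snd v))"

lemma pmul_semigroup:
  assumes "valid_table B D t"
  shows "semigroup_on ({..<tsz t} \<times> {..<3}) (pmul t)"
  using valid_table_semigroup[OF assms] cadd_semigroup
  by (auto simp: semigroup_on_def pmul_def)

text \<open>The map \<open>M\<close> of the powerset construction, decoded from the table
  \<open>t\<close>.\<close>

definition exmark :: "nat \<Rightarrow> nat \<Rightarrow> nat \<Rightarrow> (nat \<times> nat) set" where
  "exmark t t1 A = {u. fst u < tsz t1 \<and> snd u < 3 \<and> tmark t (snd u) A (fst u) = 1}"

context
  fixes w :: "nat \<Rightarrow> nat" and D N :: nat
  assumes w: "\<And>n. w n < D"
begin

lemma recog_atom:
  assumes "valid_table (2 ^ N) D t" "ok_atom (2 ^ N) D tag p q t"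
    and "\<And>b. sat_sets w (vset b) \<phi> \<longleftrightarrow> (\<exists>n. atom_hit tag p q (b n) (w n))"
  shows "recog N w t \<phi>"
  unfolding recog_def
proof (intro allI impI)
  fix b s e
  assume b: "\<forall>n. b n < (2::nat) ^ N" and fac: "factor (tmul t) (\<lambda>n. tlet t (b n) (w n)) s e"
  note sg = valid_table_semigroup[OF assms(1)]
  have a: "tlet t (b n) (w n) \<in> {..<tsz t}" for n
    using valid_table_let[OF assms(1)] b w by simp
  have "tmark t 0 s 0 = 1 \<longleftrightarrow> (\<exists>n. tmark t 0 (tlet t (b n) (w n)) 0 = 1)"
    by (rule factor_or[of "{..<tsz t}" "tmul t" "\<lambda>n. tlet t (b n) (w n)" "\<lambda>x. tmark t 0 x 0 = 1" s e, OF sg a _ fac])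
       (use assms(2) in \<open>simp add: ok_atom_def\<close>)
  also have "\<dots> \<longleftrightarrow> (\<exists>n. atom_hit tag p q (b n) (w n))"
    using assms(2) b w by (simp add: ok_atom_def)
  finally show "sat_sets w (vset b) \<phi> \<longleftrightarrow> tacc t s e"
    using assms(2,3) factor_linked(1,2)[of "{..<tsz t}" "tmul t" "\<lambda>n. tlet t (b n) (w n)" s e, OF sg a fac]
    by (simp add: ok_atom_def)
qed

lemma recog_less:
  assumes "valid_table (2 ^ N) D t" "ok_less (2 ^ N) D x y t"
  shows "recog N w t (Less x y)"
  unfolding recog_def
proof (intro allI impI)
  fix b s e
  assume b: "\<forall>n. b n < (2::nat) ^ N" and fac: "factor (tmul t) (\<lambda>n. tlet t (b n) (w n)) s e"
  note sg = valid_table_semigroup[OF assms(1)]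
  have a: "tlet t (b n) (w n) \<in> {..<tsz t}" for n
    using valid_table_let[OF assms(1)] b w by simp
  have "tmark t 0 s 2 = 1 \<longleftrightarrow> (\<exists>m n. m < n \<and> tmark t 0 (tlet t (b m) (w m)) 0 = 1 \<and>
      tmark t 0 (tlet t (b n) (w n)) 1 = 1)"
    by (rule factor_before[of "{..<tsz t}" "tmul t" "\<lambda>n. tlet t (b n) (w n)" "\<lambda>x. tmark t 0 x 0 = 1"
          "\<lambda>x. tmark t 0 x 2 = 1" "\<lambda>x. tmark t 0 x 1 = 1" s e, OF sg a _ _ _ fac])
       (use assms(2) b w in \<open>simp_all add: ok_less_def\<close>)
  also have "\<dots> \<longleftrightarrow> sat_sets w (vset b) (Less x y)"
    using assms(2) b w by (simp add: ok_less_def vset_def)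
  finally show "sat_sets w (vset b) (Less x y) \<longleftrightarrow> tacc t s e"
    using assms(2) factor_linked(1,2)[of "{..<tsz t}" "tmul t" "\<lambda>n. tlet t (b n) (w n)" s e, OF sg a fac]
    by (simp add: ok_less_def)
qed

lemma recog_neg:
  assumes "valid_table (2 ^ N) D t" "ok_neg (2 ^ N) D t t1" "recog N w t1 \<phi>"
  shows "recog N w t (Neg \<phi>)"
  unfolding recog_def
proof (intro allI impI)
  fix b s e
  assume b: "\<forall>n. b n < (2::nat) ^ N" and fac: "factor (tmul t) (\<lambda>n. tlet t (b n) (w n)) s e"
  note sg = valid_table_semigroup[OF assms(1)]
  have a: "tlet t (b n) (w n) \<in> {..<tsz t}" for n
    using valid_table_let[OF assms(1)] b w by simp
  have "factor (tmul t1) (\<lambda>n. id (tlet t (b n) (w n))) (id s) (id e)"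
    by (rule factor_hom[of "{..<tsz t}" "tmul t" _ id, OF sg a _ fac])
       (use assms(2) in \<open>simp add: ok_neg_def\<close>)
  moreover have "tlet t (b n) (w n) = tlet t1 (b n) (w n)" for n
    using assms(2) b w by (simp add: ok_neg_def)
  ultimately have "factor (tmul t1) (\<lambda>n. tlet t1 (b n) (w n)) s e"
    by simp
  then have "sat_sets w (vset b) \<phi> \<longleftrightarrow> tacc t1 s e"
    using assms(3) b unfolding recog_def by blast
  then show "sat_sets w (vset b) (Neg \<phi>) \<longleftrightarrow> tacc t s e"
    using assms(2) factor_linked(1,2)[of "{..<tsz t}" "tmul t" "\<lambda>n. tlet t (b n) (w n)" s e, OF sg a fac]
    by (simp add: ok_neg_def)
qed

lemma recog_conj:
  assumes "valid_table (2 ^ N) D t" "ok_conj (2 ^ N) D t t1 t2" "recog N w t1 \<phi>" "recog N w t2 \<psi>"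
  shows "recog N w t (Conj \<phi> \<psi>)"
  unfolding recog_def
proof (intro allI impI)
  fix b s e
  assume b: "\<forall>n. b n < (2::nat) ^ N" and fac: "factor (tmul t) (\<lambda>n. tlet t (b n) (w n)) s e"
  note sg = valid_table_semigroup[OF assms(1)]
  have a: "tlet t (b n) (w n) \<in> {..<tsz t}" for n
    using valid_table_let[OF assms(1)] b w by simp
  have "factor (tmul t1) (\<lambda>n. tmark t 0 (tlet t (b n) (w n)) 0) (tmark t 0 s 0) (tmark t 0 e 0)"
    by (rule factor_hom[of "{..<tsz t}" "tmul t" _ "\<lambda>x. tmark t 0 x 0", OF sg a _ fac])
       (use assms(2) in \<open>simp add: ok_conj_def\<close>)
  moreover have "tmark t 0 (tlet t (b n) (w n)) 0 = tlet t1 (b n) (w n)" for n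
    using assms(2) b w by (simp add: ok_conj_def)
  ultimately have "factor (tmul t1) (\<lambda>n. tlet t1 (b n) (w n)) (tmark t 0 s 0) (tmark t 0 e 0)"
    by simp
  then have 1: "sat_sets w (vset b) \<phi> \<longleftrightarrow> tacc t1 (tmark t 0 s 0) (tmark t 0 e 0)"
    using assms(3) b unfolding recog_def by blast
  have "factor (tmul t2) (\<lambda>n. tmark t 0 (tlet t (b n) (w n)) 1) (tmark t 0 s 1) (tmark t 0 e 1)"
    by (rule factor_hom[of "{..<tsz t}" "tmul t" _ "\<lambda>x. tmark t 0 x 1", OF sg a _ fac])
       (use assms(2) in \<open>simp add: ok_conj_def\<close>)
  moreover have "tmark t 0 (tlet t (b n) (w n)) 1 = tlet t2 (b n) (w n)" for n
    using assms(2) b w by (simp add: ok_conj_def)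
  ultimately have "factor (tmul t2) (\<lambda>n. tlet t2 (b n) (w n)) (tmark t 0 s 1) (tmark t 0 e 1)"
    by simp
  then have 2: "sat_sets w (vset b) \<psi> \<longleftrightarrow> tacc t2 (tmark t 0 s 1) (tmark t 0 e 1)"
    using assms(4) b unfolding recog_def by blast
  show "sat_sets w (vset b) (Conj \<phi> \<psi>) \<longleftrightarrow> tacc t s e"
    using 1 2 assms(2) factor_linked(1,2)[of "{..<tsz t}" "tmul t" "\<lambda>n. tlet t (b n) (w n)" s e, OF sg a fac]
    by (simp add: ok_conj_def)
qed

lemma exmark_mul:
  assumes v1: "valid_table B D t1" and ok: "ok_ex N B D tag v t t1"
    and "x < tsz t" "y < tsz t"
  shows "exmark t t1 (tmul t x y) = {pmul t1 u u' |u u'. u \<in> exmark t t1 x \<and> u' \<in> exmark t t1 y}"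
proof -
  have ok: "tmark t k (tmul t x y) z = 1 \<longleftrightarrow>
           (\<exists>k1<3. \<exists>z1<tsz t1. tmark t k1 x z1 = 1 \<and> (\<exists>k2<3. \<exists>z2<tsz t1. tmark t k2 y z2 = 1 \<and>
              z = tmul t1 z1 z2 \<and> k = cadd k1 k2))" if "k < 3" "z < tsz t1" for k z
    by (rule ok_ex_mul[OF ok assms(3,4) that])
  have sg: "pmul t1 u u' \<in> {..<tsz t1} \<times> {..<3}" if "u \<in> exmark t t1 x" "u' \<in> exmark t t1 y" for u u'
  proof -
    have "u \<in> {..<tsz t1} \<times> {..<3}" "u' \<in> {..<tsz t1} \<times> {..<3}"
      using that by (auto simp: exmark_def mem_Times_iff)
    then show ?thesis
      using pmul_semigroup[OF v1] unfolding semigroup_on_def by blast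
  qed
  show ?thesis
  proof (intro equalityI subsetI)
    fix u assume u: "u \<in> exmark t t1 (tmul t x y)"
    then obtain k1 z1 k2 z2 where *: "k1 < 3" "z1 < tsz t1" "tmark t k1 x z1 = 1" "k2 < 3" "z2 < tsz t1"
        "tmark t k2 y z2 = 1" "fst u = tmul t1 z1 z2" "snd u = cadd k1 k2"
      using ok[of "snd u" "fst u"] unfolding exmark_def by auto
    then have "u = pmul t1 (z1, k1) (z2, k2)" by (simp add: pmul_def prod_eq_iff)
    moreover have "(z1, k1) \<in> exmark t t1 x" "(z2, k2) \<in> exmark t t1 y"
      using * by (auto simp: exmark_def)
    ultimately show "u \<in> {pmul t1 u u' |u u'. u \<in> exmark t t1 x \<and> u' \<in> exmark t t1 y}" by blast
  next
    fix u assume "u \<in> {pmul t1 u u' |u u'. u \<in> exmark t t1 x \<and> u' \<in> exmark t t1 y}"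
    then obtain a c where ac: "u = pmul t1 a c" "a \<in> exmark t t1 x" "c \<in> exmark t t1 y" by blast
    have "fst u < tsz t1" "snd u < 3" using sg[OF ac(2,3)] ac(1) by (auto simp: mem_Times_iff)
    moreover have "tmark t (snd u) (tmul t x y) (fst u) = 1"
      unfolding ok[OF calculation(2,1)] using ac unfolding exmark_def pmul_def
      by (intro exI[of _ "snd a"] conjI exI[of _ "fst a"] exI[of _ "snd c"] exI[of _ "fst c"]) auto
    ultimately show "u \<in> exmark t t1 (tmul t x y)" by (simp add: exmark_def)
  qed
qed

text \<open>A value for the quantified variable amounts to choosing bit \<open>v\<close> at every
  position, so a letter of \<open>t\<close> stands for all letters of \<open>t1\<close> obtained by
  changing that bit. The counter sums the chosen bits; for tag 6, the first-order quantifier, it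
  must end at 1.\<close>

lemma recog_ex:
  assumes v: "valid_table (2 ^ N) D t" and v1: "valid_table (2 ^ N) D t1"
    and ok: "ok_ex N (2 ^ N) D tag v t t1" and rec: "recog N w t1 \<phi>" and "v < N"
    and sat: "\<And>V. sat_sets w V \<psi> \<longleftrightarrow> (\<exists>A. (tag = 6 \<longrightarrow> (\<exists>a. A = {a})) \<and> sat_sets w (V(v := A)) \<phi>)"
  shows "recog N w t \<psi>"
  unfolding recog_def
proof (intro allI impI)
  fix b s e
  assume b: "\<forall>n. b n < (2::nat) ^ N" and fac: "factor (tmul t) (\<lambda>n. tlet t (b n) (w n)) s e"
  note sg = valid_table_semigroup[OF v]
  have a: "tlet t (b n) (w n) \<in> {..<tsz t}" for n
    using valid_table_let[OF v] b w by simp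
  \<comment> \<open>\<open>Y n\<close> contains the masks that may be chosen at \<open>n\<close>,
    and \<open>l n\<close> turns a choice into its letter in \<open>t1\<close>, paired with the bit
    to be counted.\<close>
  define l where "l n c = (tlet t1 c (w n), of_bool (v \<in> set_decode c) :: nat)" for n c
  define Y where "Y n = {c. c < 2 ^ N \<and> variant N v (b n) c}" for n
  define L where "L c \<longleftrightarrow> (tag = 6 \<longrightarrow> (\<exists>a. vset c v = {a})) \<and> sat_sets w (vset c) \<phi>" for c
  define acc where "acc u u' \<longleftrightarrow> (tag = 6 \<longrightarrow> snd u = 1) \<and> tacc t1 (fst u) (fst u')" for u u' :: "nat \<times> nat"
  have "(\<exists>y. (\<forall>n. y n \<in> Y n) \<and> L y) \<longleftrightarrow>
    (\<exists>u\<in>exmark t t1 s. \<exists>u'\<in>exmark t t1 e. pmul t1 u u' = u \<and> pmul t1 u' u' = u' \<and> acc u u')"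
  proof (rule factor_powerset[where X = "{..<tsz t}" and g = "tmul t" and Z = "{..<tsz t1} \<times> {..<3}"
        and a = "\<lambda>n. tlet t (b n) (w n)" and M = "exmark t t1" and l = l])
    show "exmark t t1 A \<subseteq> {..<tsz t1} \<times> {..<3}" for A
      by (auto simp: exmark_def mem_Times_iff)
    show "exmark t t1 (tmul t A B) = {pmul t1 x y |x y. x \<in> exmark t t1 A \<and> y \<in> exmark t t1 B}"
      if "A \<in> {..<tsz t}" "B \<in> {..<tsz t}" for A B
      using exmark_mul[OF v1 ok] that by simp
    show "exmark t t1 (tlet t (b n) (w n)) = l n ` Y n" for n
    proof -
      have *: "tmark t k (tlet t (b n) (w n)) z = 1 \<longleftrightarrow>
          (\<exists>b'<2 ^ N. variant N v (b n) b' \<and> z = tlet t1 b' (w n) \<and> k = of_bool (v \<in> set_decode b'))"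
        if "k < 3" "z < tsz t1" for k z
        by (rule ok_ex_let[OF ok b[rule_format] w that])
      show ?thesis
      proof (intro equalityI subsetI)
        fix u assume "u \<in> exmark t t1 (tlet t (b n) (w n))"
        then obtain b' where "b' < 2 ^ N" "variant N v (b n) b'" "fst u = tlet t1 b' (w n)"
            "snd u = of_bool (v \<in> set_decode b')"
          using *[of "snd u" "fst u"] unfolding exmark_def by auto
        then show "u \<in> l n ` Y n"
          by (intro image_eqI[of _ _ b']) (auto simp: l_def Y_def prod_eq_iff)
      next
        fix u assume "u \<in> l n ` Y n"
        then obtain b' where b': "b' < 2 ^ N" "variant N v (b n) b'" "u = l n b'"
          by (auto simp: Y_def)
        have "fst u < tsz t1" "snd u < 3"
          using valid_table_let[OF v1 b'(1) w[of n]] b'(3) by (auto simp: l_def)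
        then show "u \<in> exmark t t1 (tlet t (b n) (w n))"
          using *[of "snd u" "fst u"] b' unfolding exmark_def l_def by auto
      qed
    qed
    show "L y \<longleftrightarrow> acc u u'" if y: "\<And>n. y n \<in> Y n" and f: "factor (pmul t1) (\<lambda>n. l n (y n)) u u'" for y u u'
    proof -
      have y: "\<forall>n. y n < 2 ^ N" using y by (simp add: Y_def)
      have l: "l n (y n) \<in> {..<tsz t1} \<times> {..<3}" for n
        using valid_table_let[OF v1 y[rule_format] w] by (auto simp: l_def)
      have "factor (tmul t1) (\<lambda>n. fst (l n (y n))) (fst u) (fst u')"
        by (rule factor_hom[of "{..<tsz t1} \<times> {..<3}" "pmul t1" _ fst, OF pmul_semigroup[OF v1] l _ f])
           (simp add: pmul_def)
      then have "sat_sets w (vset y) \<phi> \<longleftrightarrow> tacc t1 (fst u) (fst u')"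
        using rec y unfolding recog_def l_def by simp
      moreover have "factor cadd (\<lambda>n. snd (l n (y n))) (snd u) (snd u')"
        by (rule factor_hom[of "{..<tsz t1} \<times> {..<3}" "pmul t1" _ snd, OF pmul_semigroup[OF v1] l _ f])
           (simp add: pmul_def)
      then have "snd u = 1 \<longleftrightarrow> (\<exists>a. {n. v \<in> set_decode (y n)} = {a})"
        unfolding l_def snd_conv by (rule factor_count)
      ultimately show ?thesis
        by (simp add: L_def acc_def vset_def)
    qed
  qed (use sg a pmul_semigroup[OF v1] fac in auto)
  also have "\<dots> \<longleftrightarrow> tacc t s e"
  proof -
    have "s < tsz t" "e < tsz t"
      using factor_linked(1,2)[of "{..<tsz t}" "tmul t" "\<lambda>n. tlet t (b n) (w n)" s e, OF sg a fac] by auto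
    then have acc_iff: "tacc t s e \<longleftrightarrow>
           (\<exists>k1<3. \<exists>z1<tsz t1. tmark t k1 s z1 = 1 \<and> (\<exists>k2<3. \<exists>z2<tsz t1. tmark t k2 e z2 = 1 \<and>
              tmul t1 z1 z2 = z1 \<and> tmul t1 z2 z2 = z2 \<and> cadd k1 k2 = k1 \<and> cadd k2 k2 = k2 \<and>
              tacc t1 z1 z2 \<and> (tag = 6 \<longrightarrow> k1 = 1)))"
      by (rule ok_ex_acc[OF ok])
    show ?thesis
      unfolding acc_iff by (auto simp: exmark_def Bex_def pmul_def prod_eq_iff acc_def split_paired_Ex)
  qed
  finally have "(\<exists>y. (\<forall>n. y n \<in> Y n) \<and> L y) \<longleftrightarrow> tacc t s e" .
  moreover have "(\<exists>y. (\<forall>n. y n \<in> Y n) \<and> L y) \<longleftrightarrow> sat_sets w (vset b) \<psi>"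
  proof
    assume "\<exists>y. (\<forall>n. y n \<in> Y n) \<and> L y"
    then obtain y where y: "\<And>n. y n < 2 ^ N" "\<And>n. variant N v (b n) (y n)" "L y"
      by (auto simp: Y_def)
    have "vset y = (vset b)(v := vset y v)"
      by (rule vset_variant[of b N y v]) (use b y in auto)
    then show "sat_sets w (vset b) \<psi>"
      unfolding sat using y(3) unfolding L_def by metis
  next
    assume "sat_sets w (vset b) \<psi>"
    then obtain A where A: "tag = 6 \<longrightarrow> (\<exists>a. A = {a})" "sat_sets w ((vset b)(v := A)) \<phi>"
      unfolding sat by blast
    obtain y where y: "\<And>n. y n < 2 ^ N" "\<And>n. variant N v (b n) (y n)" "vset y = (vset b)(v := A)"
      using ex_variant[of b N v A] b \<open>v < N\<close> by blast
    then have "L y" using A by (simp add: L_def)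
    then show "\<exists>y. (\<forall>n. y n \<in> Y n) \<and> L y" using y by (auto simp: Y_def)
  qed
  ultimately show "sat_sets w (vset b) \<psi> \<longleftrightarrow> tacc t s e" by simp
qed

end

section \<open>Existence of recognising tables\<close>

lemma ex_ok_atom: "\<exists>t. valid_table B D t \<and> ok_atom B D tag p q t"
proof -
  have sg: "semigroup_on (UNIV :: bool set) (\<or>)" by (auto simp: semigroup_on_def)
  obtain t h where t: "valid_table B D t" "bij_betw h {..<tsz t} (UNIV :: bool set)"
    "\<And>x y. x < tsz t \<Longrightarrow> y < tsz t \<Longrightarrow> h (tmul t x y) = (h x \<or> h y)"
    "\<And>b j. b < B \<Longrightarrow> j < D \<Longrightarrow> h (tlet t b j) = atom_hit tag p q b j"
    "\<And>x y. x < tsz t \<Longrightarrow> y < tsz t \<Longrightarrow> tacc t x y \<longleftrightarrow> h x"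
    "\<And>k x y. k < (1::nat) \<Longrightarrow> x < tsz t \<Longrightarrow> y < 1 \<Longrightarrow> tmark t k x y = of_bool (h x)"
    using ex_table[of "UNIV :: bool set" "(\<or>)" B D "atom_hit tag p q" "\<lambda>x y. x" 1 1 "\<lambda>k x y. of_bool x",
        OF finite_UNIV sg UNIV_I] by blast
  have "tmul t x y < tsz t" if "x < tsz t" "y < tsz t" for x y
    using t(1) that by (simp add: valid_table_def)
  then have "ok_atom B D tag p q t"
    using t valid_table_let[OF t(1)] by (simp add: ok_atom_def)
  then show ?thesis using t(1) by blast
qed

lemma ex_ok_less: "\<exists>t. valid_table B D t \<and> ok_less B D p q t"
proof -
  define f where "f x y = (fst x \<or> fst y, fst (snd x) \<or> fst (snd y),
    snd (snd x) \<or> snd (snd y) \<or> fst x \<and> fst (snd y))" for x y :: "bool \<times> bool \<times> bool"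
  define l where "l b j = (2 * p \<in> set_decode b, 2 * q \<in> set_decode b, False)" for b j :: nat
  define mk where "mk k x y = (if y = 0 then of_bool (fst x) else if y = 1 then of_bool (fst (snd x))
      else of_bool (snd (snd x)) :: nat)" for k y :: nat and x :: "bool \<times> bool \<times> bool"
  have sg: "semigroup_on UNIV f" by (auto simp: semigroup_on_def f_def)
  obtain t h where t: "valid_table B D t" "bij_betw h {..<tsz t} (UNIV :: (bool \<times> bool \<times> bool) set)"
    "\<And>x y. x < tsz t \<Longrightarrow> y < tsz t \<Longrightarrow> h (tmul t x y) = f (h x) (h y)"
    "\<And>b j. b < B \<Longrightarrow> j < D \<Longrightarrow> h (tlet t b j) = l b j"
    "\<And>x y. x < tsz t \<Longrightarrow> y < tsz t \<Longrightarrow> tacc t x y \<longleftrightarrow> snd (snd (h x))"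
    "\<And>k x y. k < (1::nat) \<Longrightarrow> x < tsz t \<Longrightarrow> y < 3 \<Longrightarrow> tmark t k x y = mk k (h x) y"
    using ex_table[of UNIV f B D l "\<lambda>x y. snd (snd x)" 1 3 mk, OF finite_UNIV sg UNIV_I] by blast
  have "tmul t x y < tsz t" if "x < tsz t" "y < tsz t" for x y
    using t(1) that by (simp add: valid_table_def)
  then have "ok_less B D p q t"
    using t(3-6) valid_table_let[OF t(1)] by (simp add: ok_less_def f_def l_def mk_def)
  then show ?thesis using t(1) by blast
qed

text \<open>The table is given entry by entry because \<open>ok_neg\<close> wants the very elements
  of \<open>t1\<close>, whereas the bijection in \<open>ex_table\<close> may rename them.\<close>

lemma ex_ok_neg:
  assumes "valid_table B D t1"
  shows "\<exists>t. valid_table B D t \<and> ok_neg B D t t1"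
proof -
  define F where "F i x y = (if i = 0 then tsz t1 else if i = 1 then tmul t1 x y
    else if i = 2 then tlet t1 x y else of_bool (\<not> tacc t1 x y))" for i x y :: nat
  obtain t where t: "\<forall>i<4. \<forall>x<tsz t1 + B + 1. \<forall>y<tsz t1 + D + 1. lookup t i x y = F i x y"
    using ex_lookup[of 4 "tsz t1 + B + 1" "tsz t1 + D + 1" F] by blast
  have eq: "tsz t = tsz t1" "\<And>x y. x < tsz t1 \<Longrightarrow> y < tsz t1 \<Longrightarrow> tmul t x y = tmul t1 x y"
    "\<And>x y. x < tsz t1 \<Longrightarrow> y < tsz t1 \<Longrightarrow> tacc t x y \<longleftrightarrow> \<not> tacc t1 x y"
    "\<And>b j. b < B \<Longrightarrow> j < D \<Longrightarrow> tlet t b j = tlet t1 b j"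
    using t by (simp_all add: tsz_def[of t] tmul_def[of t] tacc_def[of t] tlet_def[of t] F_def)
  have "ok_neg B D t t1" using eq by (simp add: ok_neg_def)
  moreover have "valid_table B D t"
    using assms eq by (simp add: valid_table_def)
  ultimately show ?thesis by blast
qed

lemma ex_ok_conj:
  assumes v: "valid_table B D t1" "valid_table B D t2"
  shows "\<exists>t. valid_table B D t \<and> ok_conj B D t t1 t2"
proof -
  define X where "X = {..<tsz t1} \<times> {..<tsz t2}"
  define f where "f u v = (tmul t1 (fst u) (fst v), tmul t2 (snd u) (snd v))" for u v :: "nat \<times> nat"
  define l where "l b j = (tlet t1 b j, tlet t2 b j)" for b j
  define ac where "ac u v \<longleftrightarrow> tacc t1 (fst u) (fst v) \<and> tacc t2 (snd u) (snd v)" for u v :: "nat \<times> nat"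
  define mk where "mk k x y = (if y = 0 then fst x else snd x)" for k y :: nat and x :: "nat \<times> nat"
  have sg: "semigroup_on X f"
    using v[THEN valid_table_semigroup] by (auto simp: semigroup_on_def f_def X_def)
  have X: "finite X" by (simp add: X_def)
  have l: "l b j \<in> X" if "b < B" "j < D" for b j
    using v[THEN valid_table_let, OF that] by (simp add: l_def X_def)
  obtain t h where t: "valid_table B D t" "bij_betw h {..<tsz t} X"
    "\<And>x y. x < tsz t \<Longrightarrow> y < tsz t \<Longrightarrow> h (tmul t x y) = f (h x) (h y)"
    "\<And>b j. b < B \<Longrightarrow> j < D \<Longrightarrow> h (tlet t b j) = l b j"
    "\<And>x y. x < tsz t \<Longrightarrow> y < tsz t \<Longrightarrow> tacc t x y \<longleftrightarrow> ac (h x) (h y)"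
    "\<And>k x y. k < (1::nat) \<Longrightarrow> x < tsz t \<Longrightarrow> y < 2 \<Longrightarrow> tmark t k x y = mk k (h x) y"
    using ex_table[of X f B D l ac 1 2 mk, OF X sg l] by blast
  have "tmul t x y < tsz t" if "x < tsz t" "y < tsz t" for x y
    using t(1) that by (simp add: valid_table_def)
  then have "ok_conj B D t t1 t2"
    using t(3-6) valid_table_let[OF t(1)] by (simp add: ok_conj_def f_def l_def mk_def ac_def)
  then show ?thesis using t(1) by blast
qed

text \<open>The witness is the powerset of \<open>Z\<close> with elementwise product.\<close>

lemma ex_ok_ex:
  assumes v1: "valid_table B D t1"
  shows "\<exists>t. valid_table B D t \<and> ok_ex N B D tag v t t1"
proof -
  define Z where "Z = {..<tsz t1} \<times> {..<3::nat}"
  define f where "f U V = {pmul t1 u v |u v. u \<in> U \<and> v \<in> V}" for U V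
  define l where "l b j = {(tlet t1 b' j, of_bool (v \<in> set_decode b') :: nat) |b'. b' < B \<and> variant N v b b'}" for b j
  define ac where "ac U V \<longleftrightarrow> (\<exists>k1<3. \<exists>z1<tsz t1. (z1, k1) \<in> U \<and> (\<exists>k2<3. \<exists>z2<tsz t1. (z2, k2) \<in> V \<and>
              tmul t1 z1 z2 = z1 \<and> tmul t1 z2 z2 = z2 \<and> cadd k1 k2 = k1 \<and> cadd k2 k2 = k2 \<and>
              tacc t1 z1 z2 \<and> (tag = 6 \<longrightarrow> k1 = 1)))" for U V :: "(nat \<times> nat) set"
  define mk where "mk k U z = (of_bool ((z, k) \<in> U) :: nat)" for k z :: nat and U :: "(nat \<times> nat) set"
  note sgZ = pmul_semigroup[OF v1, folded Z_def]
  have sg: "semigroup_on (Pow Z) f"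
    unfolding semigroup_on_def
  proof (intro conjI ballI)
    fix U V assume "U \<in> Pow Z" "V \<in> Pow Z"
    then show "f U V \<in> Pow Z"
      using sgZ unfolding semigroup_on_def f_def by blast
  next
    fix U V W assume UVW: "U \<in> Pow Z" "V \<in> Pow Z" "W \<in> Pow Z"
    have as: "pmul t1 (pmul t1 u v) w = pmul t1 u (pmul t1 v w)" if "u \<in> U" "v \<in> V" "w \<in> W" for u v w
      using sgZ UVW that unfolding semigroup_on_def by blast
    show "f (f U V) W = f U (f V W)"
    proof (intro equalityI subsetI)
      fix x assume "x \<in> f (f U V) W"
      then obtain u v w where "u \<in> U" "v \<in> V" "w \<in> W" "x = pmul t1 (pmul t1 u v) w"
        unfolding f_def by blast
      then show "x \<in> f U (f V W)"
        using as unfolding f_def by blast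
    next
      fix x assume "x \<in> f U (f V W)"
      then obtain u v w where "u \<in> U" "v \<in> V" "w \<in> W" "x = pmul t1 u (pmul t1 v w)"
        unfolding f_def by blast
      then show "x \<in> f (f U V) W"
        using as[symmetric] unfolding f_def by blast
    qed
  qed
  have X: "finite (Pow Z)" by (simp add: Z_def)
  have l: "l b j \<in> Pow Z" if "b < B" "j < D" for b j
    using valid_table_let[OF v1 _ that(2)] by (auto simp: l_def Z_def)
  obtain t h where t: "valid_table B D t" "bij_betw h {..<tsz t} (Pow Z)"
    "\<And>x y. x < tsz t \<Longrightarrow> y < tsz t \<Longrightarrow> h (tmul t x y) = f (h x) (h y)"
    "\<And>b j. b < B \<Longrightarrow> j < D \<Longrightarrow> h (tlet t b j) = l b j"
    "\<And>x y. x < tsz t \<Longrightarrow> y < tsz t \<Longrightarrow> tacc t x y \<longleftrightarrow> ac (h x) (h y)"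
    "\<And>k x y. k < (3::nat) \<Longrightarrow> x < tsz t \<Longrightarrow> y < tsz t1 \<Longrightarrow> tmark t k x y = mk k (h x) y"
    using ex_table[of "Pow Z" f B D l ac 3 "tsz t1" mk, OF X sg l] by blast
  have mark: "tmark t k x z = 1 \<longleftrightarrow> (z, k) \<in> h x" if "k < 3" "x < tsz t" "z < tsz t1" for k x z
    using t(6)[OF that] by (simp add: mk_def)
  have hZ: "h x \<subseteq> Z" if "x < tsz t" for x
    using t(2) that by (auto simp: bij_betw_def)
  have mul_lt: "tmul t x y < tsz t" if "x < tsz t" "y < tsz t" for x y
    using t(1) that by (simp add: valid_table_def)
  have "ok_ex N B D tag v t t1"
    unfolding ok_ex_def
  proof (intro conjI allI impI)
    fix x y k z assume *: "x < tsz t" "y < tsz t" "k < (3::nat)" "z < tsz t1"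
    have "tmark t k (tmul t x y) z = 1 \<longleftrightarrow> (z, k) \<in> f (h x) (h y)"
      using mark mul_lt t(3) * by simp
    also have "\<dots> \<longleftrightarrow> (\<exists>k1<3. \<exists>z1<tsz t1. (z1, k1) \<in> h x \<and> (\<exists>k2<3. \<exists>z2<tsz t1. (z2, k2) \<in> h y \<and>
              z = tmul t1 z1 z2 \<and> k = cadd k1 k2))"
      using hZ[OF *(1)] hZ[OF *(2)] unfolding f_def pmul_def Z_def by fastforce
    also have "\<dots> \<longleftrightarrow> (\<exists>k1<3. \<exists>z1<tsz t1. tmark t k1 x z1 = 1 \<and> (\<exists>k2<3. \<exists>z2<tsz t1. tmark t k2 y z2 = 1 \<and>
              z = tmul t1 z1 z2 \<and> k = cadd k1 k2))"
      using mark * by (simp cong: conj_cong)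
    finally show "tmark t k (tmul t x y) z = 1 \<longleftrightarrow> (\<exists>k1<3. \<exists>z1<tsz t1. tmark t k1 x z1 = 1 \<and>
        (\<exists>k2<3. \<exists>z2<tsz t1. tmark t k2 y z2 = 1 \<and> z = tmul t1 z1 z2 \<and> k = cadd k1 k2))" .
  next
    fix x y assume *: "x < tsz t" "y < tsz t"
    show "tacc t x y \<longleftrightarrow> (\<exists>k1<3. \<exists>z1<tsz t1. tmark t k1 x z1 = 1 \<and> (\<exists>k2<3. \<exists>z2<tsz t1. tmark t k2 y z2 = 1 \<and>
              tmul t1 z1 z2 = z1 \<and> tmul t1 z2 z2 = z2 \<and> cadd k1 k2 = k1 \<and> cadd k2 k2 = k2 \<and>
              tacc t1 z1 z2 \<and> (tag = 6 \<longrightarrow> k1 = 1)))"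
      unfolding t(5)[OF *] ac_def using mark * by (simp cong: conj_cong)
  next
    fix b j k z assume *: "b < B" "j < D" "k < (3::nat)" "z < tsz t1"
    have "tmark t k (tlet t b j) z = 1 \<longleftrightarrow> (z, k) \<in> l b j"
      using mark[OF *(3) valid_table_let[OF t(1) *(1,2)] *(4)] t(4)[OF *(1,2)] by simp
    then show "tmark t k (tlet t b j) z = 1 \<longleftrightarrow>
        (\<exists>b'<B. variant N v b b' \<and> z = tlet t1 b' j \<and> k = of_bool (v \<in> set_decode b'))"
      unfolding l_def by blast
  qed
  then show ?thesis using t(1) by blast
qed

definition ok_step :: "nat \<Rightarrow> nat \<Rightarrow> nat \<Rightarrow> nat \<Rightarrow> nat \<Rightarrow> nat \<Rightarrow> nat \<Rightarrow> nat \<Rightarrow> nat \<Rightarrow> bool" where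
  "ok_step N B D tag p q t t1 t2 \<longleftrightarrow> valid_table B D t \<and>
     (tag = 0 \<longrightarrow> ok_less B D p q t) \<and>
     (1 \<le> tag \<and> tag \<le> 3 \<longrightarrow> ok_atom B D tag p q t) \<and>
     (tag = 4 \<longrightarrow> ok_neg B D t t1) \<and>
     (tag = 5 \<longrightarrow> ok_conj B D t t1 t2) \<and>
     (tag = 6 \<longrightarrow> ok_ex N B D tag (2 * p) t t1) \<and>
     (tag = 7 \<longrightarrow> ok_ex N B D tag (Suc (2 * p)) t t1)"

lemma ex_ok_step:
  assumes "4 \<le> tag \<Longrightarrow> valid_table B D t1" "4 \<le> tag \<Longrightarrow> valid_table B D t2"
  shows "\<exists>t. ok_step N B D tag p q t t1 t2"
proof -
  consider "tag = 0" | "1 \<le> tag" "tag \<le> 3" | "tag = 4" | "tag = 5" | "tag = 6" | "tag = 7" | "8 \<le> tag"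
    by linarith
  then show ?thesis
  proof cases
    case 1
    then show ?thesis using ex_ok_less[of B D p q] by (simp add: ok_step_def)
  next
    case 2
    then show ?thesis using ex_ok_atom[of B D tag p q] by (simp add: ok_step_def)
  next
    case 3
    then show ?thesis using ex_ok_neg[of B D t1] assms by (simp add: ok_step_def)
  next
    case 4
    then show ?thesis using ex_ok_conj[of B D t1 t2] assms by (simp add: ok_step_def)
  next
    case 5
    then show ?thesis using ex_ok_ex[of B D t1 N tag "2 * p"] assms by (simp add: ok_step_def)
  next
    case 6
    then show ?thesis using ex_ok_ex[of B D t1 N tag "Suc (2 * p)"] assms by (simp add: ok_step_def)
  next
    \<comment> \<open>Tags beyond 7 code no formula. Only validity is demanded then, and the table
      for \<open>Less\<close> provides it.\<close>
    case 7
    then show ?thesis using ex_ok_less[of B D p q] by (auto simp: ok_step_def)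
  qed
qed

section \<open>One table for each formula code\<close>

definition code_tag :: "nat \<Rightarrow> nat" where "code_tag c = fst (prod_decode c)"
definition code_arg1 :: "nat \<Rightarrow> nat" where "code_arg1 c = fst (prod_decode (snd (prod_decode c)))"
definition code_arg2 :: "nat \<Rightarrow> nat" where "code_arg2 c = snd (prod_decode (snd (prod_decode c)))"

text \<open>The first subformula: a negation has it as its whole argument, a conjunction as the
  first component, a quantifier as the second, after the variable.\<close>

definition code_sub :: "nat \<Rightarrow> nat" where
  "code_sub c = (if code_tag c = 4 then snd (prod_decode c)
     else if code_tag c = 5 then code_arg1 c else code_arg2 c)"

text \<open>Every number \<open>c\<close> is read as a formula. For tags below 4 the arguments \<open>code_sub c\<close> and
  \<open>code_arg2 c\<close> need not be smaller than \<open>c\<close>, but then \<open>ok_step\<close> does not look at their tables.\<close>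

definition ok_family :: "nat \<Rightarrow> nat \<Rightarrow> nat \<Rightarrow> (nat \<Rightarrow> nat) \<Rightarrow> nat \<Rightarrow> bool" where
  "ok_family N B D tt c \<longleftrightarrow> ok_step N B D (code_tag c) (code_arg1 c) (code_arg2 c)
     (tt c) (tt (code_sub c)) (tt (code_arg2 c))"

text \<open>The code of \<open>(a, r)\<close> is \<open>triangle (a + r) + a\<close>, which exceeds
  \<open>r\<close> as soon as the tag \<open>a\<close> is positive.\<close>

lemma code_sub_less:
  assumes "4 \<le> code_tag c"
  shows "code_sub c < c" "code_arg1 c < c" "code_arg2 c < c"
proof -
  obtain a r where c: "c = prod_encode (a, r)" by (metis prod_decode_inverse surj_pair)
  obtain x y where r: "r = prod_encode (x, y)" by (metis prod_decode_inverse surj_pair)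
  have "4 \<le> a" using assms by (simp add: code_tag_def c)
  moreover have "a + r \<le> triangle (a + r)"
    using le_prod_encode_2[of "a + r" 0] by (simp add: prod_encode_def)
  ultimately have "r < c" by (simp add: c prod_encode_def)
  moreover have "x \<le> r" "y \<le> r"
    using le_prod_encode_1 le_prod_encode_2 by (simp_all add: r)
  ultimately show "code_sub c < c" "code_arg1 c < c" "code_arg2 c < c"
    by (auto simp: code_sub_def code_arg1_def code_arg2_def c r)
qed

lemma ex_ok_family: "\<exists>tt. \<forall>c. ok_family N B D tt c"
proof -
  define Q where "Q = (\<lambda>tt c t. ok_step N B D (code_tag c) (code_arg1 c) (code_arg2 c) t
      (tt (code_sub c)) (tt (code_arg2 c)))"
  \<comment> \<open>Well-founded choice may refer to smaller codes only. For tags below 4 the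
    arguments need not be smaller, so a constant family replaces \<open>tt\<close> there.\<close>
  let ?Q = "\<lambda>(tt :: nat \<Rightarrow> nat) c t. valid_table B D t \<and>
      (4 \<le> code_tag c \<longrightarrow> Q tt c t) \<and> (code_tag c < 4 \<longrightarrow> Q (\<lambda>_. 0) c t)"
  have "\<exists>tt. \<forall>c. ?Q tt c (tt c)"
  proof (rule dependent_wf_choice[OF wf_less])
    fix tt tt' :: "nat \<Rightarrow> nat" and c t
    assume "\<And>z. (z, c) \<in> {(x, y). x < y} \<Longrightarrow> tt z = tt' z"
    then have "4 \<le> code_tag c \<Longrightarrow> Q tt c t = Q tt' c t"
      using code_sub_less[of c] by (simp add: Q_def)
    then show "?Q tt c t = ?Q tt' c t" by blast
  next
    fix c and tt :: "nat \<Rightarrow> nat"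
    assume "\<And>y. (y, c) \<in> {(x, y). x < y} \<Longrightarrow> ?Q tt y (tt y)"
    then have IH: "valid_table B D (tt y)" if "y < c" for y using that by simp
    show "\<exists>t. ?Q tt c t"
    proof (cases "4 \<le> code_tag c")
      case True
      have "\<exists>t. Q tt c t"
        unfolding Q_def by (rule ex_ok_step) (use code_sub_less[OF True] IH in auto)
      then show ?thesis using True by (auto simp: Q_def ok_step_def)
    next
      case False
      have "\<exists>t. Q (\<lambda>_. 0) c t"
        unfolding Q_def by (rule ex_ok_step) (use False in auto)
      then show ?thesis using False by (auto simp: Q_def ok_step_def)
    qed
  qed
  then obtain tt where tt: "\<And>c. ?Q tt c (tt c)" by blast
  have "ok_family N B D tt c" for c
    using tt[of c] unfolding ok_family_def Q_def ok_step_def by (cases "4 \<le> code_tag c") auto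
  then show ?thesis by blast
qed

text \<open>A variable bound in a formula with code at most \<open>c\<close> has number at most
  \<open>c\<close>, so its index \<open>2 * x\<close> or \<open>Suc (2 * X)\<close> is below
  \<open>2 * c + 2\<close>. One such bound serves all subformulas.\<close>

lemma ok_family_recog:
  assumes w: "\<And>n. w n < D" and ok: "\<And>c'. c' \<le> c \<Longrightarrow> ok_family (2 * c + 2) (2 ^ (2 * c + 2)) D tt c'"
  shows "mso_code \<phi> \<le> c \<Longrightarrow> recog (2 * c + 2) w (tt (mso_code \<phi>)) \<phi>"
proof (induction \<phi>)
  case (Less x y)
  then show ?case
    using ok[OF Less] by (intro recog_less[where D = D])
      (auto simp: w ok_family_def ok_step_def code_tag_def code_arg1_def code_arg2_def)
next
  case (Eq x y)
  show ?case
    using ok[OF Eq] by (intro recog_atom[where D = D and tag = 1 and p = x and q = y])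
      (auto simp: w ok_family_def ok_step_def code_tag_def code_arg1_def code_arg2_def atom_hit_def vset_def)
next
  case (Mem x X)
  show ?case
    using ok[OF Mem] by (intro recog_atom[where D = D and tag = 2 and p = x and q = X])
      (auto simp: w ok_family_def ok_step_def code_tag_def code_arg1_def code_arg2_def atom_hit_def vset_def)
next
  case (Pred i x)
  show ?case
    using ok[OF Pred] by (intro recog_atom[where D = D and tag = 3 and p = i and q = x])
      (auto simp: w ok_family_def ok_step_def code_tag_def code_arg1_def code_arg2_def atom_hit_def vset_def)
next
  case (Neg \<phi>)
  have "mso_code \<phi> \<le> c" using Neg.prems le_prod_encode_2[of "mso_code \<phi>" 4] by simp
  from Neg.IH[OF this] show ?case
    using ok[OF Neg.prems] by (intro recog_neg[where D = D and ?t1.0 = "tt (mso_code \<phi>)"])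
      (auto simp: w ok_family_def ok_step_def code_tag_def code_arg1_def code_arg2_def code_sub_def)
next
  case (Conj \<phi> \<psi>)
  have "mso_code \<phi> \<le> c" "mso_code \<psi> \<le> c"
    using Conj.prems le_prod_encode_2[of "prod_encode (mso_code \<phi>, mso_code \<psi>)" 5]
      le_prod_encode_2[of "mso_code \<psi>" "mso_code \<phi>"] le_prod_encode_1[of "mso_code \<phi>" "mso_code \<psi>"] by auto
  from Conj.IH(1)[OF this(1)] Conj.IH(2)[OF this(2)] show ?case
    using ok[OF Conj.prems] by (intro recog_conj[where D = D and ?t1.0 = "tt (mso_code \<phi>)" and ?t2.0 = "tt (mso_code \<psi>)"])
      (auto simp: w ok_family_def ok_step_def code_tag_def code_arg1_def code_arg2_def code_sub_def)
next
  case (Ex x \<phi>)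
  have le: "mso_code \<phi> \<le> c" "x \<le> c"
    using Ex.prems le_prod_encode_2[of "prod_encode (x, mso_code \<phi>)" 6]
      le_prod_encode_2[of "mso_code \<phi>" x] le_prod_encode_1[of x "mso_code \<phi>"] by auto
  have step: "valid_table (2 ^ (2 * c + 2)) D (tt (mso_code (Ex x \<phi>)))"
    "valid_table (2 ^ (2 * c + 2)) D (tt (mso_code \<phi>))"
    "ok_ex (2 * c + 2) (2 ^ (2 * c + 2)) D 6 (2 * x) (tt (mso_code (Ex x \<phi>))) (tt (mso_code \<phi>))"
    using ok[OF Ex.prems] ok[OF le(1)] unfolding ok_family_def ok_step_def
    by (simp_all add: code_tag_def code_arg1_def code_arg2_def code_sub_def del: power_add power_Suc)
  have bound: "2 * x < 2 * c + 2" using le(2) by simp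
  show ?case
    by (rule recog_ex[OF w step Ex.IH[OF le(1)] bound]) (auto simp del: fun_upd_apply)
next
  case (ExSet X \<phi>)
  have le: "mso_code \<phi> \<le> c" "X \<le> c"
    using ExSet.prems le_prod_encode_2[of "prod_encode (X, mso_code \<phi>)" 7]
      le_prod_encode_2[of "mso_code \<phi>" X] le_prod_encode_1[of X "mso_code \<phi>"] by auto
  have step: "valid_table (2 ^ (2 * c + 2)) D (tt (mso_code (ExSet X \<phi>)))"
    "valid_table (2 ^ (2 * c + 2)) D (tt (mso_code \<phi>))"
    "ok_ex (2 * c + 2) (2 ^ (2 * c + 2)) D 7 (Suc (2 * X)) (tt (mso_code (ExSet X \<phi>))) (tt (mso_code \<phi>))"
    using ok[OF ExSet.prems] ok[OF le(1)] unfolding ok_family_def ok_step_def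
    by (simp_all add: code_tag_def code_arg1_def code_arg2_def code_sub_def del: power_add power_Suc)
  have bound: "Suc (2 * X) < 2 * c + 2" using le(2) by simp
  show ?case
    by (rule recog_ex[OF w step ExSet.IH[OF le(1)] bound]) (auto simp del: fun_upd_apply)
qed

section \<open>Computing recognising tables\<close>

text \<open>Each bounded quantifier shifts the environment; in this form an assumption applies at
  any quantifier depth.\<close>

lemma recfun_shift: "recfun A \<Longrightarrow> recfun (\<lambda>e. A (\<lambda>i. e (j i)))"
  by (rule recfun_subst[of A "\<lambda>i e. e (j i)"]) (assumption, rule recfun_var)

lemma recfun_of_bool: "decpred P \<Longrightarrow> recfun (\<lambda>e. of_bool (P e))"
  by (simp add: decpred_def)

lemma recfun_tsz: "recfun T \<Longrightarrow> recfun (\<lambda>e. tsz (T e))"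
  unfolding tsz_def by (intro recfun_lookup recfun_const)

lemma recfun_tmul: "recfun T \<Longrightarrow> recfun A \<Longrightarrow> recfun B \<Longrightarrow> recfun (\<lambda>e. tmul (T e) (A e) (B e))"
  unfolding tmul_def by (intro recfun_lookup recfun_const)

lemma recfun_tlet: "recfun T \<Longrightarrow> recfun A \<Longrightarrow> recfun B \<Longrightarrow> recfun (\<lambda>e. tlet (T e) (A e) (B e))"
  unfolding tlet_def by (intro recfun_lookup recfun_const)

lemma recfun_tmark:
  "recfun T \<Longrightarrow> recfun K \<Longrightarrow> recfun A \<Longrightarrow> recfun B \<Longrightarrow> recfun (\<lambda>e. tmark (T e) (K e) (A e) (B e))"
  unfolding tmark_def by (intro recfun_lookup recfun_add recfun_const)

lemma decpred_tacc: "recfun T \<Longrightarrow> recfun A \<Longrightarrow> recfun B \<Longrightarrow> decpred (\<lambda>e. tacc (T e) (A e) (B e))"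
  unfolding tacc_def by (intro decpred_eq recfun_lookup recfun_const)

lemma recfun_cadd: "recfun A \<Longrightarrow> recfun B \<Longrightarrow> recfun (\<lambda>e. cadd (A e) (B e))"
  unfolding cadd_def by (intro rec_intros)

lemmas table_intros = rec_intros recfun_tsz recfun_tmul recfun_tlet recfun_tmark decpred_tacc
  recfun_cadd recfun_of_bool decpred_set_decode

lemma decpred_valid_table:
  assumes "recfun B" "recfun D" "recfun T"
  shows "decpred (\<lambda>e. valid_table (B e) (D e) (T e))"
  unfolding valid_table_def by (intro table_intros assms[THEN recfun_shift] assms)

lemma decpred_atom_hit:
  assumes "recfun A" "recfun P" "recfun Q" "recfun B" "recfun J"
  shows "decpred (\<lambda>e. atom_hit (A e) (P e) (Q e) (B e) (J e))"
  unfolding atom_hit_def by (intro table_intros assms)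

lemma decpred_ok_atom:
  assumes "recfun B" "recfun D" "recfun A" "recfun P" "recfun Q" "recfun T"
  shows "decpred (\<lambda>e. ok_atom (B e) (D e) (A e) (P e) (Q e) (T e))"
  unfolding ok_atom_def by (intro table_intros decpred_atom_hit assms[THEN recfun_shift] assms)

lemma decpred_ok_less:
  assumes "recfun B" "recfun D" "recfun P" "recfun Q" "recfun T"
  shows "decpred (\<lambda>e. ok_less (B e) (D e) (P e) (Q e) (T e))"
  unfolding ok_less_def by (intro table_intros assms[THEN recfun_shift] assms)

lemma decpred_ok_neg:
  assumes "recfun B" "recfun D" "recfun T" "recfun T1"
  shows "decpred (\<lambda>e. ok_neg (B e) (D e) (T e) (T1 e))"
  unfolding ok_neg_def by (intro table_intros assms[THEN recfun_shift] assms)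

lemma decpred_ok_conj:
  assumes "recfun B" "recfun D" "recfun T" "recfun T1" "recfun T2"
  shows "decpred (\<lambda>e. ok_conj (B e) (D e) (T e) (T1 e) (T2 e))"
  unfolding ok_conj_def by (intro table_intros assms[THEN recfun_shift] assms)

lemma decpred_variant:
  assumes "recfun N" "recfun V" "recfun A" "recfun B"
  shows "decpred (\<lambda>e. variant (N e) (V e) (A e) (B e))"
  unfolding variant_def by (intro table_intros assms[THEN recfun_shift] assms)

lemma decpred_ok_ex:
  assumes "recfun N" "recfun B" "recfun D" "recfun A" "recfun V" "recfun T" "recfun T1"
  shows "decpred (\<lambda>e. ok_ex (N e) (B e) (D e) (A e) (V e) (T e) (T1 e))"
  unfolding ok_ex_def by (intro table_intros decpred_variant assms[THEN recfun_shift] assms)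

lemma decpred_ok_step:
  assumes "recfun N" "recfun B" "recfun D" "recfun A" "recfun P" "recfun Q"
    "recfun T" "recfun T1" "recfun T2"
  shows "decpred (\<lambda>e. ok_step (N e) (B e) (D e) (A e) (P e) (Q e) (T e) (T1 e) (T2 e))"
  unfolding ok_step_def
  by (intro table_intros decpred_valid_table decpred_ok_atom decpred_ok_less decpred_ok_neg
      decpred_ok_conj decpred_ok_ex assms)

lemma decpred_ok_family:
  assumes "recfun N" "recfun B" "recfun D" "recfun T" "recfun C"
  shows "decpred (\<lambda>e. ok_family (N e) (B e) (D e) (code_nth (T e)) (C e))"
  unfolding ok_family_def code_sub_def code_tag_def code_arg1_def code_arg2_def
  by (intro table_intros decpred_ok_step recfun_code_nth recfun_fst_prod_decode
      recfun_snd_prod_decode assms)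

text \<open>The search is for the code of a list of tables for all numbers up to \<open>c\<close>.
  Subformulas have smaller codes, so the list can be checked on its own.\<close>

lemma ex_recognizer:
  obtains tab :: "nat \<Rightarrow> nat" where "computable tab"
    "\<And>w \<phi>. (\<And>n. w n < D) \<Longrightarrow> recog (2 * mso_code \<phi> + 2) w (tab (mso_code \<phi>)) \<phi>"
    "\<And>c. valid_table (2 ^ (2 * c + 2)) D (tab c)"
proof -
  define ok where "ok c T \<longleftrightarrow> (\<forall>c'<Suc c. ok_family (2 * c + 2) (2 ^ (2 * c + 2)) D (code_nth T) c')" for c T
  have ex: "\<exists>T. ok c T" for c
  proof -
    obtain tt where tt: "\<And>c'. ok_family (2 * c + 2) (2 ^ (2 * c + 2)) D tt c'"
      using ex_ok_family[of "2 * c + 2" "2 ^ (2 * c + 2)" D] by blast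
    define T where "T = list_encode (map tt [0..<Suc c])"
    have T: "code_nth T c' = tt c'" if "c' < Suc c" for c'
      unfolding T_def using that code_nth_list_encode[of c' "map tt [0..<Suc c]"]
      by (simp del: upt_Suc)
    have "ok_family (2 * c + 2) (2 ^ (2 * c + 2)) D (code_nth T) c'" if "c' < Suc c" for c'
    proof (cases "4 \<le> code_tag c'")
      case True
      from code_sub_less[OF this] show ?thesis
        using tt[of c'] that T unfolding ok_family_def by simp
    next
      \<comment> \<open>Here the arguments may lie beyond the end of the list, but the condition
        does not look at their tables.\<close>
      case False
      then show ?thesis
        using tt[of c'] T[OF that] unfolding ok_family_def ok_step_def by simp
    qed
    then show ?thesis unfolding ok_def by blast
  qed
  define Tb where "Tb c = (LEAST T. ok c T)" for c
  have Tb: "ok c (Tb c)" for c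
    unfolding Tb_def using ex by (rule LeastI_ex)
  have dec: "decpred (\<lambda>e. ok (e (Suc 0)) (e 0))"
    unfolding ok_def by (intro decpred_all_less decpred_ok_family rec_intros)
  have "recfun (\<lambda>e. Tb (e 0))"
    unfolding Tb_def by (rule recfun_Least[of "\<lambda>T e. ok (e 0) T"]) (use dec ex in auto)
  then have "recfun (\<lambda>e. code_nth (Tb (e 0)) (e 0))"
    by (intro recfun_code_nth recfun_var)
  then have "computable (\<lambda>c. code_nth (Tb c) c)"
    by (simp add: recfun_computable_iff)
  moreover have "recog (2 * mso_code \<phi> + 2) w (code_nth (Tb (mso_code \<phi>)) (mso_code \<phi>)) \<phi>"
    if "\<And>n. w n < D" for w \<phi>
    by (rule ok_family_recog[OF that]) (use Tb[of "mso_code \<phi>"] in \<open>auto simp: ok_def\<close>)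
  moreover have "valid_table (2 ^ (2 * c + 2)) D (code_nth (Tb c) c)" for c
    using Tb[of c] unfolding ok_def ok_family_def ok_step_def by blast
  ultimately show thesis using that by blast
qed

section \<open>Ultimately periodic gaps\<close>

text \<open>With \<open>B = 1\<close> the only mask is 0, which leaves the bare word
  \<open>w\<close>. \<open>F\<close> and \<open>G\<close> must serve all valid tables, since the
  lift applies them to a table computed from the given one.\<close>

definition eff_factor :: "nat \<Rightarrow> (nat \<Rightarrow> nat) \<Rightarrow> bool" where
  "eff_factor D w \<longleftrightarrow> (\<forall>n. w n < D) \<and> (\<exists>F G. computable F \<and> computable G \<and>
     (\<forall>t. valid_table 1 D t \<longrightarrow> factor (tmul t) (\<lambda>n. tlet t 0 (w n)) (F t) (G t)))"

text \<open>\<open>x\<close> followed by \<open>i\<close> copies of the letter 0; starting from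
  \<open>x\<close> avoids an empty product.\<close>

definition rpow :: "nat \<Rightarrow> nat \<Rightarrow> nat \<Rightarrow> nat" where
  "rpow t x i = rec_nat x (\<lambda>k r. tmul t r (tlet t 0 0)) i"

lemma rpow_simps: "rpow t x 0 = x" "rpow t x (Suc i) = tmul t (rpow t x i) (tlet t 0 0)"
  by (simp_all add: rpow_def)

lemma recfun_rpow: "recfun T \<Longrightarrow> recfun A \<Longrightarrow> recfun B \<Longrightarrow> recfun (\<lambda>e. rpow (T e) (A e) (B e))"
proof (rule recfun_app3[where f = rpow])
  show "recfun (\<lambda>e. rpow (e 0) (e (Suc 0)) (e (Suc (Suc 0))))"
    unfolding rpow_def by (intro table_intros)
qed

lemma rpow_less:
  assumes "valid_table 1 D t" "0 < D" "x < tsz t"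
  shows "rpow t x i < tsz t"
proof (induction i)
  case (Suc i)
  then show ?case
    using assms valid_table_let[OF assms(1), of 0 0] by (simp add: rpow_simps valid_table_def)
qed (use assms in \<open>simp add: rpow_simps\<close>)

lemma rpow_add: "rpow t x (i + j) = rpow t (rpow t x i) j"
  by (induction j) (simp_all add: rpow_simps)

lemma seg_rpow:
  assumes "\<And>n. i < n \<Longrightarrow> n \<le> i + k \<Longrightarrow> a n = tlet t 0 0"
  shows "seg (tmul t) a i (Suc (i + k)) = rpow t (a i) k"
  using assms
proof (induction k)
  case (Suc k)
  then have "seg (tmul t) a i (Suc (i + k)) = rpow t (a i) k" by simp
  then show ?case using Suc.prems[of "Suc (i + k)"] by (simp add: rpow_simps)
qed (simp add: rpow_simps)

text \<open>Since \<open>rpow\<close> starts with one letter, the exponent of the idempotent power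
  is \<open>Suc (idem_index D t)\<close>; this is the modulus for gap lengths.\<close>

definition idem_index :: "nat \<Rightarrow> nat \<Rightarrow> nat" where
  "idem_index D t = (LEAST n. valid_table 1 D t \<longrightarrow>
     tmul t (rpow t (tlet t 0 0) n) (rpow t (tlet t 0 0) n) = rpow t (tlet t 0 0) n)"

text \<open>In a factorisation of the constant word, the repeated block is idempotent and a power of
  the letter.\<close>

lemma ex_idem_index:
  assumes "0 < D"
  shows "\<exists>n. valid_table 1 D t \<longrightarrow>
     tmul t (rpow t (tlet t 0 0) n) (rpow t (tlet t 0 0) n) = rpow t (tlet t 0 0) n"
proof (cases "valid_table 1 D t")
  case True
  note sg = valid_table_semigroup[OF True]
  have a: "tlet t 0 0 \<in> {..<tsz t}"
    using valid_table_let[OF True] assms by simp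
  have inf: "infinite {0::nat<..}" "0 \<notin> {0::nat<..}"
    by (auto simp: infinite_Ioi)
  obtain x y where xy: "x < y"
    "factor (tmul t) (\<lambda>n. tlet t 0 0) (seg (tmul t) (\<lambda>n. tlet t 0 0) 0 x) (seg (tmul t) (\<lambda>n. tlet t 0 0) x y)"
    using factor_exists[of "{..<tsz t}" "tmul t" "\<lambda>n. tlet t 0 0" "{0<..}", OF finite_lessThan sg a inf]
    by blast
  obtain k where y: "y = Suc (x + k)" using xy(1) less_imp_Suc_add by blast
  have "seg (tmul t) (\<lambda>n. tlet t 0 0) x y = rpow t (tlet t 0 0) k"
    unfolding y by (rule seg_rpow) simp
  then show ?thesis
    using factor_linked(4)[of "{..<tsz t}" "tmul t" "\<lambda>n. tlet t 0 0", OF sg a xy(2)] by auto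
qed simp

lemma idem_index:
  assumes "valid_table 1 D t" "0 < D"
  shows "tmul t (rpow t (tlet t 0 0) (idem_index D t)) (rpow t (tlet t 0 0) (idem_index D t)) =
    rpow t (tlet t 0 0) (idem_index D t)"
  unfolding idem_index_def using LeastI_ex[OF ex_idem_index[OF assms(2), of t]] assms(1) by blast

lemma recfun_idem_index:
  assumes "0 < D"
  shows "recfun (\<lambda>e. idem_index D (e 0))"
  unfolding idem_index_def
proof (rule recfun_Least[of "\<lambda>n e. valid_table 1 D (e 0) \<longrightarrow>
     tmul (e 0) (rpow (e 0) (tlet (e 0) 0 0) n) (rpow (e 0) (tlet (e 0) 0 0) n) = rpow (e 0) (tlet (e 0) 0 0) n"])
  show "decpred (\<lambda>e. valid_table 1 D (e (Suc 0)) \<longrightarrow>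
     tmul (e (Suc 0)) (rpow (e (Suc 0)) (tlet (e (Suc 0)) 0 0) (e 0)) (rpow (e (Suc 0)) (tlet (e (Suc 0)) 0 0) (e 0)) =
     rpow (e (Suc 0)) (tlet (e (Suc 0)) 0 0) (e 0))"
    by (intro table_intros decpred_valid_table recfun_rpow)
qed (rule ex_idem_index[OF assms])

lemma eff_factor_zero: "eff_factor 1 (\<lambda>n. 0)"
proof -
  define F where "F t = rpow t (tlet t 0 0) (idem_index 1 t)" for t
  have "computable F"
    unfolding recfun_computable_iff F_def
    by (intro recfun_rpow recfun_tlet recfun_idem_index rec_intros) simp
  moreover have "factor (tmul t) (\<lambda>n. tlet t 0 0) (F t) (F t)" if v: "valid_table 1 1 t" for t
  \<comment> \<open>All blocks have length \<open>Suc (idem_index 1 t)\<close>, so each of them,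
    including the first, has the same idempotent product.\<close>
  proof (rule factorI[of "{..<tsz t}" "tmul t" "\<lambda>n. tlet t 0 0" "\<lambda>i. Suc i * Suc (idem_index 1 t)"])
    show "semigroup_on {..<tsz t} (tmul t)" by (rule valid_table_semigroup[OF v])
    show "tlet t 0 0 \<in> {..<tsz t}" using valid_table_let[OF v] by simp
    show "strict_mono (\<lambda>i. Suc i * Suc (idem_index 1 t))" by (simp add: strict_mono_Suc_iff)
    show "seg (tmul t) (\<lambda>n. tlet t 0 0) 0 (Suc 0 * Suc (idem_index 1 t)) = F t"
      using seg_rpow[of 0 "idem_index 1 t" "\<lambda>n. tlet t 0 0" t] by (simp add: F_def del: seg.simps)
    show "seg (tmul t) (\<lambda>n. tlet t 0 0) (Suc i * Suc (idem_index 1 t)) (Suc (Suc i) * Suc (idem_index 1 t)) = F t" for i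
      using seg_rpow[of "Suc i * Suc (idem_index 1 t)" "idem_index 1 t" "\<lambda>n. tlet t 0 0" t]
      by (simp add: F_def algebra_simps del: seg.simps)
    show "tmul t (F t) (F t) = F t" "tmul t (F t) (F t) = F t"
      unfolding F_def by (rule idem_index[OF v], simp)+
  qed simp
  ultimately show ?thesis unfolding eff_factor_def by auto
qed

text \<open>The quotient of the additive monoid by \<open>2 q = q\<close>. As a power of a letter is idempotent, no other
  instance of contractivity is needed.\<close>

definition cyc :: "nat \<Rightarrow> nat \<Rightarrow> nat" where
  "cyc q n = (if n < q then n else q + n mod q)"

lemma cyc_less: "0 < q \<Longrightarrow> cyc q n < 2 * q"
  by (simp add: cyc_def)

lemma cyc_mod: "cyc q n mod q = n mod q"
  by (simp add: cyc_def)

text \<open>Compatibility of the quotient with addition; associativity and the morphism law both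
  rest on it.\<close>

lemma cyc_add: "cyc q (cyc q x + y) = cyc q (x + y)"
proof (cases "x < q")
  case True
  then show ?thesis by (simp add: cyc_def)
next
  case False
  then have "cyc q x + y \<ge> q" "x + y \<ge> q" by (auto simp: cyc_def)
  moreover have "(cyc q x + y) mod q = (x + y) mod q"
    by (metis cyc_mod mod_add_left_eq)
  ultimately show ?thesis by (simp add: cyc_def[of q "cyc q x + y"] cyc_def[of q "x + y"])
qed

text \<open>A counter that is reset at the divisor. For divisor 0 it never is, in accordance with
  \<open>m mod 0 = m\<close>.\<close>

lemma recfun_mod: "recfun A \<Longrightarrow> recfun B \<Longrightarrow> recfun (\<lambda>e. A e mod B e)"
proof (rule recfun_app2[where f = "(mod)"])
  have "rec_nat 0 (\<lambda>k r. if Suc r = n then 0 else Suc r) m = m mod n" for m n :: nat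
    by (induction m) (auto simp: mod_Suc)
  moreover have "recfun (\<lambda>e. rec_nat 0 (\<lambda>k r. if Suc r = e (Suc 0) then 0 else Suc r) (e 0))"
    by (intro rec_intros)
  ultimately show "recfun (\<lambda>e. e 0 mod e (Suc 0))" by simp
qed

lemma recfun_cyc: "recfun A \<Longrightarrow> recfun B \<Longrightarrow> recfun (\<lambda>e. cyc (A e) (B e))"
  unfolding cyc_def by (intro rec_intros recfun_mod)

definition cyc_monoid :: "nat \<Rightarrow> nat monoid" where
  "cyc_monoid q = \<lparr>carrier = {..<2 * q}, monoid.mult = (\<lambda>x y. cyc q (x + y)), one = 0\<rparr>"

lemma cyc_morphism:
  assumes "0 < q"
  shows "monoid_morphism nat_add_monoid (cyc_monoid q) (cyc q)"
proof -
  have "monoid nat_add_monoid"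
    by (unfold_locales) (auto simp: nat_add_monoid_def)
  moreover have "monoid (cyc_monoid q)"
  proof
    fix x y z
    have "cyc q (cyc q (x + y) + z) = cyc q (x + cyc q (y + z))"
      using cyc_add[of q "x + y" z] cyc_add[of q "y + z" x] by (simp add: ac_simps)
    then show "x \<otimes>\<^bsub>cyc_monoid q\<^esub> y \<otimes>\<^bsub>cyc_monoid q\<^esub> z = x \<otimes>\<^bsub>cyc_monoid q\<^esub> (y \<otimes>\<^bsub>cyc_monoid q\<^esub> z)"
      by (simp add: cyc_monoid_def)
  next
    fix x assume "x \<in> carrier (cyc_monoid q)"
    then have "cyc q x = x"
      by (auto simp: cyc_monoid_def cyc_def mod_if)
    then show "\<one>\<^bsub>cyc_monoid q\<^esub> \<otimes>\<^bsub>cyc_monoid q\<^esub> x = x" "x \<otimes>\<^bsub>cyc_monoid q\<^esub> \<one>\<^bsub>cyc_monoid q\<^esub> = x"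
      by (simp_all add: cyc_monoid_def)
  qed (use assms cyc_less in \<open>auto simp: cyc_monoid_def\<close>)
  moreover have "cyc q (x + y) = cyc q (cyc q x + cyc q y)" for x y
    using cyc_add[of q x y] cyc_add[of q y "cyc q x"] by (simp add: ac_simps)
  then have "cyc q \<in> hom nat_add_monoid (cyc_monoid q)"
    using assms cyc_less by (auto simp: hom_def nat_add_monoid_def cyc_monoid_def)
  moreover have "cyc q 0 = 0" using assms by (simp add: cyc_def)
  ultimately show ?thesis
    by (simp add: monoid_morphism_def nat_add_monoid_def cyc_monoid_def)
qed

text \<open>The code is found by search: its length and its entries determine it uniquely.\<close>

lemma ex_cyc_code:
  obtains mc where "computable mc" "\<And>q. mc q = morphism_code (cyc_monoid q) (cyc q)"
proof -
  define xs where "xs q = 2 * q # 0 # cyc q 1 #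
      map (\<lambda>(x, y). cyc q (x + y)) (List.product [0..<2 * q] [0..<2 * q])" for q
  \<comment> \<open>Three leading entries (size, unit, image of 1) precede the multiplication table,
    whose rows have length \<open>2 * q\<close>.\<close>
  define ok where "ok q u \<longleftrightarrow> code_length u = 3 + 2 * q * (2 * q) \<and> code_nth u 0 = 2 * q \<and>
     code_nth u 1 = 0 \<and> code_nth u 2 = cyc q 1 \<and>
     (\<forall>x<2 * q. \<forall>y<2 * q. code_nth u (3 + x * (2 * q) + y) = cyc q (x + y))" for q u
  have len: "length (xs q) = 3 + 2 * q * (2 * q)" for q by (simp add: xs_def)
  have nth: "xs q ! (3 + x * (2 * q) + y) = cyc q (x + y)" if "x < 2 * q" "y < 2 * q" for q x y
  proof -
    have "x * (2 * q) + y < 2 * q * (2 * q)"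
      using that mult_le_mono1[of "Suc x" "2 * q" "2 * q"] by simp
    moreover have "(x * (2 * q) + y) div (2 * q) = x" "(x * (2 * q) + y) mod (2 * q) = y"
      using that by simp_all
    ultimately have "List.product [0..<2 * q] [0..<2 * q] ! (x * (2 * q) + y) = (x, y)"
      using product_nth[of "x * (2 * q) + y" "[0..<2 * q]" "[0..<2 * q]"] that by simp
    moreover have "xs q ! (3 + x * (2 * q) + y) =
        map (\<lambda>(x, y). cyc q (x + y)) (List.product [0..<2 * q] [0..<2 * q]) ! (x * (2 * q) + y)"
      by (simp add: xs_def numeral_3_eq_3)
    ultimately show ?thesis
      using \<open>x * (2 * q) + y < 2 * q * (2 * q)\<close> by simp
  qed
  have ok_xs: "ok q (list_encode (xs q))" for q
  proof -
    have "code_nth (list_encode (xs q)) (3 + x * (2 * q) + y) = cyc q (x + y)"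
      if "x < 2 * q" "y < 2 * q" for x y
    proof -
      have "3 + x * (2 * q) + y < length (xs q)"
        using that mult_le_mono1[of "Suc x" "2 * q" "2 * q"] len by simp
      then show ?thesis using nth[OF that] by (simp add: code_nth_list_encode)
    qed
    moreover have "code_nth (list_encode (xs q)) i = xs q ! i" if "i < 3" for i
      using that len by (simp add: code_nth_list_encode)
    from this[of 0] this[of 1] this[of 2]
    have "code_nth (list_encode (xs q)) 0 = 2 * q" "code_nth (list_encode (xs q)) 1 = 0"
        "code_nth (list_encode (xs q)) 2 = cyc q 1"
      by (simp_all add: xs_def numeral_2_eq_2)
    ultimately show ?thesis
      unfolding ok_def by (simp add: code_length_list_encode len)
  qed
  have uniq: "u = list_encode (xs q)" if "ok q u" for q u
  proof -
    obtain ys where u: "u = list_encode ys" by (metis list_decode_inverse)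
    have len_ys: "length ys = 3 + 2 * q * (2 * q)"
      using that by (simp add: ok_def u code_length_list_encode)
    have "ys ! i = xs q ! i" if i: "i < 3 + 2 * q * (2 * q)" for i
    proof -
      have nth_ys: "code_nth u i = ys ! i" using i len_ys by (simp add: u code_nth_list_encode)
      have nth_xs: "code_nth (list_encode (xs q)) i = xs q ! i"
        using i len by (simp add: code_nth_list_encode)
      consider "i = 0" | "i = 1" | "i = 2" | "3 \<le> i" by linarith
      then have "code_nth u i = code_nth (list_encode (xs q)) i"
      proof cases
        case 4
        define k where "k = i - 3"
        have k: "k < 2 * q * (2 * q)" "i = 3 + k" using i 4 by (auto simp: k_def)
        then have "k div (2 * q) < 2 * q" "k mod (2 * q) < 2 * q"
          by (auto simp: less_mult_imp_div_less intro!: mod_less_divisor gr0I)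
        moreover have "i = 3 + (k div (2 * q)) * (2 * q) + k mod (2 * q)"
          using k(2) div_mult_mod_eq[of k "2 * q"] by linarith
        ultimately show ?thesis
          using \<open>ok q u\<close> ok_xs[of q] unfolding ok_def by metis
      qed (use \<open>ok q u\<close> ok_xs[of q] in \<open>simp_all add: ok_def\<close>)
      then show ?thesis using nth_ys nth_xs by simp
    qed
    then have "ys = xs q" using len_ys len by (intro nth_equalityI) auto
    then show ?thesis by (simp add: u)
  qed
  define mc where "mc q = (LEAST u. ok q u)" for q
  have ex: "\<exists>u. ok q u" for q using ok_xs by blast
  have "ok q (mc q)" for q unfolding mc_def using ex by (rule LeastI_ex)
  then have "mc q = list_encode (xs q)" for q using uniq by blast
  then have "mc q = morphism_code (cyc_monoid q) (cyc q)" for q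
    by (simp add: morphism_code_def cyc_monoid_def xs_def Let_def)
  moreover have "decpred (\<lambda>e. ok (e (Suc 0)) (e 0))"
    unfolding ok_def by (intro rec_intros recfun_code_length recfun_code_nth recfun_cyc)
  then have "recfun (\<lambda>e. mc (e 0))"
    unfolding mc_def by (intro recfun_Least[of "\<lambda>u e. ok (e 0) u"] ex) simp
  then have "computable mc" by (simp add: recfun_computable_iff)
  ultimately show thesis using that by blast
qed

lemma contractive_cyc:
  assumes "effectively_contractive g"
  obtains K p where "computable K" "computable p" "\<And>q. 0 < q \<Longrightarrow> 0 < p q"
    "\<And>q n. 0 < q \<Longrightarrow> K q \<le> n \<Longrightarrow>
      cyc q (g (Suc (n + p q)) - g (n + p q) - 1) = cyc q (g (Suc n) - g n - 1)"
proof -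
  obtain pre per where pp: "computable pre" "computable per"
    and up: "\<And>(M :: nat monoid) m h. carrier M = {..<m} \<and> monoid_morphism nat_add_monoid M h \<Longrightarrow>
        ultimately_periodic_with (pre (morphism_code M h)) (per (morphism_code M h))
          (\<lambda>n. h (g (n + 1) - g n - 1))"
    using assms unfolding effectively_contractive_def by blast
  obtain mc where mc: "computable mc" "\<And>q. mc q = morphism_code (cyc_monoid q) (cyc q)"
    by (rule ex_cyc_code) blast
  have up: "ultimately_periodic_with (pre (mc q)) (per (mc q)) (\<lambda>n. cyc q (g (n + 1) - g n - 1))"
    if "0 < q" for q
    unfolding mc(2) by (rule up[of _ "2 * q"]) (use cyc_morphism[OF that] in \<open>simp add: cyc_monoid_def\<close>)
  show thesis
  proof (rule that[of "\<lambda>q. pre (mc q)" "\<lambda>q. per (mc q)"])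
    show "computable (\<lambda>q. pre (mc q))" "computable (\<lambda>q. per (mc q))"
      using pp mc(1) unfolding recfun_computable_iff
      by (auto intro: recfun_app1[of pre "\<lambda>e. mc (e 0)"] recfun_app1[of per "\<lambda>e. mc (e 0)"])
  qed (use up in \<open>auto simp: ultimately_periodic_with_def\<close>)
qed

text \<open>The \<open>q\<close>-th power of the letter is idempotent, so from \<open>q\<close> on
  the exponent matters only modulo \<open>q\<close>.\<close>

lemma rpow_cyc:
  assumes v: "valid_table 1 D t" and "0 < D" "x < tsz t" and q: "q = Suc (idem_index D t)"
  shows "rpow t x (cyc q n) = rpow t x n"
proof -
  note sg = valid_table_semigroup[OF v]
  define a where "a = tlet t 0 0"
  have a: "a < tsz t" unfolding a_def using valid_table_let[OF v] assms(2) by simp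
  have lt: "rpow t y i < tsz t" if "y < tsz t" for y i
    by (rule rpow_less[OF v assms(2) that])
  have assoc: "tmul t (tmul t u y) z = tmul t u (tmul t y z)" if "u < tsz t" "y < tsz t" "z < tsz t" for u y z
    using v that by (simp add: valid_table_def)
  have Suc_rpow: "rpow t y (Suc i) = tmul t y (rpow t a i)" if "y < tsz t" for y i
  proof (induction i)
    case (Suc i)
    have "rpow t y (Suc (Suc i)) = tmul t (tmul t y (rpow t a i)) a"
      using Suc by (simp add: rpow_simps a_def)
    then show ?case using assoc[OF that lt[OF a] a] by (simp add: rpow_simps a_def)
  qed (simp add: rpow_simps a_def)
  define e where "e = rpow t a (idem_index D t)"
  have e: "tmul t e e = e" "e < tsz t"
    unfolding e_def using lt[OF a] idem_index[OF v assms(2)] by (auto simp: a_def)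
  have rq: "rpow t y q = tmul t y e" if "y < tsz t" for y
    unfolding q e_def by (rule Suc_rpow[OF that])
  have *: "rpow t x (q + k * q) = rpow t x q" for k
  proof (induction k)
    case (Suc k)
    have "rpow t x (q + Suc k * q) = rpow t (rpow t x (q + k * q)) q"
      unfolding rpow_add[symmetric] by (simp add: ac_simps)
    also have "\<dots> = tmul t (tmul t x e) e"
      unfolding Suc using rq[OF lt[OF assms(3), of q]] rq[OF assms(3)] by simp
    also have "\<dots> = rpow t x q"
      using assoc[OF assms(3) e(2) e(2)] e(1) rq[OF assms(3)] by simp
    finally show ?case .
  qed simp
  show ?thesis
  proof (cases "n < q")
    case True
    then show ?thesis by (simp add: cyc_def)
  next
    case False
    then have "0 < n div q" using q by (simp add: div_greater_zero_iff)
    then obtain k where k: "n div q = Suc k" by (cases "n div q") auto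
    have "n = (n div q) * q + n mod q" by (rule div_mult_mod_eq[symmetric])
    then have n: "n = (q + k * q) + n mod q" unfolding k by simp
    have "rpow t x n = rpow t (rpow t x (q + k * q)) (n mod q)"
      by (subst n) (rule rpow_add)
    also have "\<dots> = rpow t x (q + n mod q)"
      using *[of k] by (simp add: rpow_add)
    finally show ?thesis using False by (simp add: cyc_def)
  qed
qed

section \<open>Lifting factorisations along a contractive function\<close>

text \<open>An element of \<open>t'\<close> acts on the positions \<open>i < L\<close> of the ultimately periodic gap sequence: read from
  position \<open>i\<close>, it moves to \<open>tmark t' 0 x i\<close> and has the value \<open>tmark t' 1 x i\<close> in \<open>t\<close>, each letter \<open>j\<close>
  standing for the letter \<open>Suc j\<close> followed by a gap of zeros.\<close>

definition ok_lift :: "(nat \<Rightarrow> nat) \<Rightarrow> nat \<Rightarrow> nat \<Rightarrow> nat \<Rightarrow> nat \<Rightarrow> nat \<Rightarrow> bool" where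
  "ok_lift g D K L t t' \<longleftrightarrow> valid_table 1 D t' \<and>
     (\<forall>x<tsz t'. \<forall>y<tsz t'. \<forall>i<L.
        tmark t' 0 (tmul t' x y) i = tmark t' 0 y (tmark t' 0 x i) \<and>
        tmark t' 1 (tmul t' x y) i = tmul t (tmark t' 1 x i) (tmark t' 1 y (tmark t' 0 x i))) \<and>
     (\<forall>j<D. \<forall>i<L.
        tmark t' 0 (tlet t' 0 j) i = (if Suc i < L then Suc i else K) \<and>
        tmark t' 1 (tlet t' 0 j) i = rpow t (tlet t 0 (Suc j)) (g (Suc i) - g i - 1))"

text \<open>The witness consists of maps from a position to the next position and an output,
  composed like the runs of a transducer. Taking them extensional makes the set finite.\<close>

lemma ex_ok_lift:
  assumes v: "valid_table 1 (Suc D) t" and "K < L"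
  shows "\<exists>t'. ok_lift g D K L t t'"
proof -
  define X where "X = {..<L} \<rightarrow>\<^sub>E {..<L} \<times> {..<tsz t}"
  define f where "f F G = (\<lambda>i\<in>{..<L}. (fst (G (fst (F i))), tmul t (snd (F i)) (snd (G (fst (F i))))))"
    for F G :: "nat \<Rightarrow> nat \<times> nat"
  define l where "l b j = (\<lambda>i\<in>{..<L}. (if Suc i < L then Suc i else K,
      rpow t (tlet t 0 (Suc j)) (g (Suc i) - g i - 1)))" for b j :: nat
  define mk where "mk k F i = (if k = 0 then fst (F i) else snd (F i))"
    for k i :: nat and F :: "nat \<Rightarrow> nat \<times> nat"
  note sgt = valid_table_semigroup[OF v, unfolded semigroup_on_def]
  have XD: "fst (F i) < L" "snd (F i) < tsz t" if "F \<in> X" "i < L" for F i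
    using that unfolding X_def by (auto simp: PiE_def Pi_def mem_Times_iff)
  have fX: "f F G \<in> X" if "F \<in> X" "G \<in> X" for F G
    using sgt XD that unfolding X_def by (auto simp: f_def)
  have sg: "semigroup_on X f"
    unfolding semigroup_on_def
  proof (intro conjI ballI)
    fix F G H assume FGH: "F \<in> X" "G \<in> X" "H \<in> X"
    show "f (f F G) H = f F (f G H)"
    proof
      fix i
      show "f (f F G) H i = f F (f G H) i"
      proof (cases "i < L")
        case True
        note XD(1)[OF FGH(1) True]
        moreover note XD(1)[OF FGH(2) this]
        ultimately show ?thesis
          using True sgt XD(2) FGH by (simp add: f_def)
      qed (simp add: f_def)
    qed
  qed (rule fX)
  have X: "finite X" by (simp add: X_def finite_PiE)
  have l: "l b j \<in> X" if "b < 1" "j < D" for b j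
    using that assms(2) rpow_less[OF v] valid_table_let[OF v, of 0 "Suc j"] by (simp add: l_def X_def)
  obtain t' h where t': "valid_table 1 D t'" "bij_betw h {..<tsz t'} X"
    "\<And>x y. x < tsz t' \<Longrightarrow> y < tsz t' \<Longrightarrow> h (tmul t' x y) = f (h x) (h y)"
    "\<And>b j. b < 1 \<Longrightarrow> j < D \<Longrightarrow> h (tlet t' b j) = l b j"
    "\<And>x y. x < tsz t' \<Longrightarrow> y < tsz t' \<Longrightarrow> tacc t' x y \<longleftrightarrow> True"
    "\<And>k x y. k < (2::nat) \<Longrightarrow> x < tsz t' \<Longrightarrow> y < L \<Longrightarrow> tmark t' k x y = mk k (h x) y"
    using ex_table[of X f 1 D l "\<lambda>_ _. True" 2 L mk, OF X sg l] by blast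
  have hX: "h x \<in> X" if "x < tsz t'" for x
    using t'(2) that by (auto simp: bij_betw_def)
  have mul_lt: "tmul t' x y < tsz t'" if "x < tsz t'" "y < tsz t'" for x y
    using t'(1) that by (simp add: valid_table_def)
  have "ok_lift g D K L t t'"
    unfolding ok_lift_def
  proof (intro conjI allI impI)
    fix x y i assume *: "x < tsz t'" "y < tsz t'" "i < L"
    have "fst (h x i) < L" using XD(1)[OF hX[OF *(1)] *(3)] .
    then show "tmark t' 0 (tmul t' x y) i = tmark t' 0 y (tmark t' 0 x i)"
      "tmark t' 1 (tmul t' x y) i = tmul t (tmark t' 1 x i) (tmark t' 1 y (tmark t' 0 x i))"
      using t'(3,6) mul_lt * by (simp_all add: mk_def f_def)
  next
    fix j i assume *: "j < D" "i < L"
    show "tmark t' 0 (tlet t' 0 j) i = (if Suc i < L then Suc i else K)"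
      "tmark t' 1 (tlet t' 0 j) i = rpow t (tlet t 0 (Suc j)) (g (Suc i) - g i - 1)"
      using t'(4,6) valid_table_let[OF t'(1)] * by (simp_all add: mk_def l_def)
  qed (rule t'(1))
  then show ?thesis by blast
qed

section \<open>Positions on the lasso of gaps\<close>

text \<open>The walk 0, 1, ..., \<open>L - 1\<close> that then returns to \<open>K\<close>: the
  representative of \<open>n\<close> for pre-period \<open>K\<close> and period
  \<open>L - K\<close>.\<close>

primrec cpos :: "nat \<Rightarrow> nat \<Rightarrow> nat \<Rightarrow> nat" where
  "cpos K L 0 = 0"
| "cpos K L (Suc n) = (if Suc (cpos K L n) < L then Suc (cpos K L n) else K)"

lemma cpos_less: "K < L \<Longrightarrow> cpos K L n < L"
  by (induction n) auto

text \<open>\<open>k\<close> counts the returns to \<open>K\<close>; after the first one the walk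
  stays at \<open>K\<close> or above.\<close>

lemma cpos_period: "\<exists>k. n = cpos K (K + p) n + k * p \<and> (0 < k \<longrightarrow> K \<le> cpos K (K + p) n)" if "0 < p"
proof (induction n)
  case (Suc n)
  then obtain k where k: "n = cpos K (K + p) n + k * p" "0 < k \<longrightarrow> K \<le> cpos K (K + p) n" by blast
  show ?case
  proof (cases "Suc (cpos K (K + p) n) < K + p")
    case True
    then show ?thesis using k by (intro exI[of _ k]) auto
  next
    case False
    have "cpos K (K + p) n < K + p" by (rule cpos_less) (use that in simp)
    then have "Suc (cpos K (K + p) n) = K + p" using False by simp
    then show ?thesis using k False by (intro exI[of _ "Suc k"]) auto
  qed
qed (intro exI[of _ 0], simp)

lemma periodic_cpos:
  assumes "0 < p" "\<And>n. K \<le> n \<Longrightarrow> s (n + p) = s n"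
  shows "s (cpos K (K + p) n) = s n"
proof -
  have *: "s (m + k * p) = s m" if "K \<le> m" for m k
  proof (induction k)
    case (Suc k)
    then show ?case using assms(2)[of "m + k * p"] that by (simp add: ac_simps)
  qed simp
  obtain k where k: "n = cpos K (K + p) n + k * p" "0 < k \<longrightarrow> K \<le> cpos K (K + p) n"
    using cpos_period[OF assms(1)] by blast
  then show ?thesis using *[of "cpos K (K + p) n" k] by (cases "k = 0") auto
qed

context
  fixes g \<alpha> \<beta> :: "nat \<Rightarrow> nat" and D K p t t' :: nat
  assumes g: "strict_mono g" and \<alpha>: "\<And>n. \<alpha> (g n) = Suc (\<beta> n)" "\<And>n. n \<notin> range g \<Longrightarrow> \<alpha> n = 0"
    and \<beta>: "\<And>n. \<beta> n < D"
    and v: "valid_table 1 (Suc D) t" and p: "0 < p"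
    and per: "\<And>n. K \<le> n \<Longrightarrow> cyc (Suc (idem_index (Suc D) t)) (g (Suc (n + p)) - g (n + p) - 1) =
      cyc (Suc (idem_index (Suc D) t)) (g (Suc n) - g n - 1)"
    and ok: "ok_lift g D K (K + p) t t'"
begin

lemma \<alpha>_less: "\<alpha> n < Suc D"
  using \<alpha>(1)[of "inv_into UNIV g n"] \<alpha>(2)[of n] \<beta>[of "inv_into UNIV g n"] by (cases "n \<in> range g") (auto simp: f_inv_into_f)

lemma letter_in: "tlet t 0 (\<alpha> n) \<in> {..<tsz t}"
  using valid_table_let[OF v _ \<alpha>_less] by simp

lemma \<alpha>_gap: "g i < n \<Longrightarrow> n < g (Suc i) \<Longrightarrow> \<alpha> n = 0"
proof (rule \<alpha>(2))
  assume *: "g i < n" "n < g (Suc i)"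
  show "n \<notin> range g"
  proof
    assume "n \<in> range g"
    then obtain k where "n = g k" by blast
    then show False using * strict_mono_less[OF g] by simp
  qed
qed

lemma g_Suc: "g (Suc i) = Suc (g i + (g (Suc i) - g i - 1))"
  using strict_mono_less[OF g, of i "Suc i"] by simp

lemma seg_gap: "seg (tmul t) (\<lambda>n. tlet t 0 (\<alpha> n)) (g i) (g (Suc i)) =
    rpow t (tlet t 0 (Suc (\<beta> i))) (g (Suc i) - g i - 1)"
proof -
  have "seg (tmul t) (\<lambda>n. tlet t 0 (\<alpha> n)) (g i) (Suc (g i + (g (Suc i) - g i - 1))) =
    rpow t (tlet t 0 (\<alpha> (g i))) (g (Suc i) - g i - 1)"
    by (rule seg_rpow) (use \<alpha>_gap[of i] g_Suc[of i] in auto)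
  then show ?thesis using g_Suc[of i] \<alpha>(1) by simp
qed

text \<open>Reading \<beta> in \<open>t'\<close> from the right lasso position simulates reading
  \<alpha> in \<open>t\<close> between the images under \<open>g\<close>.\<close>

lemma seg_lift:
  assumes "i < j"
  shows "tmark t' 0 (seg (tmul t') (\<lambda>n. tlet t' 0 (\<beta> n)) i j) (cpos K (K + p) i) = cpos K (K + p) j \<and>
    tmark t' 1 (seg (tmul t') (\<lambda>n. tlet t' 0 (\<beta> n)) i j) (cpos K (K + p) i) =
      seg (tmul t) (\<lambda>n. tlet t 0 (\<alpha> n)) (g i) (g j)"
proof -
  have v': "valid_table 1 D t'" using ok by (simp add: ok_lift_def)
  have L: "cpos K (K + p) n < K + p" for n
    by (rule cpos_less) (use p in simp)
  have let_in: "tlet t' 0 (\<beta> n) \<in> {..<tsz t'}" for n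
    using valid_table_let[OF v' _ \<beta>] by simp
  have letter: "tmark t' 0 (tlet t' 0 (\<beta> n)) (cpos K (K + p) n) = cpos K (K + p) (Suc n)"
    "tmark t' 1 (tlet t' 0 (\<beta> n)) (cpos K (K + p) n) =
      seg (tmul t) (\<lambda>n. tlet t 0 (\<alpha> n)) (g n) (g (Suc n))" for n
  proof -
    let ?c = "cpos K (K + p) n" and ?q = "Suc (idem_index (Suc D) t)" and ?x = "tlet t 0 (Suc (\<beta> n))"
    have "tmark t' 0 (tlet t' 0 (\<beta> n)) ?c = (if Suc ?c < K + p then Suc ?c else K)"
      and mk: "tmark t' 1 (tlet t' 0 (\<beta> n)) ?c = rpow t ?x (g (Suc ?c) - g ?c - 1)"
      using ok \<beta>[of n] L[of n] unfolding ok_lift_def by blast+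
    then show "tmark t' 0 (tlet t' 0 (\<beta> n)) ?c = cpos K (K + p) (Suc n)" by simp
    have x: "?x < tsz t" using valid_table_let[OF v] \<beta>[of n] by simp
    \<comment> \<open>The gaps at \<open>?c\<close> and at \<open>n\<close> may differ in length.
      They agree under \<open>cyc\<close>, and a power of the zero letter depends on nothing
      else.\<close>
    have "cyc ?q (g (Suc ?c) - g ?c - 1) = cyc ?q (g (Suc n) - g n - 1)"
      by (rule periodic_cpos[of p K "\<lambda>n. cyc ?q (g (Suc n) - g n - 1)"]) (use p per in auto)
    then have "rpow t ?x (g (Suc ?c) - g ?c - 1) = rpow t ?x (g (Suc n) - g n - 1)"
      using rpow_cyc[OF v zero_less_Suc x refl, of "g (Suc ?c) - g ?c - 1"]
        rpow_cyc[OF v zero_less_Suc x refl, of "g (Suc n) - g n - 1"] by simp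
    then show "tmark t' 1 (tlet t' 0 (\<beta> n)) ?c =
      seg (tmul t) (\<lambda>n. tlet t 0 (\<alpha> n)) (g n) (g (Suc n))"
      unfolding mk seg_gap .
  qed
  show ?thesis using assms
  proof (induction j)
    case (Suc j)
    show ?case
    proof (cases "i = j")
      case True
      then show ?thesis using letter by simp
    next
      case False
      then have "i < j" using Suc.prems by simp
      let ?s = "seg (tmul t') (\<lambda>n. tlet t' 0 (\<beta> n)) i j"
      have s: "?s < tsz t'"
        using seg_in[of "{..<tsz t'}" "tmul t'" "\<lambda>n. tlet t' 0 (\<beta> n)", OF valid_table_semigroup[OF v'] let_in] by simp
      have "tmark t' 0 (tmul t' ?s (tlet t' 0 (\<beta> j))) (cpos K (K + p) i) =
            tmark t' 0 (tlet t' 0 (\<beta> j)) (tmark t' 0 ?s (cpos K (K + p) i)) \<and>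
          tmark t' 1 (tmul t' ?s (tlet t' 0 (\<beta> j))) (cpos K (K + p) i) =
            tmul t (tmark t' 1 ?s (cpos K (K + p) i))
              (tmark t' 1 (tlet t' 0 (\<beta> j)) (tmark t' 0 ?s (cpos K (K + p) i)))"
        using ok s let_in[of j] L[of i] unfolding ok_lift_def by simp
      moreover have "tmul t (seg (tmul t) (\<lambda>n. tlet t 0 (\<alpha> n)) (g i) (g j))
          (seg (tmul t) (\<lambda>n. tlet t 0 (\<alpha> n)) (g j) (g (Suc j))) =
          seg (tmul t) (\<lambda>n. tlet t 0 (\<alpha> n)) (g i) (g (Suc j))"
        by (rule seg_append[of "{..<tsz t}"])
           (use valid_table_semigroup[OF v] letter_in strict_mono_less[OF g] \<open>i < j\<close> in auto)
      moreover have "seg (tmul t') (\<lambda>n. tlet t' 0 (\<beta> n)) i (Suc j) = tmul t' ?s (tlet t' 0 (\<beta> j))"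
        using \<open>i < j\<close> by simp
      ultimately show ?thesis
        using Suc.IH[OF \<open>i < j\<close>] letter[of j] by simp
    qed
  qed simp
qed

text \<open>The new cutting positions are the images of the old ones. All old ones share one lasso
  position, as it is determined by \<open>s'\<close>, so \<open>e'\<close> has the same value at
  each of them.\<close>

lemma factor_lift:
  assumes "factor (tmul t') (\<lambda>n. tlet t' 0 (\<beta> n)) s' e'"
  shows "factor (tmul t) (\<lambda>n. tlet t 0 (\<alpha> n))
    (if g 0 = 0 then tmark t' 1 s' 0 else tmul t (rpow t (tlet t 0 0) (g 0 - 1)) (tmark t' 1 s' 0))
    (tmark t' 1 e' (tmark t' 0 s' 0))"
proof -
  obtain R where R: "infinite R" "0 \<notin> R"
    and Rs: "\<And>x. x \<in> R \<Longrightarrow> seg (tmul t') (\<lambda>n. tlet t' 0 (\<beta> n)) 0 x = s'"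
    and Re: "\<And>x y. x \<in> R \<Longrightarrow> y \<in> R \<Longrightarrow> x < y \<Longrightarrow> seg (tmul t') (\<lambda>n. tlet t' 0 (\<beta> n)) x y = e'"
    using assms unfolding factor_def by blast
  have pos: "0 < x" if "x \<in> R" for x using that R(2) by (metis neq0_conv)
  have pos_g: "g 0 < g x" if "x \<in> R" for x
    using pos[OF that] strict_mono_less[OF g] by simp
  have s: "seg (tmul t) (\<lambda>n. tlet t 0 (\<alpha> n)) (g 0) (g x) = tmark t' 1 s' 0"
    "cpos K (K + p) x = tmark t' 0 s' 0" if "x \<in> R" for x
    using seg_lift[OF pos[OF that]] Rs[OF that] by simp_all
  have "seg (tmul t) (\<lambda>n. tlet t 0 (\<alpha> n)) 0 (g x) =
    (if g 0 = 0 then tmark t' 1 s' 0 else tmul t (rpow t (tlet t 0 0) (g 0 - 1)) (tmark t' 1 s' 0))"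
    if "x \<in> R" for x
  proof (cases "g 0 = 0")
    case True
    then show ?thesis using s(1)[OF that] by simp
  next
    case False
    have zero: "\<alpha> n = 0" if "n < g 0" for n
    proof (rule \<alpha>(2))
      show "n \<notin> range g"
        using that strict_mono_less_eq[OF g, of 0] by (metis imageE le0 linorder_not_le)
    qed
    \<comment> \<open>The block of \<open>g 0\<close> leading zeros has exponent
      \<open>g 0 - 1\<close>, because \<open>rpow\<close> already starts with one zero. For
      \<open>g 0 = 0\<close> there is no such block, hence the case distinction.\<close>
    have "seg (tmul t) (\<lambda>n. tlet t 0 (\<alpha> n)) 0 (Suc (0 + (g 0 - 1))) = rpow t (tlet t 0 (\<alpha> 0)) (g 0 - 1)"
      by (rule seg_rpow) (use zero False in auto)
    then have "seg (tmul t) (\<lambda>n. tlet t 0 (\<alpha> n)) 0 (g 0) = rpow t (tlet t 0 0) (g 0 - 1)"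
      using False zero[of 0] by simp
    moreover have "tmul t (seg (tmul t) (\<lambda>n. tlet t 0 (\<alpha> n)) 0 (g 0))
        (seg (tmul t) (\<lambda>n. tlet t 0 (\<alpha> n)) (g 0) (g x)) = seg (tmul t) (\<lambda>n. tlet t 0 (\<alpha> n)) 0 (g x)"
      by (rule seg_append[of "{..<tsz t}"])
         (use valid_table_semigroup[OF v] letter_in pos_g[OF that] False in auto)
    ultimately show ?thesis using s(1)[OF that] False by simp
  qed
  moreover have "seg (tmul t) (\<lambda>n. tlet t 0 (\<alpha> n)) (g x) (g y) = tmark t' 1 e' (tmark t' 0 s' 0)"
    if "x \<in> R" "y \<in> R" "x < y" for x y
    using seg_lift[OF that(3)] Re[OF that] s(2)[OF that(1)] by simp
  moreover have "infinite (g ` R)"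
    using R(1) strict_mono_imp_inj_on[OF g] by (simp add: finite_image_iff inj_on_subset)
  moreover have "0 \<notin> g ` R" using pos_g by fastforce
  ultimately show ?thesis
    unfolding factor_def by (intro exI[of _ "g ` R"]) (auto simp: strict_mono_less[OF g])
qed

end

lemma eff_factor_lift:
  assumes eff: "eff_factor D \<beta>" and "computable g" "effectively_contractive g"
    and \<alpha>: "\<And>n. \<alpha> (g n) = Suc (\<beta> n)" "\<And>n. n \<notin> range g \<Longrightarrow> \<alpha> n = 0"
  shows "eff_factor (Suc D) \<alpha>"
proof -
  have g: "strict_mono g" using assms(3) by (simp add: effectively_contractive_def)
  obtain F G where FG: "computable F" "computable G" and \<beta>: "\<And>n. \<beta> n < D"
    and fac: "\<And>t. valid_table 1 D t \<Longrightarrow> factor (tmul t) (\<lambda>n. tlet t 0 (\<beta> n)) (F t) (G t)"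
    using eff unfolding eff_factor_def by blast
  obtain K p where K: "computable K" and p: "computable p" "\<And>q. 0 < q \<Longrightarrow> 0 < p q"
    and per: "\<And>q n. 0 < q \<Longrightarrow> K q \<le> n \<Longrightarrow>
      cyc q (g (Suc (n + p q)) - g (n + p q) - 1) = cyc q (g (Suc n) - g n - 1)"
    by (rule contractive_cyc[OF assms(3)]) blast
  define Q where "Q t = Suc (idem_index (Suc D) t)" for t
  \<comment> \<open>The premise keeps the search total when \<open>t\<close> is not a valid
    table.\<close>
  define ok where "ok t t' \<longleftrightarrow> (valid_table 1 (Suc D) t \<longrightarrow> ok_lift g D (K (Q t)) (K (Q t) + p (Q t)) t t')" for t t'
  have ex: "\<exists>t'. ok t t'" for t
  proof (cases "valid_table 1 (Suc D) t")
    case True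
    then show ?thesis
      using ex_ok_lift[OF True, of "K (Q t)" "K (Q t) + p (Q t)" g] p(2)[of "Q t"] by (simp add: ok_def Q_def)
  qed (simp add: ok_def)
  define T where "T t = (LEAST t'. ok t t')" for t
  have T: "ok t (T t)" for t unfolding T_def using ex by (rule LeastI_ex)
  define F' where "F' t = (if g 0 = 0 then tmark (T t) 1 (F (T t)) 0
    else tmul t (rpow t (tlet t 0 0) (g 0 - 1)) (tmark (T t) 1 (F (T t)) 0))" for t
  define G' where "G' t = tmark (T t) 1 (G (T t)) (tmark (T t) 0 (F (T t)) 0)" for t
  have "factor (tmul t) (\<lambda>n. tlet t 0 (\<alpha> n)) (F' t) (G' t)" if v: "valid_table 1 (Suc D) t" for t
  proof -
    have "ok_lift g D (K (Q t)) (K (Q t) + p (Q t)) t (T t)" using T[of t] v by (simp add: ok_def)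
    moreover from this have "valid_table 1 D (T t)" by (simp add: ok_lift_def)
    moreover have "cyc (Suc (idem_index (Suc D) t)) (g (Suc (n + p (Q t))) - g (n + p (Q t)) - 1) =
        cyc (Suc (idem_index (Suc D) t)) (g (Suc n) - g n - 1)" if "K (Q t) \<le> n" for n
      using per[of "Q t" n] that by (simp add: Q_def)
    moreover have "0 < p (Q t)" using p(2) by (simp add: Q_def)
    ultimately show ?thesis
      unfolding F'_def G'_def
      by (intro factor_lift[of g \<alpha> \<beta> D t "p (Q t)" "K (Q t)" "T t" "F (T t)" "G (T t)"] g \<alpha> \<beta> v fac)
  qed
  moreover have "\<alpha> n < Suc D" for n
    using \<alpha>(1)[of "inv_into UNIV g n"] \<alpha>(2)[of n] \<beta>[of "inv_into UNIV g n"] by (cases "n \<in> range g") (auto simp: f_inv_into_f)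
  moreover have Q: "recfun (\<lambda>e. Q (e 0))"
    unfolding Q_def by (intro recfun_Suc recfun_idem_index) simp
  have rec: "recfun (\<lambda>e. h (A e))" if "computable h" "recfun A" for h A
    using recfun_app1[of h A] that by (simp add: recfun_computable_iff)
  have KQ: "recfun (\<lambda>e. K (Q (A e)))" "recfun (\<lambda>e. p (Q (A e)))" if "recfun A" for A
    using rec[OF K] rec[OF p(1)] recfun_app1[of Q A] Q that by blast+
  have dec: "decpred (\<lambda>e. ok (e (Suc 0)) (e 0))"
    unfolding ok_def ok_lift_def
    by (intro table_intros decpred_valid_table recfun_rpow KQ rec[OF assms(2)])
  have T: "recfun (\<lambda>e. T (e 0))"
    unfolding T_def by (rule recfun_Least[of "\<lambda>t' e. ok (e 0) t'"]) (use dec ex in auto)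
  have "computable F'" "computable G'"
    unfolding recfun_computable_iff F'_def G'_def
    by (intro table_intros recfun_rpow T rec[OF FG(1)] rec[OF FG(2)])+
  ultimately show ?thesis unfolding eff_factor_def by blast
qed

section \<open>Iteration over all functions and the decision procedure\<close>

primrec level :: "(nat \<Rightarrow> nat) list \<Rightarrow> nat \<Rightarrow> nat" where
  "level [] n = 0"
| "level (g # gs) n = (if n \<in> range g then Suc (level gs (inv_into UNIV g n)) else 0)"

lemma eff_factor_level:
  assumes "\<And>g. g \<in> set gs \<Longrightarrow> computable g" "\<And>g. g \<in> set gs \<Longrightarrow> effectively_contractive g"
  shows "eff_factor (Suc (length gs)) (level gs)"
  using assms
proof (induction gs)
  case Nil
  have "level [] = (\<lambda>n. 0)" by (simp add: fun_eq_iff)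
  then show ?case using eff_factor_zero by simp
next
  case (Cons g gs)
  have "inj g" using Cons.prems(2)[of g] by (auto simp: effectively_contractive_def strict_mono_imp_inj_on)
  then have "eff_factor (Suc (Suc (length gs))) (level (g # gs))"
    using Cons by (intro eff_factor_lift[of "Suc (length gs)" "level gs" g "level (g # gs)"]) auto
  then show ?case by (simp del: level.simps)
qed

text \<open>\<open>level\<close> counts how many functions can be inverted in turn, starting with
  the outermost. By injectivity the preimages are unique, so reaching depth \<open>i\<close> means
  lying in the range of the first \<open>i\<close> functions composed.\<close>

lemma level_ge_iff:
  assumes "\<And>g. g \<in> set gs \<Longrightarrow> inj g" "1 \<le> i" "i \<le> length gs"
  shows "i \<le> level gs n \<longleftrightarrow> n \<in> range (foldr (\<circ>) (take i gs) id)"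
  using assms
proof (induction gs arbitrary: i n)
  case (Cons g gs)
  obtain k where i: "i = Suc k" using Cons.prems by (cases i) auto
  \<comment> \<open>\<open>k\<close> may be 0, where the induction hypothesis does not apply; the
    empty composition is onto.\<close>
  have IH: "k \<le> level gs m \<longleftrightarrow> m \<in> range (foldr (\<circ>) (take k gs) id)" for m
  proof (cases k)
    case (Suc k')
    show ?thesis by (rule Cons.IH) (use Cons.prems i Suc in auto)
  qed simp
  have "inj g" using Cons.prems by simp
  show ?case
  proof (cases "n \<in> range g")
    case True
    then obtain m where m: "n = g m" by blast
    moreover have "range (foldr (\<circ>) (take i (g # gs)) id) = g ` range (foldr (\<circ>) (take k gs) id)"
      unfolding i take_Suc_Cons foldr.simps o_apply[of "foldr (\<circ>) _"] image_comp by simp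
    ultimately have "n \<in> range (foldr (\<circ>) (take i (g # gs)) id) \<longleftrightarrow> k \<le> level gs m"
      using IH[of m] \<open>inj g\<close> by (simp only: inj_image_mem_iff)
    then show ?thesis
      using m \<open>inj g\<close> by (simp only: i level.simps) simp
  next
    case False
    then show ?thesis by (auto simp: i)
  qed
qed simp

theorem theorem3p14:
  fixes d :: nat and g f :: "nat \<Rightarrow> nat \<Rightarrow> nat" and P :: "nat \<Rightarrow> nat set"
  assumes "\<And>i. i \<in> {1..d} \<Longrightarrow> computable (g i)"
    and "\<And>i. i \<in> {1..d} \<Longrightarrow> effectively_contractive (g i)"
    and "\<And>i. i \<in> {1..d} \<Longrightarrow> f i = foldr (\<circ>) (map g [1..<Suc i]) id"
    and "\<And>i. i \<in> {1..d} \<Longrightarrow> P i = {f i n | n. True}"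
  shows "mso_theory_decidable d P"
proof -
  define gs where "gs = map g [1..<Suc d]"
  define w where "w = level gs"
  have len: "length gs = d" by (simp add: gs_def)
  have mem: "\<exists>i\<in>{1..d}. h = g i" if "h \<in> set gs" for h
    using that by (auto simp: gs_def)
  have eff: "eff_factor (Suc d) w"
    using eff_factor_level[of gs] mem assms(1,2) len unfolding w_def by metis
  have inj: "inj h" if "h \<in> set gs" for h
    using mem[OF that] assms(2) by (auto simp: effectively_contractive_def strict_mono_imp_inj_on)
  have P: "P i = {n. i \<le> w n}" if "i \<in> {1..d}" for i
  proof -
    have "take i gs = map g [1..<Suc i]"
      using that by (simp add: gs_def take_map take_upt del: upt_Suc)
    then have "i \<le> w n \<longleftrightarrow> n \<in> range (f i)" for n
      using level_ge_iff[of gs i n] inj that len assms(3)[OF that] by (simp add: w_def)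
    then show ?thesis using assms(4)[OF that] by auto
  qed
  obtain F G where FG: "computable F" "computable G" and w: "\<And>n. w n < Suc d"
    and fac: "\<And>t. valid_table 1 (Suc d) t \<Longrightarrow> factor (tmul t) (\<lambda>n. tlet t 0 (w n)) (F t) (G t)"
    using eff unfolding eff_factor_def by blast
  obtain tab where tab: "computable tab"
    "\<And>w \<phi>. (\<And>n. w n < Suc d) \<Longrightarrow> recog (2 * mso_code \<phi> + 2) w (tab (mso_code \<phi>)) \<phi>"
    "\<And>c. valid_table (2 ^ (2 * c + 2)) (Suc d) (tab c)"
    by (rule ex_recognizer[of "Suc d"]) blast
  define decide where "decide c = (of_bool (tacc (tab c) (F (tab c)) (G (tab c))) :: nat)" for c
  have "computable decide"
  proof -
    have t: "recfun (\<lambda>e. tab (e 0))" using tab(1) by (simp add: recfun_computable_iff)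
    show ?thesis
      unfolding recfun_computable_iff decide_def
      by (intro table_intros t recfun_app1[of F, OF _ t] recfun_app1[of G, OF _ t]
          FG[unfolded recfun_computable_iff])
  qed
  moreover have "decide (mso_code \<phi>) = (if \<phi> \<in> mso_theory d P then 1 else 0)" if "mso_sentence d \<phi>" for \<phi>
  proof -
    let ?t = "tab (mso_code \<phi>)"
    \<comment> \<open>A table for all masks is in particular one for the mask 0, which is all that
      \<open>F\<close> and \<open>G\<close> ask for.\<close>
    have "valid_table 1 (Suc d) ?t"
      using tab(3)[of "mso_code \<phi>"] unfolding valid_table_def by simp
    from fac[OF this] have "sat_sets w (vset (\<lambda>_. 0)) \<phi> \<longleftrightarrow> tacc ?t (F ?t) (G ?t)"
      using tab(2)[OF w, of \<phi>] unfolding recog_def by simp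
    \<comment> \<open>The word of zero masks gives every variable the empty set; this is harmless
      for a sentence, which has no free variables.\<close>
    moreover have "sat_sets w (vset (\<lambda>_. 0)) \<phi> \<longleftrightarrow> sat P e E \<phi>" for e E
    proof -
      have "sat_sets w (vset (\<lambda>_. 0)) \<phi> \<longleftrightarrow> sat (\<lambda>i. {n. i \<le> w n}) e E \<phi>"
        by (rule sat_sets_iff_sat) (use that in \<open>auto simp: mso_sentence_def\<close>)
      also have "\<dots> \<longleftrightarrow> sat P e E \<phi>"
        by (rule sat_cong) (use that P in \<open>auto simp: mso_sentence_def\<close>)
      finally show ?thesis .
    qed
    ultimately show ?thesis
      using that by (simp add: decide_def mso_theory_def)
  qed
  ultimately show ?thesis
    unfolding mso_theory_decidable_def by blast
qed

end
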